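(* Let $\mathbf j_c\in L^2(\Omega;\mathbb C^3)$ and $\mathbf u_d\in L^2(\Omega;\mathbb C^3)$ be given, and let $\alpha,\beta>0$. Then the problem $$\min_{\mathbf z\in Z} j(\mathbf z),\qquad j(\mathbf z):=\frac12\int_\Omega|\mathcal S\mathbf z-\mathbf u_d|^2\,dx+\frac{\alpha}{2}\int_\Gamma|\mathrm{curl}_\Gamma\mathbf z|^2\,dS+\frac{\beta}{2}\int_\Gamma|\mathbf z|^2\,dS,$$ has a unique solution $\overline{\mathbf z}\in Z$.
   Context: $\Omega\subset\mathbb R^3$ is a bounded connected polyhedron with Lipschitz boundary $\Gamma$ and outward unit normal $\mathbf n$; all functions are complex valued. $\boldsymbol\mu,\boldsymbol\kappa\in L^\infty(\Omega;\mathbb R^{3\times3})$ are symmetric and uniformly positive definite, and $\omega\in\mathbb R\setminus\{0\}$. $H(\mathbf{curl};\Omega)$ is the space of $\mathbf v\in L^2(\Omega)^3$ with $\mathbf{curl}\,\mathbf v\in L^2(\Omega)^3$. The tangential trace $\gamma_t\mathbf v=\mathbf v\times\mathbf n$, defined for smooth fields on $\overline\Omega$, extends continuously to $H(\mathbf{curl};\Omega)$ (with values in a negative order trace space on $\Gamma$); $H_0(\mathbf{curl};\Omega)$ is its kernel. $L^2_t(\Gamma)=\{\mathbf v\in L^2(\Gamma;\mathbb C^3):\mathbf v\cdot\mathbf n=0\text{ a.e. on }\Gamma\}$. The scalar surface curl of $\mathbf z\in L^2_t(\Gamma)$ is defined weakly by $\langle\mathrm{curl}_\Gamma\mathbf z,\varphi\rangle=\int_\Gamma\mathbf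 z\cdot(\nabla_\Gamma\varphi\times\mathbf n)\,dS$ for real-valued $\varphi\in H^1(\Gamma)$. $H(\mathrm{curl}_\Gamma;\Gamma)=\{\mathbf z\in L^2_t(\Gamma):\mathrm{curl}_\Gamma\mathbf z\in L^2(\Gamma)\}$ with norm $\|\mathbf z\|_{\mathrm{curl}_\Gamma}=\|\mathbf z\|_{L^2(\Gamma)}+\|\mathrm{curl}_\Gamma\mathbf z\|_{L^2(\Gamma)}$. The control space is $Z=\{\mathbf z\in H(\mathrm{curl}_\Gamma;\Gamma):\mathrm{curl}_\Gamma\mathbf z\in L^2_0(\Gamma)\}$, with the same norm, where $L_0^2(\Gamma)$ denotes the $L^2$ functions with zero mean. The control-to-state map $\mathcal S:Z\to H(\mathbf{curl};\Omega)\hookrightarrow L^2(\Omega)^3$ sends $\mathbf z$ to the unique $\mathbf u\in H(\mathbf{curl};\Omega)$ with $\gamma_t\mathbf u=\mathbf z\times\mathbf n$ on $\Gamma$ and $$\int_\Omega\boldsymbol\mu^{-1}\mathbf{curl}\,\mathbf u\cdot\mathbf{curl}\,\overline{\mathbf v}\,dx+\mathrm i\omega\int_\Omega\boldsymbol\kappa\mathbf u\cdot\overline{\mathbf v}\,dx=\int_\Omega\mathbf j_c\cdot\overline{\mathbf v}\,dx\quad\forall\mathbf v\in H_0(\mathbf{curl};\Omega).$$ *)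

theory Defs
  imports "HOL-Analysis.Analysis"
begin

section \<open>Complex vectors\<close>

(* a . b, without conjugation *)
definition bdot :: "complex^3 \<Rightarrow> complex^3 \<Rightarrow> complex" where
  "bdot a b = (\<Sum>i\<in>UNIV. a $ i * b $ i)"

(* a . conj b *)
definition cdot :: "complex^3 \<Rightarrow> complex^3 \<Rightarrow> complex" where
  "cdot a b = (\<Sum>i\<in>UNIV. a $ i * cnj (b $ i))"

definition cvec :: "real^3 \<Rightarrow> complex^3" where
  "cvec v = (\<chi> i. complex_of_real (v $ i))"

definition rmatvec :: "real^3^3 \<Rightarrow> complex^3 \<Rightarrow> complex^3" where
  "rmatvec A v = (\<chi> i. \<Sum>j\<in>UNIV. complex_of_real (A $ i $ j) * v $ j)"

definition ccross :: "complex^3 \<Rightarrow> complex^3 \<Rightarrow> complex^3" where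
  "ccross a b = vector [a$2 * b$3 - a$3 * b$2, a$3 * b$1 - a$1 * b$3, a$1 * b$2 - a$2 * b$1]"


section \<open>Smooth fields\<close>

definition partial :: "3 \<Rightarrow> (real^3 \<Rightarrow> 'b::real_normed_vector) \<Rightarrow> real^3 \<Rightarrow> 'b" where
  "partial i f x = frechet_derivative f (at x) (axis i 1)"

primrec Ck :: "nat \<Rightarrow> (real^3 \<Rightarrow> 'b::real_normed_vector) \<Rightarrow> bool" where
  "Ck 0 f \<longleftrightarrow> continuous_on UNIV f"
| "Ck (Suc k) f \<longleftrightarrow> (\<forall>x. f differentiable (at x)) \<and> (\<forall>i. Ck k (partial i f))"

definition smooth :: "(real^3 \<Rightarrow> 'b::real_normed_vector) \<Rightarrow> bool" where
  "smooth f \<longleftrightarrow> (\<forall>k. Ck k f)"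

definition classical_curl :: "(real^3 \<Rightarrow> complex^3) \<Rightarrow> real^3 \<Rightarrow> complex^3" where
  "classical_curl f x = vector
     [partial 2 f x $ 3 - partial 3 f x $ 2,
      partial 3 f x $ 1 - partial 1 f x $ 3,
      partial 1 f x $ 2 - partial 2 f x $ 1]"

definition gradient :: "(real^3 \<Rightarrow> real) \<Rightarrow> real^3 \<Rightarrow> real^3" where
  "gradient f x = (\<chi> i. partial i f x)"

definition test_field :: "(real^3) set \<Rightarrow> (real^3 \<Rightarrow> complex^3) \<Rightarrow> bool" where
  "test_field \<Omega> \<phi> \<longleftrightarrow> smooth \<phi> \<and> compact (closure {x. \<phi> x \<noteq> 0}) \<and> closure {x. \<phi> x \<noteq> 0} \<subseteq> \<Omega>"


section \<open>Square integrable functions\<close>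

text \<open>Elements of the function spaces below are functions, not classes modulo null sets;
  equality in these spaces is equality almost everywhere.\<close>

definition L2_sq :: "'a measure \<Rightarrow> ('a \<Rightarrow> 'b::euclidean_space) \<Rightarrow> ennreal" where
  "L2_sq M f = (\<integral>\<^sup>+x. ennreal ((norm (f x))\<^sup>2) \<partial>M)"

definition L2 :: "'a measure \<Rightarrow> ('a \<Rightarrow> 'b::euclidean_space) set" where
  "L2 M = {f \<in> borel_measurable M. L2_sq M f < \<infinity>}"


section \<open>Lipschitz polyhedra\<close>

text \<open>Near each boundary point the domain is, in suitable orthonormal coordinates, the strict
  epigraph of a Lipschitz function.  The unit vector \<open>e\<close> is the vertical direction, and \<open>g\<close>
  is evaluated at the projection onto the orthogonal complement of \<open>e\<close>.\<close>

definition lipschitz_boundary :: "(real^3) set \<Rightarrow> bool" where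
  "lipschitz_boundary \<Omega> \<longleftrightarrow> (\<forall>x\<in>frontier \<Omega>. \<exists>r>0. \<exists>e L. \<exists>g :: real^3 \<Rightarrow> real.
     norm e = 1 \<and> L-lipschitz_on UNIV g \<and>
     \<Omega> \<inter> ball x r = {y \<in> ball x r. g (y - (y \<bullet> e) *\<^sub>R e) < y \<bullet> e})"

text \<open>The polyhedron need not be convex: its closure is a finite union of (convex) polytopes.\<close>

definition lipschitz_polyhedron :: "(real^3) set \<Rightarrow> bool" where
  "lipschitz_polyhedron \<Omega> \<longleftrightarrow> open \<Omega> \<and> \<Omega> \<noteq> {} \<and> bounded \<Omega> \<and> connected \<Omega> \<and>
     (\<exists>F. finite F \<and> (\<forall>P\<in>F. polytope P) \<and> closure \<Omega> = \<Union>F) \<and> lipschitz_boundary \<Omega>"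

text \<open>The boundary of a polyhedron is flat near each of its points outside the edges and
  vertices, which form a set of surface measure zero; there the normal is given the value 0.\<close>

definition is_outward_normal :: "(real^3) set \<Rightarrow> real^3 \<Rightarrow> real^3 \<Rightarrow> bool" where
  "is_outward_normal \<Omega> x \<nu> \<longleftrightarrow> norm \<nu> = 1 \<and>
     (\<exists>r>0. \<Omega> \<inter> ball x r = {y \<in> ball x r. (y - x) \<bullet> \<nu> < 0})"

definition normal :: "(real^3) set \<Rightarrow> real^3 \<Rightarrow> real^3" where
  "normal \<Omega> x = (if x \<in> frontier \<Omega> \<and> (\<exists>\<nu>. is_outward_normal \<Omega> x \<nu>)
                then THE \<nu>. is_outward_normal \<Omega> x \<nu> else 0)"

text \<open>Two-dimensional Hausdorff measure, with the factor \<open>\<pi>/4\<close> that makes it agree with the area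
  on planes.  It is an outer measure that is countably additive on Borel sets, so
  \<^const>\<open>measure_of\<close> does not alter its values there.\<close>

definition hausdorff2_pre :: "real \<Rightarrow> (real^3) set \<Rightarrow> ennreal" where
  "hausdorff2_pre \<delta> A =
     (INF C \<in> {C :: nat \<Rightarrow> (real^3) set. A \<subseteq> (\<Union>i. C i) \<and> (\<forall>i. bounded (C i) \<and> diameter (C i) \<le> \<delta>)}.
        \<Sum>i. ennreal (pi / 4 * (diameter (C i))\<^sup>2))"

definition hausdorff2 :: "(real^3) set \<Rightarrow> ennreal" where
  "hausdorff2 A = (SUP \<delta>\<in>{0<..}. hausdorff2_pre \<delta> A)"

definition surface :: "(real^3) set \<Rightarrow> (real^3) measure" where
  "surface \<Omega> = restrict_space (measure_of UNIV (sets borel) hausdorff2) (frontier \<Omega>)"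


section \<open>The space H(curl)\<close>

definition is_weak_curl ::
    "(real^3) set \<Rightarrow> (real^3 \<Rightarrow> complex^3) \<Rightarrow> (real^3 \<Rightarrow> complex^3) \<Rightarrow> bool" where
  "is_weak_curl \<Omega> u w \<longleftrightarrow> (\<forall>\<phi>. test_field \<Omega> \<phi> \<longrightarrow>
     (LINT x|lebesgue_on \<Omega>. bdot (w x) (\<phi> x)) =
     (LINT x|lebesgue_on \<Omega>. bdot (u x) (classical_curl \<phi> x)))"

definition Hcurl :: "(real^3) set \<Rightarrow> (real^3 \<Rightarrow> complex^3) set" where
  "Hcurl \<Omega> = {u \<in> L2 (lebesgue_on \<Omega>). \<exists>w \<in> L2 (lebesgue_on \<Omega>). is_weak_curl \<Omega> u w}"

definition curl :: "(real^3) set \<Rightarrow> (real^3 \<Rightarrow> complex^3) \<Rightarrow> real^3 \<Rightarrow> complex^3" where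
  "curl \<Omega> u = (SOME w. w \<in> L2 (lebesgue_on \<Omega>) \<and> is_weak_curl \<Omega> u w)"

text \<open>The negative order trace space is \<open>H\<^sup>-\<^sup>1\<^sup>/\<^sup>2(\<Gamma>)\<^sup>3\<close>, the dual of \<open>H\<^sup>1\<^sup>/\<^sup>2(\<Gamma>)\<^sup>3\<close> with its
  Sobolev-Slobodeckij norm.  A field \<open>g\<close> on \<open>\<Gamma>\<close> acts as \<open>\<phi> \<mapsto> \<integral> g \<cdot> \<phi> dS\<close>.\<close>

definition Hhalf_sq :: "(real^3) set \<Rightarrow> (real^3 \<Rightarrow> complex^3) \<Rightarrow> ennreal" where
  "Hhalf_sq \<Omega> \<phi> = L2_sq (surface \<Omega>) \<phi> +
     (\<integral>\<^sup>+x. (\<integral>\<^sup>+y. ennreal ((norm (\<phi> x - \<phi> y))\<^sup>2 / (norm (x - y)) ^ 3) \<partial>surface \<Omega>) \<partial>surface \<Omega>)"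

definition dual_norm :: "(real^3) set \<Rightarrow> ((real^3 \<Rightarrow> complex^3) \<Rightarrow> complex) \<Rightarrow> ennreal" where
  "dual_norm \<Omega> \<Lambda> =
     (SUP \<phi> \<in> {\<phi> \<in> borel_measurable (surface \<Omega>). Hhalf_sq \<Omega> \<phi> \<le> 1}. ennreal (cmod (\<Lambda> \<phi>)))"

definition surface_functional ::
    "(real^3) set \<Rightarrow> (real^3 \<Rightarrow> complex^3) \<Rightarrow> (real^3 \<Rightarrow> complex^3) \<Rightarrow> complex" where
  "surface_functional \<Omega> g \<phi> = (LINT x|surface \<Omega>. bdot (g x) (\<phi> x))"

definition cross_normal :: "(real^3) set \<Rightarrow> (real^3 \<Rightarrow> complex^3) \<Rightarrow> real^3 \<Rightarrow> complex^3" where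
  "cross_normal \<Omega> v x = ccross (v x) (cvec (normal \<Omega> x))"

text \<open>The extension by continuity of \<open>v \<mapsto> v \<times> n\<close> from smooth fields to H(curl): the functional
  \<open>\<Lambda>\<close> is the tangential trace of \<open>u\<close> if smooth fields \<open>U k\<close> converge to \<open>u\<close> in H(curl) while
  \<open>U k \<times> n\<close> converges to \<open>\<Lambda>\<close> in the negative order trace space.\<close>

definition has_tangential_trace ::
    "(real^3) set \<Rightarrow> (real^3 \<Rightarrow> complex^3) \<Rightarrow> ((real^3 \<Rightarrow> complex^3) \<Rightarrow> complex) \<Rightarrow> bool" where
  "has_tangential_trace \<Omega> u \<Lambda> \<longleftrightarrow> u \<in> Hcurl \<Omega> \<and>
     (\<exists>U :: nat \<Rightarrow> real^3 \<Rightarrow> complex^3. (\<forall>k. smooth (U k)) \<and>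
        (\<lambda>k. L2_sq (lebesgue_on \<Omega>) (\<lambda>x. U k x - u x)) \<longlonglongrightarrow> 0 \<and>
        (\<lambda>k. L2_sq (lebesgue_on \<Omega>) (\<lambda>x. classical_curl (U k) x - curl \<Omega> u x)) \<longlonglongrightarrow> 0 \<and>
        (\<lambda>k. dual_norm \<Omega> (\<lambda>\<phi>. surface_functional \<Omega> (cross_normal \<Omega> (U k)) \<phi> - \<Lambda> \<phi>)) \<longlonglongrightarrow> 0)"

definition Hcurl0 :: "(real^3) set \<Rightarrow> (real^3 \<Rightarrow> complex^3) set" where
  "Hcurl0 \<Omega> = {v \<in> Hcurl \<Omega>. has_tangential_trace \<Omega> v (\<lambda>_. 0)}"


section \<open>Surface differential operators and the control space\<close>

definition L2t :: "(real^3) set \<Rightarrow> (real^3 \<Rightarrow> complex^3) set" where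
  "L2t \<Omega> = {z \<in> L2 (surface \<Omega>). AE x in surface \<Omega>. bdot (z x) (cvec (normal \<Omega> x)) = 0}"

definition smooth_surface_gradient :: "(real^3) set \<Rightarrow> (real^3 \<Rightarrow> real) \<Rightarrow> real^3 \<Rightarrow> real^3" where
  "smooth_surface_gradient \<Omega> f x =
     gradient f x - (gradient f x \<bullet> normal \<Omega> x) *\<^sub>R normal \<Omega> x"

text \<open>\<open>H\<^sup>1(\<Gamma>)\<close> is the completion of the restrictions of smooth functions in the norm of
  \<open>L\<^sup>2\<close> functions with \<open>L\<^sup>2\<close> surface gradient; on a Lipschitz boundary this agrees with the
  definition by local charts.\<close>

definition is_surface_gradient ::
    "(real^3) set \<Rightarrow> (real^3 \<Rightarrow> real) \<Rightarrow> (real^3 \<Rightarrow> real^3) \<Rightarrow> bool" where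
  "is_surface_gradient \<Omega> \<phi> G \<longleftrightarrow> \<phi> \<in> L2 (surface \<Omega>) \<and> G \<in> L2 (surface \<Omega>) \<and>
     (\<exists>\<Phi> :: nat \<Rightarrow> real^3 \<Rightarrow> real. (\<forall>k. smooth (\<Phi> k)) \<and>
        (\<lambda>k. L2_sq (surface \<Omega>) (\<lambda>x. \<Phi> k x - \<phi> x)) \<longlonglongrightarrow> 0 \<and>
        (\<lambda>k. L2_sq (surface \<Omega>) (\<lambda>x. smooth_surface_gradient \<Omega> (\<Phi> k) x - G x)) \<longlonglongrightarrow> 0)"

definition H1_surface :: "(real^3) set \<Rightarrow> (real^3 \<Rightarrow> real) set" where
  "H1_surface \<Omega> = {\<phi>. \<exists>G. is_surface_gradient \<Omega> \<phi> G}"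

definition surface_gradient :: "(real^3) set \<Rightarrow> (real^3 \<Rightarrow> real) \<Rightarrow> real^3 \<Rightarrow> real^3" where
  "surface_gradient \<Omega> \<phi> = (SOME G. is_surface_gradient \<Omega> \<phi> G)"

definition is_surface_curl ::
    "(real^3) set \<Rightarrow> (real^3 \<Rightarrow> complex^3) \<Rightarrow> (real^3 \<Rightarrow> complex) \<Rightarrow> bool" where
  "is_surface_curl \<Omega> z c \<longleftrightarrow> (\<forall>\<phi> \<in> H1_surface \<Omega>.
     (LINT x|surface \<Omega>. c x * complex_of_real (\<phi> x)) =
     (LINT x|surface \<Omega>. bdot (z x) (cvec (cross3 (surface_gradient \<Omega> \<phi> x) (normal \<Omega> x)))))"

definition Hcurl_surface :: "(real^3) set \<Rightarrow> (real^3 \<Rightarrow> complex^3) set" where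
  "Hcurl_surface \<Omega> = {z \<in> L2t \<Omega>. \<exists>c \<in> L2 (surface \<Omega>). is_surface_curl \<Omega> z c}"

definition surface_curl :: "(real^3) set \<Rightarrow> (real^3 \<Rightarrow> complex^3) \<Rightarrow> real^3 \<Rightarrow> complex" where
  "surface_curl \<Omega> z = (SOME c. c \<in> L2 (surface \<Omega>) \<and> is_surface_curl \<Omega> z c)"

definition control_space :: "(real^3) set \<Rightarrow> (real^3 \<Rightarrow> complex^3) set" where
  "control_space \<Omega> =
     {z \<in> Hcurl_surface \<Omega>. (LINT x|surface \<Omega>. surface_curl \<Omega> z x) = 0}"


section \<open>The optimal control problem\<close>

definition material_tensor :: "(real^3) set \<Rightarrow> (real^3 \<Rightarrow> real^3^3) \<Rightarrow> bool" where
  "material_tensor \<Omega> A \<longleftrightarrow> A \<in> borel_measurable (lebesgue_on \<Omega>) \<and>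
     (\<exists>C. AE x in lebesgue_on \<Omega>. norm (A x) \<le> C) \<and>
     (AE x in lebesgue_on \<Omega>. transpose (A x) = A x) \<and>
     (\<exists>c>0. AE x in lebesgue_on \<Omega>. \<forall>\<xi>. c * (norm \<xi>)\<^sup>2 \<le> \<xi> \<bullet> (A x *v \<xi>))"

definition is_state ::
    "(real^3) set \<Rightarrow> (real^3 \<Rightarrow> real^3^3) \<Rightarrow> (real^3 \<Rightarrow> real^3^3) \<Rightarrow> real \<Rightarrow> (real^3 \<Rightarrow> complex^3) \<Rightarrow>
     (real^3 \<Rightarrow> complex^3) \<Rightarrow> (real^3 \<Rightarrow> complex^3) \<Rightarrow> bool" where
  "is_state \<Omega> \<mu> \<kappa> \<omega> jc z u \<longleftrightarrow> u \<in> Hcurl \<Omega> \<and>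
     has_tangential_trace \<Omega> u (surface_functional \<Omega> (cross_normal \<Omega> z)) \<and>
     (\<forall>v \<in> Hcurl0 \<Omega>.
        (LINT x|lebesgue_on \<Omega>. cdot (rmatvec (matrix_inv (\<mu> x)) (curl \<Omega> u x)) (curl \<Omega> v x)) +
        \<i> * complex_of_real \<omega> * (LINT x|lebesgue_on \<Omega>. cdot (rmatvec (\<kappa> x) (u x)) (v x)) =
        (LINT x|lebesgue_on \<Omega>. cdot (jc x) (v x)))"

text \<open>The state is unique up to null sets: the difference of two states lies in the space with
  vanishing tangential trace, on which the sesquilinear form is coercive.\<close>

definition control_to_state_map ::
    "(real^3) set \<Rightarrow> (real^3 \<Rightarrow> real^3^3) \<Rightarrow> (real^3 \<Rightarrow> real^3^3) \<Rightarrow> real \<Rightarrow> (real^3 \<Rightarrow> complex^3) \<Rightarrow>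
     ((real^3 \<Rightarrow> complex^3) \<Rightarrow> real^3 \<Rightarrow> complex^3) \<Rightarrow> bool" where
  "control_to_state_map \<Omega> \<mu> \<kappa> \<omega> jc S \<longleftrightarrow> (\<forall>z \<in> control_space \<Omega>. is_state \<Omega> \<mu> \<kappa> \<omega> jc z (S z))"

definition cost ::
    "(real^3) set \<Rightarrow> ((real^3 \<Rightarrow> complex^3) \<Rightarrow> real^3 \<Rightarrow> complex^3) \<Rightarrow> (real^3 \<Rightarrow> complex^3) \<Rightarrow>
     real \<Rightarrow> real \<Rightarrow> (real^3 \<Rightarrow> complex^3) \<Rightarrow> real" where
  "cost \<Omega> S ud \<alpha> \<beta> z =
     1 / 2 * (LINT x|lebesgue_on \<Omega>. (norm (S z x - ud x))\<^sup>2) +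
     \<alpha> / 2 * (LINT x|surface \<Omega>. (cmod (surface_curl \<Omega> z x))\<^sup>2) +
     \<beta> / 2 * (LINT x|surface \<Omega>. (norm (z x))\<^sup>2)"

end

theory Submission
  imports Defs "HOL-Library.Function_Algebras"
begin

text \<open>The proof is the direct method in a form that needs no weak topology. The cost is a strongly convex
quadratic functional: by the parallelogram identity its value at a midpoint lies below the mean of
the two values by a multiple of the squared control norm of the difference. Hence a minimizing
sequence is Cauchy, its limit exists because the control space is complete
(\<open>control_norm_complete\<close>), the cost is continuous along it, and two minimizers have
distance zero (\<open>strongly_convex_minimum\<close>).

What has to be earned is the continuity of the cost, that is, of the control-to-state map. The usual
argument lifts boundary data by a bounded right inverse of the tangential trace. That inverse is
avoided here: a state exists for every control, so a closed graph argument applies. The difference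
of two states solves the homogeneous equation with the difference of the controls as boundary data.
A field with vanishing tangential trace solves the homogeneous equation only if it vanishes, since
testing with the field itself gives a real curl term plus \<open>\<i> * \<omega>\<close> times a real coercive term
(\<open>homogeneous_state_zero\<close>). So the H(curl) norm of the response is a well-defined seminorm
on the control space. It is countably subadditive, because linear combinations and limits of states
are again states (\<open>homogeneous_state_series\<close>), and by the lemma of Zabreiko, a consequence of
Baire's theorem, such a seminorm on a complete space is bounded (\<open>Zabreiko\<close>,
\<open>response_bounded\<close>).

Linearity and closedness of the state relation rest on three facts. The weak curl and the surface
curl are determined almost everywhere: a function whose integrals against smooth bump functions
vanish is zero almost everywhere, because bump functions converge to indicators of boxes and boxes
generate the Borel sets (\<open>AE_zero_of_test_field_integrals\<close>,
\<open>AE_zero_of_smooth_surface_integrals\<close>). The surface measure is finite, because the boundary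
consists of finitely many Lipschitz graphs over bounded planar sets
(\<open>finite_area_covers_frontier\<close>); thus smooth fields are square integrable on the boundary and
their trace functionals add up. Finally the negative order norm of a trace functional is bounded by
the \<open>L\<^sup>2\<close> norm of the boundary field, so traces pass to the limit
(\<open>tangential_trace_limit\<close>).\<close>

section \<open>The space of square integrable functions\<close>

text \<open>With pointwise operations, spaces of functions are subspaces of a real vector space, so that
linear algebra over type classes applies to them.\<close>

instantiation "fun" :: (type, real_vector) real_vector
begin

definition "c *\<^sub>R f = (\<lambda>x. c *\<^sub>R f x)"

instance
  by standard (simp_all add: scaleR_fun_def plus_fun_def fun_eq_iff scaleR_add_right scaleR_add_left)

end

lemma scaleR_fun_apply [simp]: "(c *\<^sub>R f) x = c *\<^sub>R f x"
  by (simp add: scaleR_fun_def)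

definition l2norm :: "'a measure \<Rightarrow> ('a \<Rightarrow> 'b::euclidean_space) \<Rightarrow> real" where
  "l2norm M f = sqrt (LINT x|M. (norm (f x))\<^sup>2)"

lemma L2_iff: "f \<in> L2 M \<longleftrightarrow> f \<in> borel_measurable M \<and> integrable M (\<lambda>x. (norm (f x))\<^sup>2)"
  by (auto simp: L2_def L2_sq_def integrable_iff_bounded)

lemma l2norm_nonneg [simp]: "0 \<le> l2norm M f"
  by (simp add: l2norm_def)

lemma l2norm_sq: "(l2norm M f)\<^sup>2 = (LINT x|M. (norm (f x))\<^sup>2)"
  by (simp add: l2norm_def)

lemma L2_sq_eq:
  assumes "f \<in> L2 M" shows "L2_sq M f = ennreal ((l2norm M f)\<^sup>2)"
  using assms unfolding L2_sq_def l2norm_sq L2_iff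
  by (intro nn_integral_eq_integral) auto

lemma L2_zero [simp]: "0 \<in> L2 M"
  by (simp add: L2_iff zero_fun_def)

lemma L2_add:
  assumes "f \<in> L2 M" "g \<in> L2 M" shows "f + g \<in> L2 M"
proof -
  have [measurable]: "f \<in> borel_measurable M" "g \<in> borel_measurable M"
    using assms by (auto simp: L2_iff)
  have dom: "integrable M (\<lambda>x. 2 * (norm (f x))\<^sup>2 + 2 * (norm (g x))\<^sup>2)"
    using assms by (auto simp: L2_iff)
  have "(norm (f x + g x))\<^sup>2 \<le> 2 * (norm (f x))\<^sup>2 + 2 * (norm (g x))\<^sup>2" for x
  proof -
    have "(norm (f x + g x))\<^sup>2 \<le> (norm (f x) + norm (g x))\<^sup>2"
      by (intro power_mono norm_triangle_ineq) auto
    also have "\<dots> \<le> 2 * (norm (f x))\<^sup>2 + 2 * (norm (g x))\<^sup>2"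
      using sum_squares_bound[of "norm (f x)" "norm (g x)"] by (simp add: power2_sum)
    finally show ?thesis .
  qed
  then have "integrable M (\<lambda>x. (norm (f x + g x))\<^sup>2)"
    by (intro Bochner_Integration.integrable_bound[OF dom _ AE_I2]) auto
  then show ?thesis by (simp add: L2_iff plus_fun_def)
qed

lemma L2_scaleR:
  assumes "f \<in> L2 M" shows "c *\<^sub>R f \<in> L2 M"
  using assms by (auto simp: L2_iff scaleR_fun_def power_mult_distrib)

lemma L2_subspace: "subspace (L2 M)"
  by (simp add: subspace_def L2_add L2_scaleR)

lemmas L2_diff = subspace_diff[OF L2_subspace]

lemma l2norm_scaleR: "l2norm M (c *\<^sub>R f) = \<bar>c\<bar> * l2norm M f"
  by (simp add: l2norm_def power_mult_distrib real_sqrt_mult)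

lemma L2_product_integrable:
  assumes "f \<in> L2 M" "g \<in> L2 M"
  shows "integrable M (\<lambda>x. norm (f x) * norm (g x))"
proof -
  have [measurable]: "f \<in> borel_measurable M" "g \<in> borel_measurable M"
    using assms by (auto simp: L2_iff)
  have dom: "integrable M (\<lambda>x. (norm (f x))\<^sup>2 + (norm (g x))\<^sup>2)"
    using assms by (auto simp: L2_iff)
  have "norm (norm (f x) * norm (g x)) \<le> norm ((norm (f x))\<^sup>2 + (norm (g x))\<^sup>2)" for x
  proof -
    have "0 \<le> norm (f x) * norm (g x)" by simp
    then show ?thesis using sum_squares_bound[of "norm (f x)" "norm (g x)"] unfolding real_norm_def by linarith
  qed
  then show ?thesis
    by (intro Bochner_Integration.integrable_bound[OF dom _ AE_I2]) auto
qed

text \<open>Young's inequality with weight \<open>(G + e) / (F + e)\<close>, where \<open>F\<close> and \<open>G\<close> are the two norms.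
The positive \<open>e\<close>, sent to zero at the end, keeps the weight meaningful when a norm vanishes.\<close>

lemma L2_Cauchy_Schwarz:
  assumes "f \<in> L2 M" "g \<in> L2 M"
  shows "(LINT x|M. norm (f x) * norm (g x)) \<le> l2norm M f * l2norm M g"
proof -
  define I F G where "I = (LINT x|M. norm (f x) * norm (g x))" and "F = l2norm M f" and "G = l2norm M g"
  have FG: "0 \<le> F" "0 \<le> G" by (auto simp: F_def G_def)
  have step: "I \<le> (F + e) * (G + e)" if e: "e > 0" for e
  proof -
    define t where "t = (G + e) / (F + e)"
    have t: "t > 0" using FG e by (simp add: t_def)
    have "2 * (norm (f x) * norm (g x)) \<le> t * (norm (f x))\<^sup>2 + (1/t) * (norm (g x))\<^sup>2" for x
    proof -
      have "0 \<le> (sqrt t * norm (f x) - norm (g x) / sqrt t)\<^sup>2" by simp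
      also have "\<dots> = t * (norm (f x))\<^sup>2 + (1/t) * (norm (g x))\<^sup>2 - 2 * (norm (f x) * norm (g x))"
        using t by (simp add: power2_diff power_mult_distrib power_divide)
      finally show ?thesis by simp
    qed
    then have "(LINT x|M. 2 * (norm (f x) * norm (g x))) \<le>
        (LINT x|M. t * (norm (f x))\<^sup>2 + (1/t) * (norm (g x))\<^sup>2)"
      using assms by (intro integral_mono) (auto simp: L2_product_integrable L2_iff)
    also have "\<dots> = t * F\<^sup>2 + (1/t) * G\<^sup>2"
      using assms by (simp add: L2_iff F_def G_def l2norm_sq)
    finally have "2 * I \<le> t * F\<^sup>2 + (1/t) * G\<^sup>2" by (simp add: I_def)
    also have "t * F\<^sup>2 \<le> t * (F + e)\<^sup>2" using FG e t by (intro mult_left_mono power_mono) auto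
    also have "t * (F + e)\<^sup>2 = (G + e) * (F + e)" using FG e by (simp add: t_def power2_eq_square)
    also have "(1/t) * G\<^sup>2 \<le> (1/t) * (G + e)\<^sup>2" using FG e t by (intro mult_left_mono power_mono) auto
    also have "(1/t) * (G + e)\<^sup>2 = (G + e) * (F + e)" using FG e by (simp add: t_def power2_eq_square)
    finally show ?thesis by (simp add: mult.commute)
  qed
  have "((\<lambda>e. (F + e) * (G + e)) \<longlongrightarrow> (F + 0) * (G + 0)) (at_right 0)"
    by (intro tendsto_intros)
  then have "I \<le> (F + 0) * (G + 0)"
  proof (rule tendsto_lowerbound)
    show "\<forall>\<^sub>F e in at_right 0. I \<le> (F + e) * (G + e)"
      using eventually_at_right_less[of 0] by (rule eventually_mono) (rule step)
  qed simp
  then show ?thesis by (simp add: I_def F_def G_def)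
qed

lemma L2_bilinear_integrable:
  assumes "bounded_bilinear B" "f \<in> L2 M" "g \<in> L2 M"
  shows "integrable M (\<lambda>x. B (f x) (g x) :: 'c::euclidean_space)"
proof -
  obtain K where K: "\<And>a b. norm (B a b) \<le> norm a * norm b * K" "K \<ge> 0"
    using bounded_bilinear.nonneg_bounded[OF assms(1)] by auto
  have [measurable]: "f \<in> borel_measurable M" "g \<in> borel_measurable M"
    using assms by (auto simp: L2_iff)
  have "continuous_on UNIV (\<lambda>p. B (fst p) (snd p))"
    by (rule bounded_bilinear.continuous_on[OF assms(1) continuous_on_fst[OF continuous_on_id] continuous_on_snd[OF continuous_on_id]])
  then have meas: "(\<lambda>x. B (f x) (g x)) \<in> borel_measurable M"
    by (rule borel_measurable_continuous_Pair[rotated 2]) measurable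
  have "norm (B (f x) (g x)) \<le> norm (norm (f x) * norm (g x) * K)" for x
    using K(1)[of "f x" "g x"] K(2) by simp
  then show ?thesis
    by (intro Bochner_Integration.integrable_bound[OF integrable_mult_left[OF L2_product_integrable[OF assms(2,3)]] meas AE_I2])
qed

text \<open>The constant depends on the bilinear map only and serves all measure spaces.\<close>

lemma L2_bilinear_bound:
  assumes "bounded_bilinear B"
  obtains K where "K \<ge> 0"
    "\<And>M f g. f \<in> L2 M \<Longrightarrow> g \<in> L2 M \<Longrightarrow>
       norm (LINT x|M. B (f x) (g x) :: 'c::euclidean_space) \<le> K * (l2norm M f * l2norm M g)"
proof -
  obtain K where K: "\<And>a b. norm (B a b) \<le> norm a * norm b * K" "K \<ge> 0"
    using bounded_bilinear.nonneg_bounded[OF assms(1)] by auto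
  have "norm (LINT x|M. B (f x) (g x)) \<le> K * (l2norm M f * l2norm M g)"
    if fg: "f \<in> L2 M" "g \<in> L2 M" for M f g
  proof -
    have "norm (LINT x|M. B (f x) (g x)) \<le> (LINT x|M. norm (B (f x) (g x)))"
      by (rule integral_norm_bound)
    also have "\<dots> \<le> (LINT x|M. norm (f x) * norm (g x) * K)"
    proof (rule integral_mono)
      show "integrable M (\<lambda>x. norm (B (f x) (g x)))"
        by (rule integrable_norm[OF L2_bilinear_integrable[OF assms fg]])
      show "integrable M (\<lambda>x. norm (f x) * norm (g x) * K)"
        by (rule integrable_mult_left[OF L2_product_integrable[OF fg]])
    qed (rule K(1))
    also have "\<dots> \<le> K * (l2norm M f * l2norm M g)"
      using L2_Cauchy_Schwarz[OF fg] K(2) by (simp add: mult.commute mult_left_mono)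
    finally show ?thesis .
  qed
  with K(2) that show ?thesis by blast
qed

lemma l2norm_triangle:
  assumes "f \<in> L2 M" "g \<in> L2 M"
  shows "l2norm M (f + g) \<le> l2norm M f + l2norm M g"
proof (rule power2_le_imp_le)
  have "(l2norm M (f + g))\<^sup>2 \<le> (LINT x|M. (norm (f x))\<^sup>2 + (norm (g x))\<^sup>2 + 2 * (norm (f x) * norm (g x)))"
    unfolding l2norm_sq
  proof (rule integral_mono)
    show "integrable M (\<lambda>x. (norm ((f + g) x))\<^sup>2)" using L2_add[OF assms] by (simp add: L2_iff)
    show "integrable M (\<lambda>x. (norm (f x))\<^sup>2 + (norm (g x))\<^sup>2 + 2 * (norm (f x) * norm (g x)))"
      using assms by (auto simp: L2_iff L2_product_integrable)
    show "(norm ((f + g) x))\<^sup>2 \<le> (norm (f x))\<^sup>2 + (norm (g x))\<^sup>2 + 2 * (norm (f x) * norm (g x))" for x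
      using power_mono[OF norm_triangle_ineq[of "f x" "g x"], of 2] by (simp add: power2_sum)
  qed
  also have "\<dots> = (l2norm M f)\<^sup>2 + (l2norm M g)\<^sup>2 + 2 * (LINT x|M. norm (f x) * norm (g x))"
    using assms by (simp add: L2_iff L2_product_integrable l2norm_sq)
  also have "\<dots> \<le> (l2norm M f + l2norm M g)\<^sup>2"
    using L2_Cauchy_Schwarz[OF assms] by (simp add: power2_sum)
  finally show "(l2norm M (f + g))\<^sup>2 \<le> (l2norm M f + l2norm M g)\<^sup>2" .
qed simp

lemma l2norm_diff_commute: "l2norm M (f - g) = l2norm M (g - f)"
  by (simp add: l2norm_def norm_minus_commute)

lemma l2norm_cong_AE:
  assumes "AE x in M. f x = g x" "f \<in> L2 M" "g \<in> L2 M"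
  shows "l2norm M f = l2norm M g"
  unfolding l2norm_def
  by (intro arg_cong[where f = sqrt] integral_cong_AE)
     (use assms in \<open>auto simp: L2_iff intro!: borel_measurable_integrable\<close>)

lemma l2norm_eq_0_iff:
  assumes "f \<in> L2 M" shows "l2norm M f = 0 \<longleftrightarrow> (AE x in M. f x = 0)"
  using assms integral_nonneg_eq_0_iff_AE[of M "\<lambda>x. (norm (f x))\<^sup>2"]
  by (simp add: l2norm_def L2_iff)

lemma l2norm_parallelogram:
  assumes "f \<in> L2 M" "g \<in> L2 M"
  shows "(l2norm M (f + g))\<^sup>2 + (l2norm M (f - g))\<^sup>2 = 2 * (l2norm M f)\<^sup>2 + 2 * (l2norm M g)\<^sup>2"
proof -
  have "(l2norm M (f + g))\<^sup>2 + (l2norm M (f - g))\<^sup>2 =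
      (LINT x|M. (norm ((f + g) x))\<^sup>2 + (norm ((f - g) x))\<^sup>2)"
    unfolding l2norm_sq using L2_add[OF assms] L2_diff[OF assms] by (intro Bochner_Integration.integral_add[symmetric]) (auto simp: L2_iff)
  also have "\<dots> = (LINT x|M. 2 * (norm (f x))\<^sup>2 + 2 * (norm (g x))\<^sup>2)"
    by (rule Bochner_Integration.integral_cong) (auto simp: power2_norm_eq_inner algebra_simps)
  also have "\<dots> = 2 * (l2norm M f)\<^sup>2 + 2 * (l2norm M g)\<^sup>2"
    using assms by (simp add: L2_iff l2norm_sq)
  finally show ?thesis .
qed

lemma L2_sq_tendsto_iff:
  assumes "\<And>n. f n \<in> L2 M"
  shows "(\<lambda>n. L2_sq M (f n)) \<longlonglongrightarrow> 0 \<longleftrightarrow> (\<lambda>n. l2norm M (f n)) \<longlonglongrightarrow> 0"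
proof -
  have "(\<lambda>n. L2_sq M (f n)) \<longlonglongrightarrow> 0 \<longleftrightarrow> (\<lambda>n. (l2norm M (f n))\<^sup>2) \<longlonglongrightarrow> 0"
    unfolding L2_sq_eq[OF assms] ennreal_0[symmetric] by (subst tendsto_ennreal_iff) auto
  also have "\<dots> \<longleftrightarrow> (\<lambda>n. l2norm M (f n)) \<longlonglongrightarrow> 0"
  proof
    show "(\<lambda>n. (l2norm M (f n))\<^sup>2) \<longlonglongrightarrow> 0 \<Longrightarrow> (\<lambda>n. l2norm M (f n)) \<longlonglongrightarrow> 0"
      using tendsto_real_sqrt[of "\<lambda>n. (l2norm M (f n))\<^sup>2" 0] by simp
    show "(\<lambda>n. l2norm M (f n)) \<longlonglongrightarrow> 0 \<Longrightarrow> (\<lambda>n. (l2norm M (f n))\<^sup>2) \<longlonglongrightarrow> 0"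
      using tendsto_power[of "\<lambda>n. l2norm M (f n)" 0 _ 2] by simp
  qed
  finally show ?thesis .
qed

text \<open>If \<open>C\<close> is the value of the series, the \<open>k\<close>-th increment is at most \<open>sqrt C / 2^k\<close>.\<close>

lemma convergent_of_weighted_increments:
  fixes u :: "nat \<Rightarrow> 'b::banach"
  assumes "(\<Sum>k. ennreal (4 ^ k * (norm (u (Suc k) - u k))\<^sup>2)) \<noteq> \<infinity>"
  shows "convergent u"
proof -
  define a where "a k = ennreal (4 ^ k * (norm (u (Suc k) - u k))\<^sup>2)" for k
  have "suminf a \<noteq> \<infinity>" unfolding a_def by (rule assms)
  then obtain C where C: "C \<ge> 0" "suminf a = ennreal C"
    by (metis ennreal_cases infinity_ennreal_def)
  have bound: "norm (u (Suc k) - u k) \<le> sqrt C * (1/2) ^ k" for k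
  proof -
    have "a k \<le> ennreal C"
      unfolding C(2)[symmetric] using sum_le_suminf[of a "{k}"] by simp
    then have "ennreal (4 ^ k * (norm (u (Suc k) - u k))\<^sup>2) \<le> ennreal C"
      by (simp only: a_def)
    then have "4 ^ k * (norm (u (Suc k) - u k))\<^sup>2 \<le> C" using C(1) by (simp only: ennreal_le_iff)
    then have "sqrt (4 ^ k * (norm (u (Suc k) - u k))\<^sup>2) \<le> sqrt C" by (rule real_sqrt_le_mono)
    then have "2 ^ k * norm (u (Suc k) - u k) \<le> sqrt C"
      by (simp add: real_sqrt_mult real_sqrt_power)
    then show ?thesis by (simp add: power_divide field_simps)
  qed
  have "summable (\<lambda>k. norm (u (Suc k) - u k))"
  proof (rule summable_comparison_test')
    show "summable (\<lambda>k. sqrt C * (1/2) ^ k)" by (intro summable_mult summable_geometric) simp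
    show "norm (norm (u (Suc k) - u k)) \<le> sqrt C * (1/2) ^ k" if "k \<ge> 0" for k using bound by simp
  qed
  then have "summable (\<lambda>k. u (Suc k) - u k)" by (rule summable_norm_cancel)
  then have "convergent (\<lambda>n. u n - u 0)"
    by (simp add: summable_iff_convergent sum_lessThan_telescope)
  then have "convergent (\<lambda>n. (u n - u 0) + u 0)"
    by (intro convergent_add convergent_const)
  then show "convergent u" by simp
qed

text \<open>Riesz-Fischer. Along a subsequence the squared norms of the increments are at most \<open>16^-k\<close>, so
the sum of \<open>4^k\<close> times their squared absolute values is integrable. It is therefore finite almost
everywhere, the subsequence converges almost everywhere, and Fatou's lemma turns this into
convergence in norm of the whole sequence.\<close>

lemma L2_complete:
  fixes f :: "nat \<Rightarrow> 'a \<Rightarrow> 'b::euclidean_space"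
  assumes L2: "\<And>n. f n \<in> L2 M"
    and Cauchy: "\<And>e. e > 0 \<Longrightarrow> \<exists>N. \<forall>m\<ge>N. \<forall>n\<ge>N. l2norm M (f m - f n) < e"
  shows "\<exists>g\<in>L2 M. (\<lambda>n. l2norm M (f n - g)) \<longlonglongrightarrow> 0"
proof -
  have [measurable]: "f n \<in> borel_measurable M" for n
    using L2 by (auto simp: L2_iff)
  have "\<forall>k. \<exists>N. \<forall>m\<ge>N. \<forall>n\<ge>N. l2norm M (f m - f n) < (1/4) ^ k"
    using Cauchy by simp
  then obtain N where N: "\<And>k m n. m \<ge> N k \<Longrightarrow> n \<ge> N k \<Longrightarrow> l2norm M (f m - f n) < (1/4) ^ k"
    by metis
  \<comment> \<open>nondecreasing, at least \<open>N k\<close> and, thanks to the summand \<open>k\<close>, unbounded\<close>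
  define r where "r k = (\<Sum>j\<le>k. N j) + k" for k
  have r_ge: "r k \<ge> N k" "r (Suc k) \<ge> r k" "r k \<ge> k" for k
    by (auto simp: r_def member_le_sum trans_le_add1)
  have r_N: "r (Suc k) \<ge> N k" for k
    using r_ge[of k] by linarith
  define h where "h k = f (r (Suc k)) - f (r k)" for k
  have h_L2: "h k \<in> L2 M" for k
    unfolding h_def by (intro L2_diff L2)
  have h_meas [measurable]: "h k \<in> borel_measurable M" for k
    using h_L2 by (auto simp: L2_iff)
  have h_small: "(l2norm M (h k))\<^sup>2 \<le> (1/16) ^ k" for k
  proof -
    have "l2norm M (h k) \<le> (1/4) ^ k"
      unfolding h_def using N[of k "r (Suc k)" "r k"] r_ge r_N by (simp add: less_imp_le)
    then have "(l2norm M (h k))\<^sup>2 \<le> ((1/4) ^ k)\<^sup>2" by (intro power_mono) auto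
    also have "\<dots> = (1/16) ^ k" by (simp add: power2_eq_square flip: power_mult_distrib)
    finally show ?thesis .
  qed
  have "(\<integral>\<^sup>+x. (\<Sum>k. ennreal (4 ^ k * (norm (h k x))\<^sup>2)) \<partial>M) =
      (\<Sum>k. \<integral>\<^sup>+x. ennreal (4 ^ k * (norm (h k x))\<^sup>2) \<partial>M)"
    by (rule nn_integral_suminf) measurable
  also have "\<dots> \<le> (\<Sum>k. ennreal ((1/4) ^ k))"
  proof (rule suminf_le)
    fix k
    have "(\<integral>\<^sup>+x. ennreal (4 ^ k * (norm (h k x))\<^sup>2) \<partial>M) = ennreal (4 ^ k) * L2_sq M (h k)"
      unfolding L2_sq_def by (subst nn_integral_cmult[symmetric]) (auto simp: ennreal_mult)
    also have "\<dots> = ennreal (4 ^ k * (l2norm M (h k))\<^sup>2)"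
      by (simp add: L2_sq_eq[OF h_L2] ennreal_mult)
    also have "\<dots> \<le> ennreal (4 ^ k * (1/16) ^ k)"
      by (intro ennreal_leI mult_left_mono h_small) auto
    also have "4 ^ k * (1/16 :: real) ^ k = (1/4) ^ k"
      by (simp flip: power_mult_distrib)
    finally show "(\<integral>\<^sup>+x. ennreal (4 ^ k * (norm (h k x))\<^sup>2) \<partial>M) \<le> ennreal ((1/4) ^ k)" .
  qed auto
  also have "\<dots> < \<infinity>"
    by (subst suminf_ennreal2) (auto intro: summable_geometric)
  finally have "AE x in M. (\<Sum>k. ennreal (4 ^ k * (norm (h k x))\<^sup>2)) \<noteq> \<infinity>"
    by (intro nn_integral_PInf_AE) auto
  then have conv: "AE x in M. convergent (\<lambda>k. f (r k) x)"
    by (rule eventually_mono) (rule convergent_of_weighted_increments, simp add: h_def)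
  define g where "g x = lim (\<lambda>k. f (r k) x)" for x
  have g_meas [measurable]: "g \<in> borel_measurable M" unfolding g_def by measurable
  have lim: "AE x in M. (\<lambda>k. f (r k) x) \<longlonglongrightarrow> g x"
    using conv by eventually_elim (simp add: g_def convergent_LIMSEQ_iff)
  have dist_le: "L2_sq M (f n - g) \<le> ennreal (((1/4) ^ k)\<^sup>2)" if "n \<ge> N k" for n k
  proof -
    have "L2_sq M (f n - g) = (\<integral>\<^sup>+x. liminf (\<lambda>j. ennreal ((norm (f n x - f (r j) x))\<^sup>2)) \<partial>M)"
      unfolding L2_sq_def
    proof (rule nn_integral_cong_AE, use lim in eventually_elim)
      fix x assume "(\<lambda>k. f (r k) x) \<longlonglongrightarrow> g x"
      then have "(\<lambda>j. ennreal ((norm (f n x - f (r j) x))\<^sup>2)) \<longlonglongrightarrow> ennreal ((norm (f n x - g x))\<^sup>2)"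
        by (intro tendsto_intros tendsto_ennrealI)
      then have "liminf (\<lambda>j. ennreal ((norm (f n x - f (r j) x))\<^sup>2)) = ennreal ((norm (f n x - g x))\<^sup>2)"
        by (rule lim_imp_Liminf[OF sequentially_bot])
      then show "ennreal ((norm ((f n - g) x))\<^sup>2) = liminf (\<lambda>j. ennreal ((norm (f n x - f (r j) x))\<^sup>2))"
        by simp
    qed
    also have "\<dots> \<le> liminf (\<lambda>j. \<integral>\<^sup>+x. ennreal ((norm (f n x - f (r j) x))\<^sup>2) \<partial>M)"
      by (intro nn_integral_liminf) measurable
    also have "\<dots> \<le> ennreal (((1/4) ^ k)\<^sup>2)"
    proof (rule Liminf_le)
      have "(\<integral>\<^sup>+x. ennreal ((norm (f n x - f (r j) x))\<^sup>2) \<partial>M) \<le> ennreal (((1/4) ^ k)\<^sup>2)" if j: "j \<ge> N k" for j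
      proof -
        have "(\<integral>\<^sup>+x. ennreal ((norm (f n x - f (r j) x))\<^sup>2) \<partial>M) = L2_sq M (f n - f (r j))"
          by (simp add: L2_sq_def)
        also have "\<dots> = ennreal ((l2norm M (f n - f (r j)))\<^sup>2)"
          by (intro L2_sq_eq L2_diff L2)
        also have "\<dots> \<le> ennreal (((1/4) ^ k)\<^sup>2)"
          using N[OF \<open>n \<ge> N k\<close>, of "r j"] r_ge(3)[of j] j
          by (intro ennreal_leI power_mono) (auto simp: less_imp_le)
        finally show ?thesis .
      qed
      then show "\<forall>\<^sub>F j in sequentially. (\<integral>\<^sup>+x. ennreal ((norm (f n x - f (r j) x))\<^sup>2) \<partial>M) \<le> ennreal (((1/4) ^ k)\<^sup>2)"
        by (auto simp: eventually_sequentially)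
    qed simp
    finally show ?thesis .
  qed
  have diff_L2: "f n - g \<in> L2 M" if "n \<ge> N k" for n k
  proof -
    have "L2_sq M (f n - g) < \<infinity>" using dist_le[OF that] by (auto intro: le_less_trans)
    then show ?thesis by (simp add: L2_def fun_diff_def)
  qed
  have "f (N 0) - (f (N 0) - g) \<in> L2 M"
    by (intro L2_diff L2 diff_L2[of 0]) simp
  then have g: "g \<in> L2 M" by simp
  have dist: "l2norm M (f n - g) \<le> (1/4) ^ k" if "n \<ge> N k" for n k
  proof -
    have "ennreal ((l2norm M (f n - g))\<^sup>2) \<le> ennreal (((1/4) ^ k)\<^sup>2)"
      using dist_le[OF that] L2_sq_eq[OF diff_L2[OF that]] by simp
    then have "(l2norm M (f n - g))\<^sup>2 \<le> ((1/4) ^ k)\<^sup>2" by (simp add: ennreal_le_iff)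
    then show ?thesis by (rule power2_le_imp_le) simp
  qed
  have "(\<lambda>n. l2norm M (f n - g)) \<longlonglongrightarrow> 0"
  proof (rule LIMSEQ_I)
    fix e :: real assume "e > 0"
    then obtain k where "(1/4) ^ k < e" using real_arch_pow_inv[of e "1/4"] by auto
    then show "\<exists>n0. \<forall>n\<ge>n0. norm (l2norm M (f n - g) - 0) < e"
      using dist[of k] by (intro exI[of _ "N k"]) (auto intro: le_less_trans)
  qed
  with g show ?thesis by blast
qed

lemma L2_bilinear_tendsto:
  fixes B :: "'b::euclidean_space \<Rightarrow> 'c::euclidean_space \<Rightarrow> 'd::euclidean_space"
  assumes B: "bounded_bilinear B" and f: "\<And>n. f n \<in> L2 M" "f0 \<in> L2 M" and g: "g \<in> L2 M"
    and lim: "(\<lambda>n. l2norm M (f n - f0)) \<longlonglongrightarrow> 0"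
  shows "(\<lambda>n. LINT x|M. B (f n x) (g x)) \<longlonglongrightarrow> (LINT x|M. B (f0 x) (g x))"
proof -
  obtain K where K: "K \<ge> 0" "\<And>(M :: 'a measure) f g. f \<in> L2 M \<Longrightarrow> g \<in> L2 M \<Longrightarrow>
       norm (LINT x|M. B (f x) (g x)) \<le> K * (l2norm M f * l2norm M g)"
    using L2_bilinear_bound[OF B] by metis
  have le: "norm ((LINT x|M. B (f n x) (g x)) - (LINT x|M. B (f0 x) (g x))) \<le> K * (l2norm M (f n - f0) * l2norm M g)" for n
  proof -
    have "(LINT x|M. B (f n x) (g x)) - (LINT x|M. B (f0 x) (g x)) = (LINT x|M. B (f n x) (g x) - B (f0 x) (g x))"
      by (rule Bochner_Integration.integral_diff[symmetric]; rule L2_bilinear_integrable[OF B]; fact f g)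
    also have "\<dots> = (LINT x|M. B ((f n - f0) x) (g x))"
      by (simp add: bounded_bilinear.diff_left[OF B])
    finally show ?thesis using K(2)[OF L2_diff[OF f(1) f(2)] g, of n] by simp
  qed
  have "(\<lambda>n. K * (l2norm M (f n - f0) * l2norm M g)) \<longlonglongrightarrow> 0"
    by (intro tendsto_mult_right_zero tendsto_mult_left_zero lim)
  then have "(\<lambda>n. (LINT x|M. B (f n x) (g x)) - (LINT x|M. B (f0 x) (g x))) \<longlonglongrightarrow> 0"
    by (rule Lim_null_comparison[rotated]) (intro always_eventually allI le)
  then show ?thesis by (rule LIM_zero_cancel)
qed

lemma L2_bilinear_add:
  fixes B :: "'b::euclidean_space \<Rightarrow> 'c::euclidean_space \<Rightarrow> 'd::euclidean_space"
  assumes "bounded_bilinear B" "f \<in> L2 M" "f' \<in> L2 M" "g \<in> L2 M"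
  shows "(LINT x|M. B ((f + f') x) (g x)) = (LINT x|M. B (f x) (g x)) + (LINT x|M. B (f' x) (g x))"
  using assms by (simp add: bounded_bilinear.add_left[OF assms(1)] L2_bilinear_integrable)

lemma L2_bilinear_scaleR:
  fixes B :: "'b::euclidean_space \<Rightarrow> 'c::euclidean_space \<Rightarrow> 'd::euclidean_space"
  assumes "bounded_bilinear B"
  shows "(LINT x|M. B ((c *\<^sub>R f) x) (g x)) = c *\<^sub>R (LINT x|M. B (f x) (g x))"
  by (simp add: bounded_bilinear.scaleR_left[OF assms])

lemma L2_bounded:
  assumes "finite_measure M" "f \<in> borel_measurable M" "\<And>x. x \<in> space M \<Longrightarrow> norm (f x) \<le> B"
  shows "f \<in> L2 M"
proof -
  interpret finite_measure M by fact
  have "integrable M (\<lambda>x. (norm (f x))\<^sup>2)"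
  proof (rule integrable_const_bound[of _ "B\<^sup>2"])
    show "AE x in M. norm ((norm (f x))\<^sup>2) \<le> B\<^sup>2"
      using assms(3) by (intro AE_I2) (simp add: power_mono)
  qed (use assms(2) in measurable)
  then show ?thesis using assms by (simp add: L2_iff)
qed

lemma L2_integrable:
  assumes "finite_measure M" "f \<in> L2 M" shows "integrable M f"
proof -
  have one: "(\<lambda>x. 1 :: real) \<in> L2 M" by (rule L2_bounded[OF assms(1), of _ 1]) auto
  have "integrable M (\<lambda>x. norm (f x))"
    using L2_product_integrable[OF assms(2) one] by simp
  then show ?thesis using assms(2) by (simp add: L2_iff integrable_norm_iff)
qed

text \<open>This one statement covers multiplication by a material tensor, the cross product with the
normal and the normal component of a boundary field.\<close>

lemma L2_bounded_multiplier:
  fixes B :: "'b::euclidean_space \<Rightarrow> 'c::euclidean_space \<Rightarrow> 'd::euclidean_space"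
  assumes Bil: "bounded_bilinear B" and A: "A \<in> borel_measurable M" and C: "AE x in M. norm (A x) \<le> C"
  shows "\<exists>K\<ge>0. \<forall>u\<in>L2 M. (\<lambda>x. B (A x) (u x)) \<in> L2 M \<and> l2norm M (\<lambda>x. B (A x) (u x)) \<le> K * l2norm M u"
proof -
  obtain K where K: "K \<ge> 0" "\<And>a b. norm (B a b) \<le> norm a * norm b * K"
    using bounded_bilinear.nonneg_bounded[OF Bil] by blast
  define L where "L = \<bar>C\<bar> * K"
  have L: "L \<ge> 0" using K by (simp add: L_def)
  have pt: "AE x in M. (norm (B (A x) (u x)))\<^sup>2 \<le> L\<^sup>2 * (norm (u x))\<^sup>2" for u
    using C
  proof eventually_elim
    case (elim x)
    have "norm (B (A x) (u x)) \<le> norm (A x) * norm (u x) * K" by (rule K(2))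
    also have "\<dots> \<le> \<bar>C\<bar> * norm (u x) * K"
      using elim by (intro mult_right_mono K(1)) auto
    finally have "norm (B (A x) (u x)) \<le> L * norm (u x)" by (simp add: L_def mult_ac)
    then have "(norm (B (A x) (u x)))\<^sup>2 \<le> (L * norm (u x))\<^sup>2" by (rule power_mono) simp
    then show ?case by (simp add: power_mult_distrib)
  qed
  have cont: "continuous_on UNIV (\<lambda>p. B (fst p) (snd p))"
    by (rule bounded_bilinear.continuous_on[OF Bil continuous_on_fst[OF continuous_on_id] continuous_on_snd[OF continuous_on_id]])
  have meas: "(\<lambda>x. B (A x) (u x)) \<in> borel_measurable M" if "u \<in> L2 M" for u
  proof -
    have "u \<in> borel_measurable M" using that by (simp add: L2_iff)
    from borel_measurable_continuous_Pair[OF A this cont] show ?thesis by simp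
  qed
  have dom: "integrable M (\<lambda>x. L\<^sup>2 * (norm (u x))\<^sup>2)" if "u \<in> L2 M" for u :: "'a \<Rightarrow> 'c"
    using that by (simp add: L2_iff)
  have int: "integrable M (\<lambda>x. (norm (B (A x) (u x)))\<^sup>2)" if u: "u \<in> L2 M" for u
  proof (rule Bochner_Integration.integrable_bound[OF dom[OF u]])
    show "(\<lambda>x. (norm (B (A x) (u x)))\<^sup>2) \<in> borel_measurable M" using meas[OF u] by measurable
    show "AE x in M. norm ((norm (B (A x) (u x)))\<^sup>2) \<le> norm (L\<^sup>2 * (norm (u x))\<^sup>2)"
      using pt by (rule eventually_mono) simp
  qed
  have bound: "l2norm M (\<lambda>x. B (A x) (u x)) \<le> L * l2norm M u" if u: "u \<in> L2 M" for u
  proof (rule power2_le_imp_le)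
    have "(l2norm M (\<lambda>x. B (A x) (u x)))\<^sup>2 \<le> (LINT x|M. L\<^sup>2 * (norm (u x))\<^sup>2)"
      unfolding l2norm_sq by (rule integral_mono_AE[OF int[OF u] dom[OF u] pt])
    then show "(l2norm M (\<lambda>x. B (A x) (u x)))\<^sup>2 \<le> (L * l2norm M u)\<^sup>2"
      by (simp add: l2norm_sq power_mult_distrib)
  qed (use L in simp)
  have "(\<lambda>x. B (A x) (u x)) \<in> L2 M" if "u \<in> L2 M" for u
    using meas[OF that] int[OF that] by (simp add: L2_iff)
  with bound L show ?thesis by blast
qed

lemma l2norm_tendsto:
  assumes f: "\<And>n. f n \<in> L2 M" "g \<in> L2 M" and lim: "(\<lambda>n. l2norm M (f n - g)) \<longlonglongrightarrow> 0"
  shows "(\<lambda>n. l2norm M (f n)) \<longlonglongrightarrow> l2norm M g"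
proof -
  have le: "norm (l2norm M (f n) - l2norm M g) \<le> l2norm M (f n - g)" for n
    using l2norm_triangle[OF L2_diff[OF f(1)[of n] f(2)] f(2)]
      l2norm_triangle[OF L2_diff[OF f(2) f(1)[of n]] f(1)[of n]] l2norm_diff_commute[of M "f n" g]
    by (simp add: abs_le_iff)
  have "(\<lambda>n. l2norm M (f n) - l2norm M g) \<longlonglongrightarrow> 0"
    by (rule Lim_null_comparison[OF always_eventually[OF allI[OF le]] lim])
  then show ?thesis by (rule LIM_zero_cancel)
qed

lemma L2_sum: "(\<And>i. i \<in> I \<Longrightarrow> f i \<in> L2 M) \<Longrightarrow> (\<Sum>i\<in>I. f i) \<in> L2 M"
  by (rule subspace_sum[OF L2_subspace])

lemma l2norm_sum_le:
  assumes "finite I" "\<And>i. i \<in> I \<Longrightarrow> f i \<in> L2 M"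
  shows "l2norm M (\<Sum>i\<in>I. f i) \<le> (\<Sum>i\<in>I. l2norm M (f i))"
  using assms
proof (induction I rule: finite_induct)
  case empty show ?case by (simp add: l2norm_def)
next
  case (insert i I)
  have "l2norm M (f i + (\<Sum>i\<in>I. f i)) \<le> l2norm M (f i) + l2norm M (\<Sum>i\<in>I. f i)"
    by (intro l2norm_triangle L2_sum insert.prems) auto
  also have "\<dots> \<le> l2norm M (f i) + (\<Sum>i\<in>I. l2norm M (f i))"
    by (intro add_left_mono insert.IH insert.prems) simp
  finally show ?case unfolding sum.insert[OF insert.hyps] .
qed

lemma L2_series:
  fixes f :: "nat \<Rightarrow> 'a \<Rightarrow> 'b::euclidean_space"
  assumes f: "\<And>n. f n \<in> L2 M" and sm: "summable (\<lambda>n. l2norm M (f n))"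
  shows "\<exists>g\<in>L2 M. (\<lambda>n. l2norm M ((\<Sum>k<n. f k) - g)) \<longlonglongrightarrow> 0 \<and> l2norm M g \<le> (\<Sum>n. l2norm M (f n))"
proof -
  have S: "(\<Sum>k<n. f k) \<in> L2 M" for n using f by (rule L2_sum)
  have tail: "l2norm M ((\<Sum>k<m. f k) - (\<Sum>k<n. f k)) \<le> \<bar>(\<Sum>k<m. l2norm M (f k)) - (\<Sum>k<n. l2norm M (f k))\<bar>" for m n
  proof -
    have le: "l2norm M ((\<Sum>k<m. f k) - (\<Sum>k<n. f k)) \<le> (\<Sum>k<m. l2norm M (f k)) - (\<Sum>k<n. l2norm M (f k))" if "n \<le> m" for m n
    proof -
      have split: "{..<m} = {..<n} \<union> {n..<m}" "{..<n} \<inter> {n..<m} = {}" using that by auto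
      have "(\<Sum>k<m. f k) = (\<Sum>k<n. f k) + (\<Sum>k\<in>{n..<m}. f k)"
        unfolding split(1) by (rule sum.union_disjoint) (use split in auto)
      moreover have "(\<Sum>k<m. l2norm M (f k)) = (\<Sum>k<n. l2norm M (f k)) + (\<Sum>k\<in>{n..<m}. l2norm M (f k))"
        unfolding split(1) by (rule sum.union_disjoint) (use split in auto)
      ultimately show ?thesis using l2norm_sum_le[of "{n..<m}" f M] f by simp
    qed
    show ?thesis
    proof (cases "n \<le> m")
      case True then show ?thesis using le[OF True] by linarith
    next
      case False
      then have "l2norm M ((\<Sum>k<n. f k) - (\<Sum>k<m. f k)) \<le> (\<Sum>k<n. l2norm M (f k)) - (\<Sum>k<m. l2norm M (f k))"
        by (intro le) simp
      then show ?thesis using l2norm_diff_commute[of M "\<Sum>k<m. f k" "\<Sum>k<n. f k"] by linarith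
    qed
  qed
  have "\<exists>g\<in>L2 M. (\<lambda>n. l2norm M ((\<Sum>k<n. f k) - g)) \<longlonglongrightarrow> 0"
  proof (rule L2_complete[OF S])
    fix e :: real assume "e > 0"
    have "Cauchy (\<lambda>n. \<Sum>k<n. l2norm M (f k))"
      using sm by (simp add: summable_iff_convergent convergent_Cauchy)
    then obtain N where "\<forall>m\<ge>N. \<forall>n\<ge>N. norm ((\<Sum>k<m. l2norm M (f k)) - (\<Sum>k<n. l2norm M (f k))) < e"
      using CauchyD \<open>e > 0\<close> by blast
    then show "\<exists>N. \<forall>m\<ge>N. \<forall>n\<ge>N. l2norm M ((\<Sum>k<m. f k) - (\<Sum>k<n. f k)) < e"
      unfolding real_norm_def using tail le_less_trans by blast
  qed
  then obtain g where g: "g \<in> L2 M" "(\<lambda>n. l2norm M ((\<Sum>k<n. f k) - g)) \<longlonglongrightarrow> 0" by blast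
  have "l2norm M g \<le> (\<Sum>n. l2norm M (f n))"
  proof (rule LIMSEQ_le_const2[OF l2norm_tendsto[OF S g]], intro exI allI impI)
    fix n
    have "l2norm M (\<Sum>k<n. f k) \<le> (\<Sum>k<n. l2norm M (f k))" using f by (intro l2norm_sum_le) auto
    also have "\<dots> \<le> (\<Sum>n. l2norm M (f n))" by (rule sum_le_suminf[OF sm]) auto
    finally show "l2norm M (\<Sum>k<n. f k) \<le> (\<Sum>n. l2norm M (f n))" .
  qed
  with g show ?thesis by blast
qed

lemma l2norm_diff_cong:
  assumes "AE x in M. g x = g' x" "f \<in> L2 M" "g \<in> L2 M" "g' \<in> L2 M"
  shows "l2norm M (f - g) = l2norm M (f - g')"
proof (rule l2norm_cong_AE)
  show "AE x in M. (f - g) x = (f - g') x" using assms(1) by (rule eventually_mono) simp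
qed (intro L2_diff assms)+

lemma l2norm_triangle_diff:
  assumes "f \<in> L2 M" "g \<in> L2 M" "h \<in> L2 M"
  shows "l2norm M (f - h) \<le> l2norm M (f - g) + l2norm M (g - h)"
  using l2norm_triangle[OF L2_diff[OF assms(1,2)] L2_diff[OF assms(2,3)]] by simp

text \<open>The last term is the source of the strong convexity of the cost.\<close>

lemma l2norm_midpoint:
  assumes "a \<in> L2 M" "b \<in> L2 M"
  shows "(l2norm M ((1/2) *\<^sub>R (a + b)))\<^sup>2 = ((l2norm M a)\<^sup>2 + (l2norm M b)\<^sup>2) / 2 - (l2norm M (a - b))\<^sup>2 / 4"
proof -
  have "(l2norm M ((1/2) *\<^sub>R (a + b)))\<^sup>2 = (l2norm M (a + b))\<^sup>2 / 4"
    unfolding l2norm_scaleR by (simp add: power_divide)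
  then show ?thesis using l2norm_parallelogram[OF assms] by (simp only:) (simp add: field_simps)
qed

section \<open>Countably subadditive seminorms and strongly convex minimization\<close>

text \<open>Only seminorms are available on spaces of functions, since functions that agree almost everywhere
are at distance zero; a pseudometric replaces the metric throughout.\<close>

locale seminorm_on =
  fixes Z :: "'a::real_vector set" and N :: "'a \<Rightarrow> real"
  assumes subspace: "subspace Z"
    and triangle: "x \<in> Z \<Longrightarrow> y \<in> Z \<Longrightarrow> N (x + y) \<le> N x + N y"
    and scale: "x \<in> Z \<Longrightarrow> N (c *\<^sub>R x) = \<bar>c\<bar> * N x"
begin

lemmas closed = subspace_0[OF subspace] subspace_add[OF subspace] subspace_diff[OF subspace]
  subspace_scale[OF subspace] subspace_sum[OF subspace]

lemma zero: "N 0 = 0"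
  using scale[of 0 0] closed(1) by simp

lemma minus_commute: "x \<in> Z \<Longrightarrow> y \<in> Z \<Longrightarrow> N (x - y) = N (y - x)"
  using scale[of "x - y" "-1"] closed(3) by simp

lemma nonneg: assumes "x \<in> Z" shows "0 \<le> N x"
proof -
  have "N (x + (-1) *\<^sub>R x) \<le> N x + N ((-1) *\<^sub>R x)"
    using assms closed(4) by (intro triangle) blast+
  then show ?thesis using scale[OF assms, of "-1"] zero by simp
qed

lemma triangle_minus: "x \<in> Z \<Longrightarrow> y \<in> Z \<Longrightarrow> N (x - y) \<le> N x + N y"
  using triangle[of x "(-1) *\<^sub>R y"] scale[of y "-1"] closed(4)[of y "-1"] by simp

lemma triangle_diff: "x \<in> Z \<Longrightarrow> y \<in> Z \<Longrightarrow> z \<in> Z \<Longrightarrow> N (x - z) \<le> N (x - y) + N (y - z)"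
  using triangle[of "x - y" "y - z"] closed(3) by simp

end

locale complete_seminorm_on = seminorm_on +
  assumes complete: "(\<And>n :: nat. x n \<in> Z) \<Longrightarrow>
     (\<And>e. e > 0 \<Longrightarrow> \<exists>n0. \<forall>m\<ge>n0. \<forall>n\<ge>n0. N (x m - x n) < e) \<Longrightarrow>
     \<exists>y\<in>Z. (\<lambda>n. N (x n - y)) \<longlonglongrightarrow> 0"
begin

text \<open>Closed balls are closed under limits; the bound is only required from some index on.\<close>

lemma tendsto_bound:
  assumes "\<And>n :: nat. x n \<in> Z" "y \<in> Z" "w \<in> Z" "(\<lambda>n. N (x n - y)) \<longlonglongrightarrow> 0"
    and "\<And>n. n \<ge> k \<Longrightarrow> N (w - x n) \<le> r"
  shows "N (w - y) \<le> r"
proof -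
  have "(\<lambda>n. r + N (x n - y)) \<longlonglongrightarrow> r + 0"
    by (intro tendsto_intros assms(4))
  moreover have "N (w - y) \<le> r + N (x n - y)" if "n \<ge> k" for n
    using triangle_diff[OF assms(3) assms(1)[of n] assms(2)] assms(5)[OF that] by simp
  ultimately show ?thesis
    using LIMSEQ_le_const[of "\<lambda>n. r + N (x n - y)" "r + 0" "N (w - y)"] by auto
qed

text \<open>Baire's theorem for the sublevel sets of \<open>p\<close>, which exhaust the space: one of them is dense in
some ball. Otherwise every ball contains a smaller closed ball on which \<open>p\<close> exceeds a prescribed
number, and the common point of a nested sequence of such balls would have infinite \<open>p\<close>.\<close>

lemma Baire_ball:
  fixes p :: "'a \<Rightarrow> real"
  shows "\<exists>c. \<exists>x0\<in>Z. \<exists>r>0. \<forall>x\<in>Z. N (x - x0) < r \<longrightarrow> (\<forall>e>0. \<exists>y\<in>Z. p y \<le> c \<and> N (x - y) < e)"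
proof (rule ccontr)
  assume no: "\<not> ?thesis"
  have neg: "\<exists>x\<in>Z. N (x - x0) < r \<and> (\<exists>e>0. \<forall>y\<in>Z. N (x - y) < e \<longrightarrow> c < p y)"
    if x0: "x0 \<in> Z" "r > 0" for x0 r c
  proof (rule ccontr)
    assume contr: "\<not> ?thesis"
    have "\<exists>y\<in>Z. p y \<le> c \<and> N (x - y) < e" if x: "x \<in> Z" "N (x - x0) < r" and e: "e > 0" for x e
    proof -
      have "\<not> (\<forall>y\<in>Z. N (x - y) < e \<longrightarrow> c < p y)" using contr x e by blast
      then show ?thesis unfolding not_less[symmetric] by blast
    qed
    then have "\<forall>x\<in>Z. N (x - x0) < r \<longrightarrow> (\<forall>e>0. \<exists>y\<in>Z. p y \<le> c \<and> N (x - y) < e)" by blast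
    with no x0 show False by blast
  qed
  define ok where "ok q \<longleftrightarrow> fst q \<in> Z \<and> snd q > 0" for q :: "'a \<times> real"
  define next_ok where "next_ok k q q' \<longleftrightarrow> N (fst q' - fst q) < snd q / 2 \<and> snd q' \<le> snd q / 2 \<and>
      (\<forall>y\<in>Z. N (fst q' - y) \<le> snd q' \<longrightarrow> real k < p y)" for k and q q' :: "'a \<times> real"
  have start: "\<exists>q. ok q" using closed(1) by (intro exI[of _ "(0, 1)"]) (simp add: ok_def)
  have step: "\<exists>q'. ok q' \<and> next_ok k q q'" if q: "ok q" for q k
  proof -
    obtain x e where x: "x \<in> Z" "N (x - fst q) < snd q / 2" "e > 0" "\<And>y. y \<in> Z \<Longrightarrow> N (x - y) < e \<Longrightarrow> real k < p y"
      using neg[of "fst q" "snd q / 2" "real k"] q by (auto simp: ok_def)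
    \<comment> \<open>half of \<open>e\<close> because the closed ball is to lie in the open ball of radius \<open>e\<close>\<close>
    then show ?thesis
      using q by (intro exI[of _ "(x, min (e / 2) (snd q / 2))"]) (auto simp: ok_def next_ok_def)
  qed
  obtain q where q: "ok (q k)" and q_step: "next_ok k (q k) (q (Suc k))" for k
    using dependent_nat_choice[of "\<lambda>_. ok" next_ok, OF start step] by blast
  define x r where "x k = fst (q k)" and "r k = snd (q k)" for k
  have x: "x k \<in> Z" and r: "r k > 0" for k using q by (auto simp: x_def r_def ok_def)
  have step: "N (x k - x (Suc k)) \<le> r k / 2" "r (Suc k) \<le> r k / 2"
    "\<And>y. y \<in> Z \<Longrightarrow> N (x (Suc k) - y) \<le> r (Suc k) \<Longrightarrow> real k < p y" for k
    using q_step[of k] minus_commute[OF x x, of "Suc k" k] by (auto simp: x_def r_def next_ok_def)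
  have near: "N (x k - x (k + j)) + r (k + j) \<le> r k" for k j
  proof (induction j)
    case 0 show ?case by (simp add: zero)
  next
    case (Suc j)
    then show ?case
      using triangle_diff[OF x x x, of k "Suc (k + j)" "k + j"] step(1,2)[of "k + j"] by simp
  qed
  have near': "N (x k - x n) \<le> r k" if "n \<ge> k" for k n
    using near[of k "n - k"] r[of n] that by simp
  have r_pow: "r k \<le> r 0 * (1/2) ^ k" for k
  proof (induction k)
    case (Suc k) then show ?case using step(2)[of k] by simp
  qed simp
  have "\<exists>y\<in>Z. (\<lambda>n. N (x n - y)) \<longlonglongrightarrow> 0"
  proof (rule complete[OF x])
    fix e :: real assume "e > 0"
    then obtain k where k: "(1/2) ^ k < e / (2 * r 0)"
      using real_arch_pow_inv[of "e / (2 * r 0)" "1/2"] r[of 0] by auto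
    have "N (x m - x n) < e" if "m \<ge> k" "n \<ge> k" for m n
    proof -
      have "N (x m - x n) \<le> N (x k - x m) + N (x k - x n)"
        using triangle_diff[OF x x x, of m n k] minus_commute[OF x x, of m k] by simp
      also have "\<dots> \<le> 2 * r k" using near'[OF that(1)] near'[OF that(2)] by simp
      also have "\<dots> \<le> 2 * (r 0 * (1/2) ^ k)" using r_pow by simp
      also have "\<dots> < e" using k r[of 0] by (simp add: field_simps)
      finally show ?thesis .
    qed
    then show "\<exists>n0. \<forall>m\<ge>n0. \<forall>n\<ge>n0. N (x m - x n) < e" by blast
  qed
  then obtain y where y: "y \<in> Z" "(\<lambda>n. N (x n - y)) \<longlonglongrightarrow> 0" by blast
  have "real k < p y" for k
    by (rule step(3)[OF y(1)], rule tendsto_bound[OF x y(1) x y(2), of "Suc k"], rule near')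
  moreover obtain k where "p y \<le> real k" using real_arch_simple by blast
  ultimately show False by (metis not_le)
qed

text \<open>The ball on which a sublevel set of \<open>p\<close> is dense may be centred at the origin, since sublevel sets
of seminorms are symmetric and convex. By scaling, every point of the ball of radius \<open>r * t\<close> is then
approximated by points with \<open>p\<close> at most \<open>c * t\<close>. Approximating the remaining error again and again,
with radii halved each time, writes any point of the ball as a series along which \<open>p\<close> is summable,
and countable subadditivity bounds \<open>p\<close> there. The closed graph theorem is the case
\<open>p x = norm (T x)\<close>.\<close>

theorem Zabreiko:
  assumes p: "seminorm_on Z p"
    and countably_subadditive: "\<And>x y. (\<And>n :: nat. x n \<in> Z) \<Longrightarrow> y \<in> Z \<Longrightarrow>
      (\<lambda>n. N ((\<Sum>k<n. x k) - y)) \<longlonglongrightarrow> 0 \<Longrightarrow> summable (\<lambda>n. p (x n)) \<Longrightarrow> p y \<le> (\<Sum>n. p (x n))"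
  shows "\<exists>C\<ge>0. \<forall>x\<in>Z. p x \<le> C * N x"
proof -
  interpret p: seminorm_on Z p by (rule p)
  obtain c x0 r where x0: "x0 \<in> Z" and r: "r > 0"
    and "\<forall>x\<in>Z. N (x - x0) < r \<longrightarrow> (\<forall>e>0. \<exists>y\<in>Z. p y \<le> c \<and> N (x - y) < e)"
    using Baire_ball[of p] by blast
  then have ball: "\<exists>y\<in>Z. p y \<le> c \<and> N (x - y) < e"
    if "x \<in> Z" "N (x - x0) < r" "e > 0" for x e
    using that by blast
  have c: "c \<ge> 0"
  proof -
    obtain y where "y \<in> Z" "p y \<le> c" using ball[OF x0, of 1] zero r by auto
    then show ?thesis using p.nonneg[of y] by simp
  qed
  \<comment> \<open>\<open>x\<close> is half the difference of \<open>x0 + x\<close> and \<open>x0 - x\<close>, which both lie in the ball\<close>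
  have centred: "\<exists>y\<in>Z. p y \<le> c \<and> N (x - y) < e" if x: "x \<in> Z" "N x < r" and e: "e > 0" for x e
  proof -
    obtain y1 where y1: "y1 \<in> Z" "p y1 \<le> c" "N (x0 + x - y1) < e"
      using ball[of "x0 + x" e] x x0 e closed(2) by auto
    have "N (x0 - x - x0) = N x" using scale[OF x(1), of "-1"] by simp
    then obtain y2 where y2: "y2 \<in> Z" "p y2 \<le> c" "N (x0 - x - y2) < e"
      using ball[of "x0 - x" e] x x0 e closed(3) by auto
    define y where "y = (1/2) *\<^sub>R (y1 - y2)"
    have "y \<in> Z" using y1 y2 closed by (simp add: y_def)
    moreover have "p y \<le> c"
      using p.scale[OF closed(3)[OF y1(1) y2(1)], of "1/2"] p.triangle_minus[OF y1(1) y2(1)] y1 y2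
      by (simp add: y_def)
    moreover have "N (x - y) < e"
    proof -
      define a b where "a = x0 + x - y1" and "b = x0 - x - y2"
      have ab: "a \<in> Z" "b \<in> Z" using x x0 y1 y2 closed by (auto simp: a_def b_def)
      have "x - y = (1/2) *\<^sub>R (a - b)"
        by (simp add: y_def a_def b_def algebra_simps) (simp flip: scaleR_add_left)
      then have "N (x - y) = (1/2) * N (a - b)"
        using scale[OF closed(3)[OF ab], of "1/2"] by simp
      also have "\<dots> \<le> (1/2) * (N a + N b)" using triangle_minus[OF ab] by simp
      finally show ?thesis using y1(3) y2(3) by (simp add: a_def b_def)
    qed
    ultimately show ?thesis by blast
  qed
  have scaled: "\<exists>y\<in>Z. p y \<le> c * t \<and> N (x - y) < e" if x: "x \<in> Z" "N x < r * t" and e: "e > 0" and t: "t > 0" for x e t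
  proof -
    have "t * N ((1/t) *\<^sub>R x) < t * r" using x t scale[OF x(1), of "1/t"] by (simp add: mult.commute)
    then have "N ((1/t) *\<^sub>R x) < r" using t by simp
    then obtain y where y: "y \<in> Z" "p y \<le> c" "N ((1/t) *\<^sub>R x - y) < e / t"
      using centred[of "(1/t) *\<^sub>R x" "e / t"] x e t closed(4) by auto
    have "N (x - t *\<^sub>R y) = t * N ((1/t) *\<^sub>R x - y)"
      using scale[of "(1/t) *\<^sub>R x - y" t] x y t closed by (simp add: scaleR_diff_right)
    then show ?thesis
      using y t closed(4)[OF y(1), of t] p.scale[OF y(1), of t]
      by (intro bexI[of _ "t *\<^sub>R y"]) (auto simp: field_simps mult_left_mono)
  qed
  \<comment> \<open>the factor 2 is the sum of the geometric series of the halved radii\<close>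
  have unit: "p x \<le> 2 * c" if x: "x \<in> Z" "N x < r" for x
  proof -
    define ok where "ok k s \<longleftrightarrow> s \<in> Z \<and> N (x - s) < r * (1/2) ^ k \<and> (k = 0 \<longrightarrow> s = 0)" for k s
    have start: "\<exists>s. ok 0 s"
      using x closed(1) by (intro exI[of _ 0]) (simp add: ok_def)
    have step: "\<exists>s'. ok (Suc k) s' \<and> p (s' - s) \<le> c * (1/2) ^ k" if s: "ok k s" for s k
    proof -
      have sk: "s \<in> Z" "N (x - s) < r * (1/2) ^ k" using s by (auto simp: ok_def)
      obtain y where y: "y \<in> Z" "p y \<le> c * (1/2) ^ k" "N (x - s - y) < r * (1/2) ^ Suc k"
        using scaled[of "x - s" "(1/2) ^ k" "r * (1/2) ^ Suc k"] sk x r closed(3) by auto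
      then show ?thesis
        using sk closed(2) by (intro exI[of _ "s + y"]) (simp add: ok_def diff_diff_eq)
    qed
    obtain s where s_ok: "ok k (s k)" and s_step: "p (s (Suc k) - s k) \<le> c * (1/2) ^ k" for k
      using dependent_nat_choice[of ok "\<lambda>k s s'. p (s' - s) \<le> c * (1/2) ^ k", OF start step] by blast
    have s: "s k \<in> Z \<and> N (x - s k) < r * (1/2) ^ k \<and> (k = 0 \<longrightarrow> s k = 0)" for k
      using s_ok[of k] by (simp add: ok_def)
    have sZ: "s k \<in> Z" for k using s by blast
    have "(\<lambda>n. N (x - s n)) \<longlonglongrightarrow> 0"
    proof (rule tendsto_sandwich[OF _ _ tendsto_const])
      show "(\<lambda>k. r * (1/2) ^ k) \<longlonglongrightarrow> 0"
        by (intro tendsto_mult_right_zero LIMSEQ_realpow_zero) auto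
      show "\<forall>\<^sub>F k in sequentially. 0 \<le> N (x - s k)"
        using nonneg[OF closed(3)[OF x(1) sZ]] by simp
      show "\<forall>\<^sub>F k in sequentially. N (x - s k) \<le> r * (1/2) ^ k"
        using s by (simp add: less_imp_le)
    qed
    then have "(\<lambda>n. N ((\<Sum>k<n. s (Suc k) - s k) - (x - s 0))) \<longlonglongrightarrow> 0"
      using minus_commute[OF x(1) sZ] by (simp add: sum_lessThan_telescope)
    moreover have dZ: "s (Suc k) - s k \<in> Z" for k using sZ closed(3) by blast
    moreover have sm: "summable (\<lambda>k. p (s (Suc k) - s k))"
    proof (rule summable_comparison_test')
      show "summable (\<lambda>k. c * (1/2) ^ k)" by (intro summable_mult summable_geometric) simp
      show "norm (p (s (Suc k) - s k)) \<le> c * (1/2) ^ k" if "k \<ge> 0" for k using s_step p.nonneg[OF dZ] by simp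
    qed
    ultimately have "p (x - s 0) \<le> (\<Sum>k. p (s (Suc k) - s k))"
      using x(1) sZ[of 0] closed(3) by (intro countably_subadditive) auto
    also have "\<dots> \<le> (\<Sum>k. c * (1/2) ^ k)"
      using s_step by (intro suminf_le sm summable_mult summable_geometric) auto
    also have "\<dots> = 2 * c"
      by (subst suminf_mult) (auto intro: summable_geometric simp: suminf_geometric)
    finally have "p (x - s 0) \<le> 2 * c" .
    then show ?thesis using s[of 0] by simp
  qed
  have bound: "p x \<le> (2 * c / r) * t" if x: "x \<in> Z" "N x < t" for x t
  proof -
    have t: "t > 0" using nonneg[OF x(1)] x(2) by simp
    have "t * N ((r / t) *\<^sub>R x) = r * N x" using t r scale[OF x(1), of "r / t"] by simp
    also have "\<dots> < t * r" using x r by (simp add: mult.commute)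
    finally have "N ((r / t) *\<^sub>R x) < r" using t by simp
    then have "p ((r / t) *\<^sub>R x) \<le> 2 * c" using unit closed(4)[OF x(1)] by blast
    then show ?thesis using p.scale[OF x(1), of "r / t"] t r by (simp add: field_simps)
  qed
  have "p x \<le> (2 * c / r) * N x" if x: "x \<in> Z" for x
  proof (rule tendsto_lowerbound)
    show "((\<lambda>t. (2 * c / r) * t) \<longlongrightarrow> (2 * c / r) * N x) (at_right (N x))"
      by (intro tendsto_intros)
    show "\<forall>\<^sub>F t in at_right (N x). p x \<le> (2 * c / r) * t"
      using eventually_at_right_less[of "N x"] by (rule eventually_mono) (rule bound[OF x])
  qed simp
  then show ?thesis using c r by (intro exI[of _ "2 * c / r"]) auto
qed

text \<open>The midpoint inequality, read with the infimum in place of the value at the midpoint, bounds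
the distance of two points by how far their values exceed the infimum. So minimizing sequences are
Cauchy and minimizers are unique.\<close>

theorem strongly_convex_minimum:
  fixes J :: "'a \<Rightarrow> real"
  assumes J_nonneg: "\<And>x. x \<in> Z \<Longrightarrow> 0 \<le> J x"
    and c: "c > 0"
    and midpoint: "\<And>x y. x \<in> Z \<Longrightarrow> y \<in> Z \<Longrightarrow>
      J ((1/2) *\<^sub>R (x + y)) \<le> (J x + J y) / 2 - c * (N (x - y))\<^sup>2"
    and continuous: "\<And>x y. (\<And>n :: nat. x n \<in> Z) \<Longrightarrow> y \<in> Z \<Longrightarrow> (\<lambda>n. N (x n - y)) \<longlonglongrightarrow> 0 \<Longrightarrow>
      (\<lambda>n. J (x n)) \<longlonglongrightarrow> J y"
  obtains y where "y \<in> Z" "\<And>x. x \<in> Z \<Longrightarrow> J y \<le> J x"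
    "\<And>y'. y' \<in> Z \<Longrightarrow> (\<And>x. x \<in> Z \<Longrightarrow> J y' \<le> J x) \<Longrightarrow> N (y' - y) = 0"
proof -
  define m where "m = (INF x\<in>Z. J x)"
  have bdd: "bdd_below (J ` Z)" using J_nonneg by (auto intro!: bdd_belowI[of _ 0])
  have m_le: "m \<le> J x" if "x \<in> Z" for x
    unfolding m_def using bdd that by (rule cINF_lower)
  have dist: "c * (N (x - y))\<^sup>2 \<le> (J x + J y) / 2 - m" if "x \<in> Z" "y \<in> Z" for x y
    using midpoint[OF that] m_le[of "(1/2) *\<^sub>R (x + y)"] that closed by fastforce
  have "\<exists>x\<in>Z. J x < m + (1/2) ^ n" for n :: nat
    using cINF_less_iff[OF _ bdd, of "m + (1/2) ^ n"] closed(1) by (auto simp: m_def)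
  then obtain x where x: "\<And>n. x n \<in> Z" "\<And>n :: nat. J (x n) < m + (1/2) ^ n" by metis
  have "\<exists>y\<in>Z. (\<lambda>n. N (x n - y)) \<longlonglongrightarrow> 0"
  proof (rule complete[OF x(1)])
    fix e :: real assume e: "e > 0"
    obtain k where k: "(1/2) ^ k < c * e\<^sup>2"
      using real_arch_pow_inv[of "c * e\<^sup>2" "1/2"] c e by auto
    define q where "q = (1/2 :: real) ^ k"
    have q: "q < c * e\<^sup>2" using k by (simp only: q_def)
    have "N (x i - x j) < e" if "i \<ge> k" "j \<ge> k" for i j
    proof -
      have *: "J (x n) < m + q" if "n \<ge> k" for n
        by (rule less_le_trans[OF x(2)]) (use that in \<open>auto simp: q_def simp del: power_one_over intro!: power_decreasing\<close>)
      have "(J (x i) + J (x j)) / 2 - m < q"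
        using *[OF that(1)] *[OF that(2)] by (simp add: field_simps)
      then have "c * (N (x i - x j))\<^sup>2 < c * e\<^sup>2"
        using le_less_trans[OF dist[OF x(1)[of i] x(1)[of j]] less_trans[OF _ q]] by simp
      then have "(N (x i - x j))\<^sup>2 < e\<^sup>2" using c by simp
      then show ?thesis using e by (simp add: power2_less_imp_less)
    qed
    then show "\<exists>n0. \<forall>m\<ge>n0. \<forall>n\<ge>n0. N (x m - x n) < e" by blast
  qed
  then obtain y where y: "y \<in> Z" "(\<lambda>n. N (x n - y)) \<longlonglongrightarrow> 0" by blast
  have "J y \<le> m + 0"
  proof (rule LIMSEQ_le[OF continuous[OF x(1) y]])
    show "(\<lambda>n. m + (1/2) ^ n) \<longlonglongrightarrow> m + 0"
      by (intro tendsto_intros LIMSEQ_realpow_zero) auto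
  qed (use x(2) in \<open>auto intro: less_imp_le\<close>)
  then have J_y: "J y = m" using m_le[OF y(1)] by simp
  show ?thesis
  proof (rule that[OF y(1)])
    show "J y \<le> J x" if "x \<in> Z" for x using m_le[OF that] J_y by simp
    show "N (y' - y) = 0" if y': "y' \<in> Z" "\<And>x. x \<in> Z \<Longrightarrow> J y' \<le> J x" for y'
    proof -
      have "J y' = m" using y'(2)[OF y(1)] m_le[OF y'(1)] J_y by simp
      then have "c * (N (y' - y))\<^sup>2 \<le> 0" using dist[OF y'(1) y(1)] J_y by simp
      then show ?thesis using c by (simp add: mult_le_0_iff)
    qed
  qed
qed

end

section \<open>Smooth functions and bump functions\<close>

lemma has_derivative_frechet:
  "f differentiable (at x) \<Longrightarrow> (f has_derivative frechet_derivative f (at x)) (at x)"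
  by (simp add: frechet_derivative_works)

lemma partial_unique:
  assumes "(f has_derivative F) (at x)" shows "partial i f x = F (axis i 1)"
  using frechet_derivative_at[OF assms] by (simp add: partial_def)

lemma partial_add:
  assumes "f differentiable (at x)" "g differentiable (at x)"
  shows "partial i (\<lambda>x. f x + g x) x = partial i f x + partial i g x"
  by (subst partial_unique[OF has_derivative_add[OF assms[THEN has_derivative_frechet]]]) (simp add: partial_def)

lemma partial_bounded_linear:
  assumes "bounded_linear L" "f differentiable (at x)"
  shows "partial i (\<lambda>x. L (f x)) x = L (partial i f x)"
  by (subst partial_unique[OF bounded_linear.has_derivative[OF assms(1) assms(2)[THEN has_derivative_frechet]]])
     (simp add: partial_def)

lemma Ck_continuous: "Ck k f \<Longrightarrow> continuous_on UNIV f"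
  by (cases k) (auto simp: continuous_on_eq_continuous_at differentiable_imp_continuous_within)

lemma Ck_add: "Ck k f \<Longrightarrow> Ck k g \<Longrightarrow> Ck k (\<lambda>x. f x + g x)"
proof (induction k arbitrary: f g)
  case 0 then show ?case by (auto intro: continuous_on_add)
next
  case (Suc k)
  then have "partial i (\<lambda>x. f x + g x) = (\<lambda>x. partial i f x + partial i g x)" for i
    by (simp add: fun_eq_iff partial_add)
  with Suc show ?case by auto
qed

lemma Ck_bounded_linear: "bounded_linear L \<Longrightarrow> Ck k f \<Longrightarrow> Ck k (\<lambda>x. L (f x))"
proof (induction k arbitrary: f)
  case 0 then show ?case by (auto intro: bounded_linear.continuous_on)
next
  case (Suc k)
  then have "partial i (\<lambda>x. L (f x)) = (\<lambda>x. L (partial i f x))" for i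
    by (simp add: fun_eq_iff partial_bounded_linear)
  with Suc show ?case by (auto intro: differentiable_compose[OF bounded_linear_imp_differentiable])
qed

lemma smooth_add: "smooth f \<Longrightarrow> smooth g \<Longrightarrow> smooth (f + g)"
  by (simp add: smooth_def plus_fun_def Ck_add)

lemma smooth_bounded_linear: "bounded_linear L \<Longrightarrow> smooth f \<Longrightarrow> smooth (\<lambda>x. L (f x))"
  by (simp add: smooth_def Ck_bounded_linear)

lemma smooth_differentiable: "smooth f \<Longrightarrow> f differentiable (at x)"
  unfolding smooth_def by (metis Ck.simps(2))

lemma smooth_continuous: "smooth f \<Longrightarrow> continuous_on UNIV f"
  unfolding smooth_def using Ck_continuous by blast

lemma smooth_partial: "smooth f \<Longrightarrow> smooth (partial i f)"
  unfolding smooth_def by (metis Ck.simps(2))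

lemma classical_curl_continuous:
  assumes "smooth f" shows "continuous_on UNIV (classical_curl f)"
proof -
  have [continuous_intros]: "continuous_on UNIV (partial i f)" for i
    using assms by (intro smooth_continuous smooth_partial)
  have "continuous_on UNIV (\<lambda>x. classical_curl f x $ j)" for j
    using exhaust_3[of j] by (elim disjE) (simp_all add: classical_curl_def, (intro continuous_intros)+)
  then have "continuous_on UNIV (\<lambda>x. \<chi> j. classical_curl f x $ j)"
    by (rule continuous_on_vec_lambda)
  then show ?thesis by simp
qed

lemma classical_curl_add:
  assumes "smooth f" "smooth g" shows "classical_curl (f + g) = classical_curl f + classical_curl g"
  using assms by (auto simp: fun_eq_iff classical_curl_def vec_eq_iff forall_3 plus_fun_def partial_add
      smooth_differentiable)

lemma bounded_linear_nth: "bounded_linear (\<lambda>v. v $ i)"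
  by (simp add: bounded_linear_vec_nth)

text \<open>For \<open>k = 0\<close> this is the standard smooth function that vanishes to infinite order at 0; the powers
in the denominator make the family closed under differentiation.\<close>

definition flat :: "real \<Rightarrow> nat \<Rightarrow> real \<Rightarrow> real" where
  "flat c k t = (if t \<le> 0 then 0 else exp (- (c / t)) / t ^ k)"

text \<open>Exponential decay beats any power: substitute \<open>s = 1 / t\<close>.\<close>

lemma flat_tendsto_0:
  assumes c: "c > 0" shows "(flat c k \<longlongrightarrow> 0) (at 0)"
proof (rule filterlim_split_at)
  have "\<forall>\<^sub>F t in at_left 0. 0 = flat c k t"
    using eventually_at_left_real[of "-1" 0] by (rule eventually_mono) (auto simp: flat_def)
  then show "(flat c k \<longlongrightarrow> 0) (at_left 0)"
    by (rule Lim_transform_eventually[rotated]) simp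
  have "filterlim (\<lambda>s. c * s) at_top at_top"
    by (rule filterlim_tendsto_pos_mult_at_top[OF tendsto_const c filterlim_ident])
  from filterlim_compose[OF tendsto_power_div_exp_0[of k] this]
  have "((\<lambda>s. (1 / c ^ k) * ((c * s) ^ k / exp (c * s))) \<longlongrightarrow> (1 / c ^ k) * 0) at_top"
    by (intro tendsto_intros)
  then have "((\<lambda>s. s ^ k / exp (c * s)) \<longlongrightarrow> 0) at_top"
    using c by (simp add: power_mult_distrib)
  moreover have "\<forall>\<^sub>F s in at_top. s ^ k / exp (c * s) = flat c k (inverse s)"
    using eventually_gt_at_top[of 0]
    by (rule eventually_mono) (simp add: flat_def exp_minus field_simps)
  ultimately have "((\<lambda>s. flat c k (inverse s)) \<longlongrightarrow> 0) at_top"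
    by (rule Lim_transform_eventually)
  then show "(flat c k \<longlongrightarrow> 0) (at_right 0)"
    by (simp add: filterlim_at_right_to_top)
qed

lemma flat_derivative:
  assumes c: "c > 0"
  shows "(flat c k has_real_derivative c * flat c (k + 2) t - real k * flat c (k + 1) t) (at t)"
proof -
  consider "t < 0" | "t = 0" | "t > 0" by linarith
  then show ?thesis
  proof cases
    case 1
    have "((\<lambda>_. 0) has_real_derivative 0) (at t)" by simp
    then have "(flat c k has_real_derivative 0) (at t)"
      by (rule has_field_derivative_transform_within_open[of _ _ _ "{..<0}"]) (use 1 in \<open>auto simp: flat_def\<close>)
    with 1 show ?thesis by (simp add: flat_def)
  next
    case 2
    \<comment> \<open>the difference quotient at 0 is again a member of the family\<close>
    have "((\<lambda>h. (flat c k (0 + h) - flat c k 0) / h) \<longlongrightarrow> 0) (at 0)"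
    proof (rule Lim_transform_eventually[OF flat_tendsto_0[OF c, of "Suc k"]])
      show "\<forall>\<^sub>F h in at 0. flat c (Suc k) h = (flat c k (0 + h) - flat c k 0) / h"
        by (auto simp: eventually_at flat_def intro!: exI[of _ 1])
    qed
    with 2 show ?thesis by (simp add: DERIV_def flat_def)
  next
    case 3
    have "((\<lambda>t. exp (- (c / t)) / t ^ k) has_real_derivative
        exp (- (c / t)) * (c / t\<^sup>2) / t ^ k - real k * exp (- (c / t)) / t ^ (k + 1)) (at t)"
    proof (cases k)
      case 0 with 3 show ?thesis
        by (auto intro!: derivative_eq_intros simp: power2_eq_square)
    next
      case (Suc j) with 3 show ?thesis
        by (auto intro!: derivative_eq_intros simp: power2_eq_square field_simps) (cases j; simp)
    qed
    then have "(flat c k has_real_derivative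
        exp (- (c / t)) * (c / t\<^sup>2) / t ^ k - real k * exp (- (c / t)) / t ^ (k + 1)) (at t)"
      by (rule has_field_derivative_transform_within_open[of _ _ _ "{0<..}"]) (use 3 in \<open>auto simp: flat_def\<close>)
    also have "exp (- (c / t)) * (c / t\<^sup>2) / t ^ k - real k * exp (- (c / t)) / t ^ (k + 1) =
        c * flat c (k + 2) t - real k * flat c (k + 1) t"
      using 3 by (simp add: flat_def power2_eq_square field_simps)
    finally show ?thesis .
  qed
qed

text \<open>An algebra of functions that is closed under partial derivatives, hence consists of smooth
functions; bump functions are products of its generators.\<close>

inductive_set flat_algebra :: "(real^3 \<Rightarrow> real) set" where
  const: "(\<lambda>x. c) \<in> flat_algebra"
| flat: "c > 0 \<Longrightarrow> (\<lambda>x. flat c k (s * x $ i + d)) \<in> flat_algebra"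
| add: "f \<in> flat_algebra \<Longrightarrow> g \<in> flat_algebra \<Longrightarrow> (\<lambda>x. f x + g x) \<in> flat_algebra"
| mult: "f \<in> flat_algebra \<Longrightarrow> g \<in> flat_algebra \<Longrightarrow> (\<lambda>x. f x * g x) \<in> flat_algebra"

lemma flat_algebra_derivative:
  assumes "f \<in> flat_algebra"
  shows "\<exists>D. (\<forall>i. D i \<in> flat_algebra) \<and> (\<forall>x. (f has_derivative (\<lambda>h. \<Sum>i\<in>UNIV. h $ i * D i x)) (at x))"
  using assms
proof induction
  case (const c)
  then show ?case by (intro exI[of _ "\<lambda>i x. 0"]) (auto intro: flat_algebra.const)
next
  case (flat c k s i d)
  define D where "D j x = (if j = i then s else 0) * (c * flat c (k + 2) (s * x $ i + d) +
      (- real k) * flat c (k + 1) (s * x $ i + d))" for j and x :: "real^3"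
  have "D j \<in> flat_algebra" for j
    unfolding D_def by (intro flat_algebra.intros flat)
  moreover have "((\<lambda>x. flat c k (s * x $ i + d)) has_derivative (\<lambda>h. \<Sum>j\<in>UNIV. h $ j * D j x)) (at x)" for x
  proof -
    have "((\<lambda>x. s * x $ i + d) has_derivative (\<lambda>h. s * h $ i)) (at x)"
      by (auto intro!: derivative_eq_intros bounded_linear.has_derivative[OF bounded_linear_nth] has_derivative_ident)
    then have "((\<lambda>x. flat c k (s * x $ i + d)) has_derivative
        (\<lambda>h. (s * h $ i) * (c * flat c (k + 2) (s * x $ i + d) - real k * flat c (k + 1) (s * x $ i + d)))) (at x)"
      by (rule DERIV_compose_FDERIV[OF flat_derivative[OF flat]])
    also have "(\<lambda>h :: real^3. (s * h $ i) * (c * flat c (k + 2) (s * x $ i + d) - real k * flat c (k + 1) (s * x $ i + d))) =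
        (\<lambda>h. \<Sum>j\<in>UNIV. h $ j * D j x)"
    proof
      fix h :: "real^3"
      have "(\<Sum>j\<in>UNIV. h $ j * D j x) = (\<Sum>j\<in>UNIV. if j = i then h $ j * D j x else 0)"
        by (rule sum.cong) (auto simp: D_def)
      also have "\<dots> = h $ i * D i x" by simp
      finally show "(s * h $ i) * (c * flat c (k + 2) (s * x $ i + d) - real k * flat c (k + 1) (s * x $ i + d)) =
          (\<Sum>j\<in>UNIV. h $ j * D j x)" by (simp add: D_def algebra_simps)
    qed
    finally show ?thesis .
  qed
  ultimately show ?case by blast
next
  case (add f g)
  from add.IH(1) obtain D where D: "\<And>i. D i \<in> flat_algebra"
    "\<And>x. (f has_derivative (\<lambda>h. \<Sum>i\<in>UNIV. h $ i * D i x)) (at x)" by blast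
  from add.IH(2) obtain E where E: "\<And>i. E i \<in> flat_algebra"
    "\<And>x. (g has_derivative (\<lambda>h. \<Sum>i\<in>UNIV. h $ i * E i x)) (at x)" by blast
  show ?case
  proof (intro exI[of _ "\<lambda>i x. D i x + E i x"] conjI allI)
    fix x show "((\<lambda>x. f x + g x) has_derivative (\<lambda>h. \<Sum>i\<in>UNIV. h $ i * (D i x + E i x))) (at x)"
      using has_derivative_add[OF D(2) E(2), of x] by (simp add: sum.distrib distrib_left)
  qed (intro flat_algebra.add D E)
next
  case (mult f g)
  from mult.IH(1) obtain D where D: "\<And>i. D i \<in> flat_algebra"
    "\<And>x. (f has_derivative (\<lambda>h. \<Sum>i\<in>UNIV. h $ i * D i x)) (at x)" by blast
  from mult.IH(2) obtain E where E: "\<And>i. E i \<in> flat_algebra"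
    "\<And>x. (g has_derivative (\<lambda>h. \<Sum>i\<in>UNIV. h $ i * E i x)) (at x)" by blast
  show ?case
  proof (intro exI[of _ "\<lambda>i x. f x * E i x + D i x * g x"] conjI allI)
    fix x show "((\<lambda>x. f x * g x) has_derivative (\<lambda>h. \<Sum>i\<in>UNIV. h $ i * (f x * E i x + D i x * g x))) (at x)"
      using has_derivative_mult[OF D(2) E(2), of x]
      by (simp add: sum.distrib distrib_left sum_distrib_left sum_distrib_right mult_ac)
  qed (intro flat_algebra.add flat_algebra.mult D E mult.hyps)
qed

text \<open>Induction on the order of differentiability, for all members of the algebra at once, as the
derivatives of a member are different members.\<close>

lemma flat_algebra_smooth:
  assumes "f \<in> flat_algebra" shows "smooth f"
proof -
  have "\<forall>f\<in>flat_algebra. Ck k f" for k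
  proof (induction k)
    case 0
    show ?case
    proof
      fix f :: "real^3 \<Rightarrow> real" assume "f \<in> flat_algebra"
      then obtain D where "\<And>x. (f has_derivative (\<lambda>h. \<Sum>i\<in>UNIV. h $ i * D i x)) (at x)"
        using flat_algebra_derivative by blast
      then show "Ck 0 f"
        by (auto intro!: continuous_at_imp_continuous_on has_derivative_continuous)
    qed
  next
    case (Suc k)
    show ?case
    proof
      fix f :: "real^3 \<Rightarrow> real" assume "f \<in> flat_algebra"
      then obtain D where D: "\<And>i. D i \<in> flat_algebra" "\<And>x. (f has_derivative (\<lambda>h. \<Sum>i\<in>UNIV. h $ i * D i x)) (at x)"
        using flat_algebra_derivative by blast
      have "partial i f = D i" for i
      proof
        fix x
        have "partial i f x = (\<Sum>j\<in>UNIV. if j = i then D j x else 0)"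
          unfolding partial_unique[OF D(2)] by (rule sum.cong) (auto simp: axis_def)
        then show "partial i f x = D i x" by simp
      qed
      moreover have "f differentiable (at x)" for x
        using D(2)[of x] unfolding differentiable_def by blast
      ultimately show "Ck (Suc k) f" using Suc D(1) by simp
    qed
  qed
  with assms show ?thesis by (simp add: smooth_def)
qed

text \<open>The support is the box between \<open>a\<close> and \<open>b\<close>. As \<open>n\<close> grows, the exponent tends to 0 at each interior
point, so that the bumps converge to the indicator of the box.\<close>

definition bump :: "nat \<Rightarrow> real^3 \<Rightarrow> real^3 \<Rightarrow> real^3 \<Rightarrow> real" where
  "bump n a b x = (\<Prod>i\<in>UNIV. flat (1 / Suc n) 0 (x $ i - a $ i) * flat (1 / Suc n) 0 (b $ i - x $ i))"

lemma bump_smooth: "smooth (bump n a b)"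
proof (rule flat_algebra_smooth)
  have l: "(\<lambda>x. flat (1 / Suc n) 0 (x $ i - a $ i)) \<in> flat_algebra" for i
    using flat_algebra.flat[of "1 / Suc n" 0 1 i "- a $ i"] by simp
  have r: "(\<lambda>x. flat (1 / Suc n) 0 (b $ i - x $ i)) \<in> flat_algebra" for i
    using flat_algebra.flat[of "1 / Suc n" 0 "-1" i "b $ i"] by simp
  show "bump n a b \<in> flat_algebra"
    unfolding bump_def UNIV_3 by (simp del: of_nat_Suc) (intro flat_algebra.mult l r)
qed

lemma bump_nonneg: "0 \<le> bump n a b x"
  unfolding bump_def by (intro prod_nonneg) (auto simp: flat_def)

lemma bump_le_1: "bump n a b x \<le> 1"
  unfolding bump_def by (intro prod_le_1) (auto simp: flat_def mult_le_one)

lemma bump_eq_0: assumes "x \<notin> box a b" shows "bump n a b x = 0"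
proof -
  obtain i where "\<not> (a $ i < x $ i \<and> x $ i < b $ i)" using assms by (auto simp: mem_box_cart)
  then have "flat (1 / Suc n) 0 (x $ i - a $ i) * flat (1 / Suc n) 0 (b $ i - x $ i) = 0"
    by (auto simp: flat_def)
  then show ?thesis unfolding bump_def by (intro prod_zero) auto
qed

lemma bump_tendsto: "(\<lambda>n. bump n a b x) \<longlonglongrightarrow> indicator (box a b) x"
proof (cases "x \<in> box a b")
  case True
  have "(\<lambda>n. flat (1 / Suc n) 0 t) \<longlonglongrightarrow> 1" if "t > 0" for t
  proof -
    have "(\<lambda>n. exp (- (1 / Suc n) * (1 / t))) \<longlonglongrightarrow> exp (- 0 * (1 / t))"
      by (intro tendsto_intros lim_1_over_n[THEN LIMSEQ_Suc])
    then show ?thesis using that by (simp add: flat_def)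
  qed
  then have "(\<lambda>n. bump n a b x) \<longlonglongrightarrow> (\<Prod>i\<in>(UNIV :: 3 set). 1 * 1)"
    unfolding bump_def using True by (intro tendsto_intros) (auto simp: mem_box_cart)
  with True show ?thesis by simp
qed (simp add: bump_eq_0)

section \<open>Functions with vanishing integrals against bump functions\<close>

text \<open>Induction over the Borel sets reaches only Borel sets; this property carries the result over to
all measurable sets. It holds for Borel measures and for Lebesgue measure.\<close>

definition borel_generated :: "'a::topological_space measure \<Rightarrow> bool" where
  "borel_generated M \<longleftrightarrow> space M = UNIV \<and> sets borel \<subseteq> sets M \<and>
     (\<forall>A\<in>sets M. \<exists>B\<in>sets borel. AE x in M. x \<in> A \<longleftrightarrow> x \<in> B)"

lemma borel_generated_of_borel: "sets M = sets borel \<Longrightarrow> borel_generated M"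
  unfolding borel_generated_def using sets_eq_imp_space_eq[of M borel] by auto

lemma borel_generated_lebesgue: "borel_generated lebesgue"
  unfolding borel_generated_def
proof (intro conjI ballI)
  fix A :: "'a set" assume "A \<in> sets lebesgue"
  then obtain S N N' where A: "A = S \<union> N" "N \<subseteq> N'" "N' \<in> null_sets lborel" "S \<in> sets lborel"
    by (rule sets_completionE)
  have "AE x in lebesgue. x \<notin> N'"
    using A(3) by (intro AE_not_in null_sets_completionI)
  then have "AE x in lebesgue. x \<in> A \<longleftrightarrow> x \<in> S"
    by (rule eventually_mono) (use A in auto)
  with A(4) show "\<exists>B\<in>sets borel. AE x in lebesgue. x \<in> A \<longleftrightarrow> x \<in> B" by auto
qed auto

lemma sigma_finite_lebesgue: "sigma_finite_measure (lebesgue :: 'a::euclidean_space measure)"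
proof -
  obtain A :: "'a set set" where A: "countable A" "A \<subseteq> sets lborel" "\<Union>A = space lborel" "\<forall>a\<in>A. emeasure lborel a \<noteq> \<infinity>"
    using lborel.sigma_finite_countable by blast
  then have "emeasure lebesgue a \<noteq> \<infinity>" if "a \<in> A" for a
    using that by (auto simp: emeasure_completion main_part_sets)
  then show ?thesis
    using A by (intro sigma_finite_measure.intro exI[of _ A]) auto
qed

text \<open>The sets over which the integral vanishes form a Dynkin system, and boxes are stable under
intersection. The whole space belongs to the system as the limit of growing boxes.\<close>

lemma AE_zero_of_box_integrals:
  fixes c :: "'a::euclidean_space \<Rightarrow> 'b::euclidean_space"
  assumes "sigma_finite_measure M" and M: "borel_generated M" and c: "integrable M c"
    and boxes: "\<And>a b. (LINT x:box a b|M. c x) = 0"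
  shows "AE x in M. c x = 0"
proof (rule sigma_finite_measure.density_zero[OF assms(1) c])
  have borel_M: "A \<in> sets M" if "A \<in> sets borel" for A using that M by (auto simp: borel_generated_def)
  have int: "set_integrable M A c" if "A \<in> sets borel" for A
    using integrable_mult_indicator[OF borel_M[OF that] c] by (simp add: set_integrable_def)
  have total: "(LINT x|M. c x) = 0"
  proof -
    define B where "B n = box (- (real n *\<^sub>R One)) (real n *\<^sub>R One :: 'a)" for n
    have "(\<lambda>n. LINT x|M. indicator (B n) x *\<^sub>R c x) \<longlonglongrightarrow> (LINT x|M. c x)"
    proof (rule integral_dominated_convergence)
      show "integrable M (\<lambda>x. norm (c x))" using c by simp
      show "(\<lambda>x. indicator (B n) x *\<^sub>R c x) \<in> borel_measurable M" for n
        using int[of "B n"] by (auto simp: B_def set_integrable_def intro!: borel_measurable_integrable)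
      show "AE x in M. (\<lambda>n. indicator (B n) x *\<^sub>R c x) \<longlonglongrightarrow> c x"
      proof (intro AE_I2 tendsto_eventually)
        fix x :: 'a
        obtain n where n: "x \<in> B n" using UN_box_eq_UNIV unfolding B_def by blast
        have "x \<in> B m" if "m \<ge> n" for m
        proof -
          have "B n \<subseteq> B m" unfolding B_def using that by (intro subset_box_imp) auto
          with n show ?thesis by blast
        qed
        then show "\<forall>\<^sub>F m in sequentially. indicator (B m) x *\<^sub>R c x = c x"
          unfolding eventually_sequentially by (intro exI[of _ n]) simp
      qed
      show "c \<in> borel_measurable M" using c by (rule borel_measurable_integrable)
      show "AE x in M. norm (indicator (B n) x *\<^sub>R c x) \<le> norm (c x)" for n
        by (auto simp: indicator_def)
    qed
    moreover have "(LINT x|M. indicator (B n) x *\<^sub>R c x) = 0" for n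
      using boxes by (simp add: B_def set_lebesgue_integral_def)
    ultimately show ?thesis by (simp add: LIMSEQ_const_iff)
  qed
  have borel_zero: "(LINT x:A|M. c x) = 0" if A: "A \<in> sets borel" for A
  proof -
    have "Int_stable (range (\<lambda>(a, b). box a b :: 'a set))"
      by (auto simp: Int_stable_def box_Int_box)
    moreover have "range (\<lambda>(a, b). box a b :: 'a set) \<subseteq> Pow UNIV" by auto
    moreover have "A \<in> sigma_sets UNIV (range (\<lambda>(a, b). box a b))"
      using A unfolding borel_eq_box by simp
    ultimately show ?thesis
    proof (induction rule: sigma_sets_induct_disjoint)
      case (basic A) then show ?case using boxes by auto
    next
      case empty show ?case by (simp add: set_lebesgue_integral_def)
    next
      case (compl A)
      then have A: "A \<in> sets borel" by (simp add: borel_eq_box)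
      have "(LINT x:UNIV - A|M. c x) = (LINT x|M. c x - indicator A x *\<^sub>R c x)"
        unfolding set_lebesgue_integral_def
        by (rule Bochner_Integration.integral_cong) (auto simp: indicator_def)
      also have "\<dots> = (LINT x|M. c x) - (LINT x:A|M. c x)"
        using c int[OF A] by (simp add: set_lebesgue_integral_def set_integrable_def)
      finally show ?case using compl total by simp
    next
      case (union F)
      then have F: "F i \<in> sets borel" for i by (auto simp: borel_eq_box)
      have "(LINT x:(\<Union>i. F i)|M. c x) = (\<Sum>i. (LINT x:F i|M. c x))"
      proof (rule lebesgue_integral_countable_add)
        show "F i \<in> sets M" for i using borel_M F by blast
        show "F i \<inter> F j = {}" if "i \<noteq> j" for i j using union(1) that by (auto simp: disjoint_family_on_def)
        show "set_integrable M (\<Union>i. F i) c" using F by (intro int) auto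
      qed
      then show ?case using union by simp
    qed
  qed
  fix A assume A: "A \<in> sets M"
  then obtain B where B: "B \<in> sets borel" "AE x in M. x \<in> A \<longleftrightarrow> x \<in> B"
    using M by (auto simp: borel_generated_def)
  have "(LINT x:A|M. c x) = (LINT x:B|M. c x)"
    unfolding set_lebesgue_integral_def
  proof (rule integral_cong_AE)
    show "(\<lambda>x. indicator A x *\<^sub>R c x) \<in> borel_measurable M"
      using A c by (auto intro!: borel_measurable_integrable)
    show "(\<lambda>x. indicator B x *\<^sub>R c x) \<in> borel_measurable M"
      using borel_M[OF B(1)] c by (auto intro!: borel_measurable_integrable)
    show "AE x in M. indicator A x *\<^sub>R c x = indicator B x *\<^sub>R c x"
      using B(2) by (rule eventually_mono) (auto simp: indicator_def)
  qed
  then show "(LINT x:A|M. c x) = 0" using borel_zero[OF B(1)] by simp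
qed

text \<open>Dominated convergence, with the function itself as majorant.\<close>

lemma box_integral_zero_of_bump_integrals:
  fixes c :: "real^3 \<Rightarrow> 'b::euclidean_space"
  assumes M: "borel_generated M" and c: "integrable M c"
    and bumps: "\<And>n. (LINT x|M. bump n a b x *\<^sub>R c x) = 0"
  shows "(LINT x:box a b|M. c x) = 0"
proof -
  have meas: "f \<in> borel_measurable M" if "continuous_on UNIV f" for f :: "real^3 \<Rightarrow> real"
  proof -
    have "f \<in> borel_measurable borel" using that by (rule borel_measurable_continuous_onI)
    then show ?thesis using M unfolding borel_generated_def measurable_def by auto
  qed
  have box_M: "box a b \<in> sets M"
    using M borel_open[OF open_box] unfolding borel_generated_def by blast
  have "(\<lambda>n. LINT x|M. bump n a b x *\<^sub>R c x) \<longlonglongrightarrow> (LINT x|M. indicator (box a b) x *\<^sub>R c x)"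
  proof (rule integral_dominated_convergence)
    show "integrable M (\<lambda>x. norm (c x))" using c by simp
    show "(\<lambda>x. indicator (box a b) x *\<^sub>R c x) \<in> borel_measurable M"
      by (rule borel_measurable_integrable[OF integrable_mult_indicator[OF box_M c]])
    show "(\<lambda>x. bump n a b x *\<^sub>R c x) \<in> borel_measurable M" for n
      using c by (intro borel_measurable_scaleR meas smooth_continuous bump_smooth borel_measurable_integrable)
    show "AE x in M. (\<lambda>n. bump n a b x *\<^sub>R c x) \<longlonglongrightarrow> indicator (box a b) x *\<^sub>R c x"
      by (intro AE_I2 tendsto_scaleR bump_tendsto tendsto_const)
    show "AE x in M. norm (bump n a b x *\<^sub>R c x) \<le> norm (c x)" for n
      using bump_nonneg bump_le_1 by (intro AE_I2) (simp add: mult_left_le_one_le)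
  qed
  then show ?thesis using bumps by (simp add: LIMSEQ_const_iff set_lebesgue_integral_def)
qed

lemma test_field_bump:
  assumes "cbox a b \<subseteq> \<Omega>"
  shows "test_field \<Omega> (\<lambda>x. bump n a b x *\<^sub>R v)"
  unfolding test_field_def
proof (intro conjI)
  show "smooth (\<lambda>x. bump n a b x *\<^sub>R v)"
    by (rule smooth_bounded_linear[OF bounded_linear_scaleR_left bump_smooth])
  have "{x. bump n a b x *\<^sub>R v \<noteq> 0} \<subseteq> cbox a b"
    using bump_eq_0 box_subset_cbox by force
  then have *: "closure {x. bump n a b x *\<^sub>R v \<noteq> 0} \<subseteq> cbox a b"
    by (intro closure_minimal closed_cbox)
  then show "compact (closure {x. bump n a b x *\<^sub>R v \<noteq> 0})"
    by (metis bounded_cbox bounded_subset closed_closure compact_eq_bounded_closed)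
  show "closure {x. bump n a b x *\<^sub>R v \<noteq> 0} \<subseteq> \<Omega>" using * assms by blast
qed

text \<open>Test fields with one nonzero component isolate the components of \<open>w\<close>. They are available only
for boxes inside the domain, so the argument is first made on each such box and then the domain is
covered by countably many of them.\<close>

lemma AE_zero_of_test_field_integrals:
  fixes w :: "real^3 \<Rightarrow> complex^3"
  assumes \<Omega>: "open \<Omega>" and w: "integrable (lebesgue_on \<Omega>) w"
    and test: "\<And>\<phi>. test_field \<Omega> \<phi> \<Longrightarrow> (LINT x|lebesgue_on \<Omega>. bdot (w x) (\<phi> x)) = 0"
  shows "AE x in lebesgue_on \<Omega>. w x = 0"
proof -
  have \<Omega>_sets: "\<Omega> \<inter> space lebesgue \<in> sets lebesgue" using \<Omega> by auto
  have comp: "AE x in lebesgue_on \<Omega>. w x $ j = 0" for j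
  proof -
    define c where "c x = indicator \<Omega> x *\<^sub>R (w x $ j)" for x
    have wj: "integrable (lebesgue_on \<Omega>) (\<lambda>x. w x $ j)"
      by (rule integrable_bounded_linear[OF bounded_linear_nth w])
    have c: "integrable lebesgue c"
      using wj integrable_restrict_space[OF \<Omega>_sets, of "\<lambda>x. w x $ j"] by (simp add: c_def[abs_def])
    have small: "(LINT x:box a b|lebesgue. c x) = 0" if ab: "cbox a b \<subseteq> \<Omega>" for a b
    proof (rule box_integral_zero_of_bump_integrals[OF borel_generated_lebesgue c])
      fix n
      have "(LINT x|lebesgue. bump n a b x *\<^sub>R c x) = (LINT x|lebesgue_on \<Omega>. bump n a b x *\<^sub>R (w x $ j))"
        unfolding integral_restrict_space[OF \<Omega>_sets]
        by (rule Bochner_Integration.integral_cong) (auto simp: c_def)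
      also have "\<dots> = (LINT x|lebesgue_on \<Omega>. bdot (w x) (bump n a b x *\<^sub>R axis j 1))"
        by (rule Bochner_Integration.integral_cong)
           (simp_all add: bdot_def axis_def mult_scaleR_right if_distrib[of "\<lambda>y. _ * y"] if_distrib[of "\<lambda>y. _ *\<^sub>R y"] cong: if_cong)
      also have "\<dots> = 0" by (rule test[OF test_field_bump[OF ab]])
      finally show "(LINT x|lebesgue. bump n a b x *\<^sub>R c x) = 0" .
    qed
    have local: "AE x in lebesgue. x \<in> box a b \<longrightarrow> c x = 0" if ab: "cbox a b \<subseteq> \<Omega>" for a b
    proof -
      have int: "integrable lebesgue (\<lambda>x. indicator (box a b) x *\<^sub>R c x)"
        by (rule integrable_mult_indicator[OF _ c]) auto
      have "AE x in lebesgue. indicator (box a b) x *\<^sub>R c x = 0"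
      proof (rule AE_zero_of_box_integrals[OF sigma_finite_lebesgue borel_generated_lebesgue int])
        fix a' b'
        obtain a'' b'' where box: "box a' b' \<inter> box a b = box a'' b''"
          using box_Int_box[of a' b' a b] by blast
        have "(LINT x:box a' b'|lebesgue. indicator (box a b) x *\<^sub>R c x) = (LINT x:box a'' b''|lebesgue. c x)"
          unfolding set_lebesgue_integral_def box[symmetric]
          by (rule Bochner_Integration.integral_cong) (auto simp: indicator_def)
        also have "\<dots> = 0"
        proof (cases "box a'' b'' = {}")
          case False
          then have "cbox a'' b'' \<subseteq> cbox a b"
            using closure_mono[of "box a'' b''" "box a b"] closure_box[of a'' b''] closure_box[of a b] box by (cases "box a b = {}") auto
          with ab show ?thesis by (intro small) blast
        qed (simp add: set_lebesgue_integral_def)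
        finally show "(LINT x:box a' b'|lebesgue. indicator (box a b) x *\<^sub>R c x) = 0" .
      qed
      then show ?thesis by (rule eventually_mono) (auto simp: indicator_def)
    qed
    obtain D where D: "countable D" "D \<subseteq> Pow \<Omega>" "\<And>X. X \<in> D \<Longrightarrow> \<exists>a b. X = cbox a b" "\<Union>D = \<Omega>"
      using open_countable_Union_open_cbox[OF \<Omega>] by metis
    have "AE x in lebesgue. x \<in> X \<longrightarrow> c x = 0" if X: "X \<in> D" for X
    proof -
      obtain a b where ab: "X = cbox a b" "cbox a b \<subseteq> \<Omega>" using D(2,3) X by blast
      have "AE x in lebesgue. x \<notin> cbox a b - box a b"
        using negligible_frontier_interval[of a b] by (intro AE_not_in) (simp add: negligible_iff_null_sets)
      with local[OF ab(2)] show ?thesis by eventually_elim (auto simp: ab(1))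
    qed
    then have "AE x in lebesgue. \<forall>X\<in>D. x \<in> X \<longrightarrow> c x = 0"
      by (subst AE_ball_countable[OF D(1)]) blast
    then have "AE x in lebesgue. x \<in> \<Omega> \<longrightarrow> w x $ j = 0"
      by (rule eventually_mono) (use D(4) in \<open>auto simp: c_def indicator_def\<close>)
    then show ?thesis by (simp add: AE_restrict_space_iff[OF \<Omega>_sets])
  qed
  then have "AE x in lebesgue_on \<Omega>. \<forall>j. w x $ j = 0"
    by (simp add: AE_all_countable)
  then show ?thesis by (rule eventually_mono) (simp add: vec_eq_iff)
qed

section \<open>Finite area of Lipschitz boundaries\<close>

text \<open>Arbitrarily fine finite covers with uniformly bounded sum of squared diameters. This is stronger
than finite Hausdorff measure, but unlike the latter it is visibly stable under finite unions.\<close>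

definition finite_area_covers :: "(real^3) set \<Rightarrow> bool" where
  "finite_area_covers A \<longleftrightarrow> (\<exists>K. \<forall>\<delta>>0. \<exists>\<C>. finite \<C> \<and> A \<subseteq> \<Union>\<C> \<and>
     (\<forall>C\<in>\<C>. bounded C \<and> diameter C \<le> \<delta>) \<and> (\<Sum>C\<in>\<C>. (diameter C)\<^sup>2) \<le> K)"

lemma finite_area_covers_subset: "finite_area_covers B \<Longrightarrow> A \<subseteq> B \<Longrightarrow> finite_area_covers A"
  unfolding finite_area_covers_def by (elim ex_forward all_forward imp_forward conj_forward) auto

lemma finite_area_covers_empty: "finite_area_covers {}"
  unfolding finite_area_covers_def by (intro exI[of _ 0] allI impI exI[of _ "{}"]) auto

lemma finite_area_covers_Un:
  assumes "finite_area_covers A" "finite_area_covers B" shows "finite_area_covers (A \<union> B)"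
proof -
  obtain K where K: "\<And>\<delta>. \<delta> > 0 \<Longrightarrow> \<exists>\<C>. finite \<C> \<and> A \<subseteq> \<Union>\<C> \<and>
     (\<forall>C\<in>\<C>. bounded C \<and> diameter C \<le> \<delta>) \<and> (\<Sum>C\<in>\<C>. (diameter C)\<^sup>2) \<le> K"
    using assms(1) unfolding finite_area_covers_def by blast
  obtain L where L: "\<And>\<delta>. \<delta> > 0 \<Longrightarrow> \<exists>\<C>. finite \<C> \<and> B \<subseteq> \<Union>\<C> \<and>
     (\<forall>C\<in>\<C>. bounded C \<and> diameter C \<le> \<delta>) \<and> (\<Sum>C\<in>\<C>. (diameter C)\<^sup>2) \<le> L"
    using assms(2) unfolding finite_area_covers_def by blast
  show ?thesis
    unfolding finite_area_covers_def
  proof (intro exI[of _ "K + L"] allI impI)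
    fix \<delta> :: real assume "\<delta> > 0"
    obtain \<C> where C: "finite \<C>" "A \<subseteq> \<Union>\<C>" "\<forall>C\<in>\<C>. bounded C \<and> diameter C \<le> \<delta>" "(\<Sum>C\<in>\<C>. (diameter C)\<^sup>2) \<le> K"
      using K[OF \<open>\<delta> > 0\<close>] by blast
    obtain \<D> where D: "finite \<D>" "B \<subseteq> \<Union>\<D>" "\<forall>C\<in>\<D>. bounded C \<and> diameter C \<le> \<delta>" "(\<Sum>C\<in>\<D>. (diameter C)\<^sup>2) \<le> L"
      using L[OF \<open>\<delta> > 0\<close>] by blast
    have "(\<Sum>C\<in>\<C> \<union> \<D>. (diameter C)\<^sup>2) \<le> (\<Sum>C\<in>\<C>. (diameter C)\<^sup>2) + (\<Sum>C\<in>\<D>. (diameter C)\<^sup>2)"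
      using sum.union_inter[OF C(1) D(1), of "\<lambda>C. (diameter C)\<^sup>2"] sum_nonneg[of "\<C> \<inter> \<D>" "\<lambda>C. (diameter C)\<^sup>2"] by simp
    with C D show "\<exists>\<C>. finite \<C> \<and> A \<union> B \<subseteq> \<Union>\<C> \<and>
        (\<forall>C\<in>\<C>. bounded C \<and> diameter C \<le> \<delta>) \<and> (\<Sum>C\<in>\<C>. (diameter C)\<^sup>2) \<le> K + L"
      by (intro exI[of _ "\<C> \<union> \<D>"]) auto
  qed
qed

lemma finite_area_covers_UN:
  "finite I \<Longrightarrow> (\<And>i. i \<in> I \<Longrightarrow> finite_area_covers (A i)) \<Longrightarrow> finite_area_covers (\<Union>i\<in>I. A i)"
  by (induction I rule: finite_induct) (auto simp: finite_area_covers_empty finite_area_covers_Un)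

text \<open>Finite covers are continued to sequences by empty sets, which have diameter 0.\<close>

lemma hausdorff2_finite:
  assumes "finite_area_covers A" shows "hausdorff2 A < \<infinity>"
proof -
  obtain K where K: "\<And>\<delta>. \<delta> > 0 \<Longrightarrow> \<exists>\<C>. finite \<C> \<and> A \<subseteq> \<Union>\<C> \<and>
     (\<forall>C\<in>\<C>. bounded C \<and> diameter C \<le> \<delta>) \<and> (\<Sum>C\<in>\<C>. (diameter C)\<^sup>2) \<le> K"
    using assms unfolding finite_area_covers_def by blast
  have "hausdorff2_pre \<delta> A \<le> ennreal (pi / 4 * K)" if \<delta>: "\<delta> > 0" for \<delta>
  proof -
    obtain \<C> where C: "finite \<C>" "A \<subseteq> \<Union>\<C>" "\<forall>C\<in>\<C>. bounded C \<and> diameter C \<le> \<delta>" "(\<Sum>C\<in>\<C>. (diameter C)\<^sup>2) \<le> K"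
      using K[OF \<delta>] by blast
    obtain f where f: "bij_betw f {0..<card \<C>} \<C>"
      using ex_bij_betw_nat_finite[OF C(1)] by blast
    define g where "g i = (if i < card \<C> then f i else {})" for i
    have g_C: "g i \<in> \<C>" if "i < card \<C>" for i
      using f that by (auto simp: g_def bij_betw_def)
    have "A \<subseteq> (\<Union>i. g i)"
    proof
      fix x assume "x \<in> A"
      then obtain C where "C \<in> \<C>" "x \<in> C" using C(2) by blast
      moreover have "C \<in> f ` {0..<card \<C>}" using f \<open>C \<in> \<C>\<close> by (simp add: bij_betw_def)
      then obtain i where "i < card \<C>" "C = f i" by auto
      ultimately show "x \<in> (\<Union>i. g i)" by (auto simp: g_def)
    qed
    moreover have "bounded (g i) \<and> diameter (g i) \<le> \<delta>" for i
      using C(3) g_C[of i] \<delta> by (cases "i < card \<C>") (auto simp: g_def)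
    ultimately have "hausdorff2_pre \<delta> A \<le> (\<Sum>i. ennreal (pi / 4 * (diameter (g i))\<^sup>2))"
      unfolding hausdorff2_pre_def by (intro INF_lower) auto
    also have "\<dots> = (\<Sum>i<card \<C>. ennreal (pi / 4 * (diameter (g i))\<^sup>2))"
      by (rule suminf_finite) (auto simp: g_def)
    also have "\<dots> = ennreal (\<Sum>i<card \<C>. pi / 4 * (diameter (g i))\<^sup>2)"
      by (rule sum_ennreal) auto
    also have "(\<Sum>i<card \<C>. pi / 4 * (diameter (g i))\<^sup>2) = (\<Sum>i\<in>{0..<card \<C>}. pi / 4 * (diameter (f i))\<^sup>2)"
      by (rule sum.cong) (auto simp: g_def)
    also have "\<dots> = (\<Sum>C\<in>\<C>. pi / 4 * (diameter C)\<^sup>2)"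
      by (rule sum.reindex_bij_betw[OF f])
    also have "ennreal \<dots> \<le> ennreal (pi / 4 * K)"
      unfolding sum_distrib_left[symmetric] by (intro ennreal_leI mult_left_mono C(4)) simp
    finally show ?thesis .
  qed
  then have "hausdorff2 A \<le> ennreal (pi / 4 * K)"
    unfolding hausdorff2_def by (intro SUP_least) auto
  then show ?thesis by (rule le_less_trans) simp
qed

text \<open>Divide the square into \<open>N * N\<close> squares of side \<open>2 * R / N\<close>. Their images have diameter at most
\<open>4 * L * R / N\<close>, so the squared diameters sum to at most \<open>(4 * L * R)\<^sup>2\<close> for every \<open>N\<close>.\<close>

lemma finite_area_covers_lipschitz_image:
  fixes h :: "real \<times> real \<Rightarrow> real^3"
  assumes L: "L-lipschitz_on UNIV h" and R: "R > 0"
  shows "finite_area_covers (h ` ({-R<..<R} \<times> {-R<..<R}))"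
proof -
  have L0: "L \<ge> 0" using L by (rule lipschitz_on_nonneg)
  show ?thesis
  unfolding finite_area_covers_def
  proof (intro exI[of _ "(4 * L * R)\<^sup>2"] allI impI)
    fix \<delta> :: real assume \<delta>: "\<delta> > 0"
    obtain N :: nat where N: "4 * L * R / \<delta> < N" using reals_Archimedean2 by blast
    have "0 \<le> 4 * L * R / \<delta>" using L0 R \<delta> by simp
    then have "0 < real N" using N by (rule le_less_trans)
    then have N0: "N > 0" by simp
    define s where "s = 2 * R / N"
    have s: "s > 0" using R N0 by (simp add: s_def)
    define I where "I i = {-R + real i * s .. -R + (real i + 1) * s}" for i
    define Q where "Q = (\<lambda>(i, j). h ` (I i \<times> I j))"
    have width: "dist p q \<le> 2 * s" if "p \<in> I i \<times> I j" "q \<in> I i \<times> I j" for p q i j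
    proof -
      have "\<bar>fst p - fst q\<bar> \<le> s" "\<bar>snd p - snd q\<bar> \<le> s"
        using that by (auto simp: I_def algebra_simps abs_le_iff)
      moreover have "dist p q \<le> dist (fst p) (fst q) + dist (snd p) (snd q)"
        unfolding dist_prod_def by (rule sqrt_sum_squares_le_sum) auto
      ultimately show ?thesis by (simp add: dist_real_def)
    qed
    have diam: "bounded (Q p) \<and> diameter (Q p) \<le> 2 * L * s" for p
    proof -
      obtain i j where p: "p = (i, j)" by (cases p)
      have close: "norm (x - y) \<le> 2 * L * s" if "x \<in> Q p" "y \<in> Q p" for x y
      proof -
        obtain a b where ab: "a \<in> I i \<times> I j" "x = h a" "b \<in> I i \<times> I j" "y = h b"
          using \<open>x \<in> Q p\<close> \<open>y \<in> Q p\<close> by (auto simp: p Q_def)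
        have "norm (x - y) \<le> L * dist a b"
          using lipschitz_onD[OF L, of a b] ab by (simp add: dist_norm)
        also have "\<dots> \<le> L * (2 * s)" by (intro mult_left_mono width[OF ab(1,3)] L0)
        finally show ?thesis by simp
      qed
      have "bounded (Q p)"
        unfolding p Q_def case_prod_conv
        by (intro compact_imp_bounded compact_continuous_image compact_Times
            continuous_on_subset[OF lipschitz_on_continuous_on[OF L]]) (auto simp: I_def)
      moreover have "diameter (Q p) \<le> 2 * L * s"
        using L0 s close by (intro diameter_le) auto
      ultimately show ?thesis by blast
    qed
    have cover: "\<exists>i<N. t \<in> I i" if t: "-R < t" "t < R" for t
    proof -
      define i where "i = nat \<lfloor>(t + R) / s\<rfloor>"
      have pos: "(t + R) / s \<ge> 0" using t s by simp
      have i: "real i \<le> (t + R) / s" "(t + R) / s < real i + 1"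
        using pos by (auto simp: i_def)
      have "(t + R) / s < N" using t s R N0 by (simp add: s_def field_simps)
      then have "i < N" using i(1) by linarith
      moreover have "t \<in> I i" using i s by (auto simp: I_def field_simps)
      ultimately show ?thesis by blast
    qed
    have "2 * L * s = 4 * L * R / N" by (simp add: s_def)
    also have "\<dots> \<le> \<delta>" using N N0 \<delta> by (simp add: field_simps)
    finally have small: "2 * L * s \<le> \<delta>" .
    show "\<exists>\<C>. finite \<C> \<and> h ` ({-R<..<R} \<times> {-R<..<R}) \<subseteq> \<Union>\<C> \<and>
        (\<forall>C\<in>\<C>. bounded C \<and> diameter C \<le> \<delta>) \<and> (\<Sum>C\<in>\<C>. (diameter C)\<^sup>2) \<le> (4 * L * R)\<^sup>2"
    proof (intro exI[of _ "Q ` ({..<N} \<times> {..<N})"] conjI)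
      show "h ` ({-R<..<R} \<times> {-R<..<R}) \<subseteq> \<Union> (Q ` ({..<N} \<times> {..<N}))"
      proof (clarify)
        fix t u assume "t \<in> {-R<..<R}" "u \<in> {-R<..<R}"
        then obtain i j where "i < N" "t \<in> I i" "j < N" "u \<in> I j" using cover by auto blast
        then show "h (t, u) \<in> \<Union> (Q ` ({..<N} \<times> {..<N}))"
          by (intro UnionI[of "Q (i, j)"]) (auto simp: Q_def)
      qed
      show "\<forall>C\<in>Q ` ({..<N} \<times> {..<N}). bounded C \<and> diameter C \<le> \<delta>"
      proof (rule ballI, erule imageE)
        fix C p assume "C = Q p"
        then show "bounded C \<and> diameter C \<le> \<delta>"
          using diam[of p] order_trans[OF conjunct2[OF diam[of p]] small] by simp
      qed
      have "(\<Sum>C\<in>Q ` ({..<N} \<times> {..<N}). (diameter C)\<^sup>2) \<le> (\<Sum>p\<in>{..<N} \<times> {..<N}. (diameter (Q p))\<^sup>2)"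
        using sum_image_le[of "{..<N} \<times> {..<N}" "\<lambda>C. (diameter C)\<^sup>2" Q] by (simp only: o_def finite_cartesian_product finite_lessThan zero_le_power2)
      also have "\<dots> \<le> (\<Sum>p\<in>{..<N} \<times> {..<N}. (2 * L * s)\<^sup>2)"
      proof (rule sum_mono)
        show "(diameter (Q p))\<^sup>2 \<le> (2 * L * s)\<^sup>2" for p
          by (rule power_mono[OF conjunct2[OF diam] diameter_ge_0[OF conjunct1[OF diam]]])
      qed
      also have "\<dots> = (4 * L * R)\<^sup>2"
        using N0 by (simp add: s_def power2_eq_square)
      finally show "(\<Sum>C\<in>Q ` ({..<N} \<times> {..<N}). (diameter C)\<^sup>2) \<le> (4 * L * R)\<^sup>2" .
    qed auto
  qed
qed

text \<open>Coordinates on the plane orthogonal to \<open>e\<close>, over which the boundary is a graph.\<close>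

lemma orthonormal_complement:
  fixes e :: "real^3" assumes "norm e = 1"
  obtains a b where "norm a = 1" "norm b = 1" "\<And>y. y - (y \<bullet> e) *\<^sub>R e = (y \<bullet> a) *\<^sub>R a + (y \<bullet> b) *\<^sub>R b"
proof -
  have e: "e \<noteq> 0" using assms by auto
  obtain B where B: "B \<subseteq> {y. e \<bullet> y = 0}" "pairwise orthogonal B" "\<And>x. x \<in> B \<Longrightarrow> norm x = 1"
      "independent B" "card B = dim {y. e \<bullet> y = 0}" "span B = {y. e \<bullet> y = 0}"
    using orthonormal_basis_subspace[OF subspace_hyperplane] by metis
  have "card B = 2" using B(5) dim_hyperplane[OF e] by simp
  then obtain a b where ab: "B = {a, b}" "a \<noteq> b" by (auto simp: card_2_iff)
  have n: "norm a = 1" "norm b = 1" using B(3) ab by auto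
  have o: "a \<bullet> b = 0" using B(2) ab by (auto simp: pairwise_def orthogonal_def)
  have "y - (y \<bullet> e) *\<^sub>R e = (y \<bullet> a) *\<^sub>R a + (y \<bullet> b) *\<^sub>R b" for y
  proof -
    define p where "p = y - (y \<bullet> e) *\<^sub>R e"
    have ee: "e \<bullet> e = 1" "a \<bullet> a = 1" "b \<bullet> b = 1" using assms n by (auto simp: norm_eq_1)
    have "e \<bullet> p = 0" using ee by (simp add: p_def inner_diff_right inner_commute)
    then have "p \<in> span {a, b}" using B(6) ab by simp
    then obtain s t where "p - s *\<^sub>R a - t *\<^sub>R b = 0"
      using span_breakdown_eq[of p a "{b}"] span_breakdown_eq[of _ b "{}"] by auto
    then have p: "p = s *\<^sub>R a + t *\<^sub>R b" by (simp add: algebra_simps)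
    have "e \<bullet> a = 0" "e \<bullet> b = 0" using B(1) ab by auto
    then have "y \<bullet> a = p \<bullet> a" "y \<bullet> b = p \<bullet> b" by (auto simp: p_def inner_diff_left)
    then have "y \<bullet> a = s" "y \<bullet> b = t"
      using o ee unfolding p by (auto simp: inner_add_left inner_commute[of b a])
    then show ?thesis unfolding p_def[symmetric] by (simp only: p)
  qed
  then show ?thesis using that n by blast
qed

text \<open>Near a boundary point the boundary lies on the graph of the Lipschitz function \<open>g\<close>: a boundary
point is not in the open domain, so it is not above the graph, and points below the graph have a
neighbourhood that avoids the domain. The graph over a bounded part of a plane is a Lipschitz image
of a square, and compactness leaves finitely many pieces.\<close>

lemma finite_area_covers_frontier:
  assumes \<Omega>: "open \<Omega>" "bounded \<Omega>" and lip: "lipschitz_boundary \<Omega>"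
  shows "finite_area_covers (frontier \<Omega>)"
proof -
  have local: "\<exists>r>0. finite_area_covers (frontier \<Omega> \<inter> ball x r)" if x: "x \<in> frontier \<Omega>" for x
  proof -
    obtain r e L g where r: "r > 0" and e: "norm e = 1" and L: "L-lipschitz_on UNIV g"
      and epi: "\<Omega> \<inter> ball x r = {y \<in> ball x r. g (y - (y \<bullet> e) *\<^sub>R e) < y \<bullet> e}"
      using lip x unfolding lipschitz_boundary_def by meson
    have L0: "L \<ge> 0" using L by (rule lipschitz_on_nonneg)
    have g: "continuous_on UNIV g" using L by (rule lipschitz_on_continuous_on)
    obtain a b where ab: "norm a = 1" "norm b = 1"
      and expand: "\<And>y. y - (y \<bullet> e) *\<^sub>R e = (y \<bullet> a) *\<^sub>R a + (y \<bullet> b) *\<^sub>R b"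
      using orthonormal_complement[OF e] by metis
    define P where "P = (\<lambda>p. fst p *\<^sub>R a + snd p *\<^sub>R b :: real^3)"
    define h where "h p = P p + g (P p) *\<^sub>R e" for p
    have P_lip: "dist (P p) (P q) \<le> 2 * dist p q" for p q
    proof -
      have "dist (P p) (P q) = norm ((fst p - fst q) *\<^sub>R a + (snd p - snd q) *\<^sub>R b)"
        by (simp add: P_def dist_norm algebra_simps)
      also have "\<dots> \<le> \<bar>fst p - fst q\<bar> + \<bar>snd p - snd q\<bar>"
        using norm_triangle_ineq[of "(fst p - fst q) *\<^sub>R a" "(snd p - snd q) *\<^sub>R b"] ab by simp
      also have "\<dots> \<le> 2 * dist p q"
        using dist_fst_le[of p q] dist_snd_le[of p q] by (simp add: dist_real_def)
      finally show ?thesis .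
    qed
    have h_lip: "(2 + 2 * L)-lipschitz_on UNIV h"
    proof (rule lipschitz_onI)
      fix p q
      have "dist (h p) (h q) \<le> dist (P p) (P q) + dist (g (P p) *\<^sub>R e) (g (P q) *\<^sub>R e)"
        unfolding h_def by (rule dist_triangle_add)
      also have "dist (g (P p) *\<^sub>R e) (g (P q) *\<^sub>R e) = dist (g (P p)) (g (P q))"
        using e by (simp add: dist_norm flip: scaleR_diff_left)
      also have "\<dots> \<le> L * dist (P p) (P q)" by (rule lipschitz_onD[OF L]) auto
      also have "\<dots> \<le> L * (2 * dist p q)" by (intro mult_left_mono P_lip L0)
      finally show "dist (h p) (h q) \<le> (2 + 2 * L) * dist p q" using P_lip[of p q] by (simp add: algebra_simps)
    qed (use L0 in simp)
    define R where "R = norm x + r"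
    have R: "R > 0" using r by (simp add: R_def add_nonneg_pos)
    have "frontier \<Omega> \<inter> ball x r \<subseteq> h ` ({-R<..<R} \<times> {-R<..<R})"
    proof
      fix y assume y: "y \<in> frontier \<Omega> \<inter> ball x r"
      have "y \<notin> \<Omega>" using y \<Omega>(1) by (simp add: frontier_def interior_open)
      then have le: "y \<bullet> e \<le> g (y - (y \<bullet> e) *\<^sub>R e)" using epi y by force
      have "\<not> y \<bullet> e < g (y - (y \<bullet> e) *\<^sub>R e)"
      proof
        assume lt: "y \<bullet> e < g (y - (y \<bullet> e) *\<^sub>R e)"
        define T where "T = ball x r \<inter> {z. z \<bullet> e < g (z - (z \<bullet> e) *\<^sub>R e)}"
        have "open {z. z \<bullet> e < g (z - (z \<bullet> e) *\<^sub>R e)}"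
          by (intro open_Collect_less continuous_intros continuous_on_compose2[OF g]) auto
        then have "open T" by (auto simp: T_def)
        moreover have "y \<in> T \<inter> closure \<Omega>" using y lt by (auto simp: T_def frontier_def)
        ultimately obtain z where "z \<in> T" "z \<in> \<Omega>" using open_Int_closure_eq_empty[of T \<Omega>] by blast
        then have "z \<in> \<Omega> \<inter> ball x r" "z \<bullet> e < g (z - (z \<bullet> e) *\<^sub>R e)" by (auto simp: T_def)
        then show False unfolding epi by auto
      qed
      with le have eq: "g (y - (y \<bullet> e) *\<^sub>R e) = y \<bullet> e" by simp
      have "y = h (y \<bullet> a, y \<bullet> b)"
        using expand[of y] eq by (simp add: h_def P_def) (metis diff_add_cancel)
      moreover have "norm y < R"
        using y norm_triangle_ineq2[of y x] by (simp add: R_def dist_norm norm_minus_commute)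
      then have "\<bar>y \<bullet> a\<bar> < R" "\<bar>y \<bullet> b\<bar> < R"
        using Cauchy_Schwarz_ineq2[of y a] Cauchy_Schwarz_ineq2[of y b] ab by auto
      ultimately show "y \<in> h ` ({-R<..<R} \<times> {-R<..<R})" by (intro image_eqI[of _ _ "(y \<bullet> a, y \<bullet> b)"]) auto
    qed
    with finite_area_covers_subset[OF finite_area_covers_lipschitz_image[OF h_lip R]] r show ?thesis by blast
  qed
  then obtain r where r: "\<And>x. x \<in> frontier \<Omega> \<Longrightarrow> r x > 0 \<and> finite_area_covers (frontier \<Omega> \<inter> ball x (r x))"
    by metis
  have "compact (frontier \<Omega>)" using \<Omega>(2) by (rule compact_frontier_bounded)
  then obtain D where D: "D \<subseteq> frontier \<Omega>" "finite D" "frontier \<Omega> \<subseteq> (\<Union>x\<in>D. ball x (r x))"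
    by (rule compactE_image[of "frontier \<Omega>" "frontier \<Omega>" "\<lambda>x. ball x (r x)"]) (use r in force)+
  have "finite_area_covers (\<Union>x\<in>D. frontier \<Omega> \<inter> ball x (r x))"
    using D r by (intro finite_area_covers_UN) auto
  then show ?thesis by (rule finite_area_covers_subset) (use D(3) in blast)
qed

section \<open>The domain, its boundary and its normal\<close>

lemma bounded_bilinear_bdot: "bounded_bilinear bdot"
  by (rule bilinear_conv_bounded_bilinear[THEN iffD1])
     (auto simp: bilinear_def bdot_def intro!: linearI simp: algebra_simps sum.distrib scaleR_sum_right)

lemma bounded_bilinear_cdot: "bounded_bilinear cdot"
  by (rule bilinear_conv_bounded_bilinear[THEN iffD1])
     (auto simp: bilinear_def cdot_def intro!: linearI simp: algebra_simps sum.distrib scaleR_sum_right)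

lemma bounded_bilinear_rmatvec: "bounded_bilinear rmatvec"
  by (rule bilinear_conv_bounded_bilinear[THEN iffD1])
     (auto simp: bilinear_def rmatvec_def vec_eq_iff intro!: linearI simp: algebra_simps sum.distrib sum_distrib_left scaleR_conv_of_real[where 'a = complex])

lemma bounded_bilinear_ccross_cvec: "bounded_bilinear (\<lambda>a n. ccross a (cvec n))"
  by (rule bilinear_conv_bounded_bilinear[THEN iffD1])
     (auto simp: bilinear_def ccross_def cvec_def vec_eq_iff forall_3 intro!: linearI simp: algebra_simps scaleR_conv_of_real[where 'a = complex])

lemma bounded_bilinear_of_real_mult: "bounded_bilinear (\<lambda>c r. c * complex_of_real r)"
  by (rule bilinear_conv_bounded_bilinear[THEN iffD1])
     (auto simp: bilinear_def intro!: linearI simp: algebra_simps scaleR_conv_of_real)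

lemma bounded_bilinear_bdot_cvec: "bounded_bilinear (\<lambda>a n. bdot a (cvec n))"
  by (rule bilinear_conv_bounded_bilinear[THEN iffD1])
     (auto simp: bilinear_def bdot_def cvec_def sum_3 intro!: linearI simp: algebra_simps scaleR_conv_of_real[where 'a = complex])

lemma bounded_bilinear_cvec_cross: "bounded_bilinear (\<lambda>a n. cvec (cross3 a n))"
  by (rule bilinear_conv_bounded_bilinear[THEN iffD1])
     (auto simp: bilinear_def cvec_def cross3_def vec_eq_iff forall_3 intro!: linearI simp: algebra_simps scaleR_conv_of_real[where 'a = complex])

locale polyhedral_domain =
  fixes \<Omega> :: "(real^3) set"
  assumes polyhedron: "lipschitz_polyhedron \<Omega>"
begin

abbreviation "D \<equiv> lebesgue_on \<Omega>"
abbreviation "\<Gamma> \<equiv> surface \<Omega>"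

lemma open_domain: "open \<Omega>" and bounded_domain: "bounded \<Omega>"
  using polyhedron by (auto simp: lipschitz_polyhedron_def)

lemma finite_volume: "finite_measure D"
  by (rule finite_measure_lebesgue_on[OF lmeasurable_open[OF bounded_domain open_domain]])

lemma space_surface: "space \<Gamma> = frontier \<Omega>"
  by (simp add: surface_def space_restrict_space space_measure_of_conv)

lemma frontier_borel: "frontier \<Omega> \<in> sets borel"
  by (intro borel_closed frontier_closed)

lemma sets_surface: "sets \<Gamma> = sets (restrict_space borel (frontier \<Omega>))"
  unfolding surface_def by (intro sets_restrict_space_cong) (simp add: sets_measure_of_conv sets.sigma_sets_eq[of borel, simplified])

lemma finite_surface: "finite_measure \<Gamma>"
proof (rule finite_measureI)
  let ?H = "measure_of UNIV (sets borel) hausdorff2"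
  have "emeasure \<Gamma> (space \<Gamma>) = emeasure ?H (frontier \<Omega>)"
    unfolding space_surface unfolding surface_def using frontier_borel
    by (intro emeasure_restrict_space) (auto simp: sets_measure_of_conv space_measure_of_conv sets.sigma_sets_eq[of borel, simplified])
  \<comment> \<open>\<^const>\<open>measure_of\<close> yields either the given set function or the zero measure\<close>
  also have "\<dots> \<le> hausdorff2 (frontier \<Omega>)"
    by (simp add: emeasure_measure_of_conv)
  also have "\<dots> < \<infinity>"
    using polyhedron by (intro hausdorff2_finite finite_area_covers_frontier) (auto simp: lipschitz_polyhedron_def)
  finally show "emeasure \<Gamma> (space \<Gamma>) \<noteq> \<infinity>" by simp
qed

lemma borel_measurable_surface: "f \<in> borel_measurable borel \<Longrightarrow> f \<in> borel_measurable \<Gamma>"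
  using measurable_restrict_space1[of f borel borel "frontier \<Omega>"] measurable_cong_sets[OF sets_surface refl] by blast

lemma L2_continuous_volume:
  assumes f: "continuous_on UNIV f" shows "f \<in> L2 D"
proof -
  have "compact (closure \<Omega>)" using bounded_domain by (simp add: compact_closure)
  then have "bounded (f ` closure \<Omega>)"
    by (intro compact_imp_bounded compact_continuous_image continuous_on_subset[OF f]) auto
  then obtain B where B: "\<And>x. x \<in> closure \<Omega> \<Longrightarrow> norm (f x) \<le> B" by (auto simp: bounded_iff)
  show ?thesis
  proof (rule L2_bounded[OF finite_volume])
    show "f \<in> borel_measurable D"
      using open_domain by (intro continuous_imp_measurable_on_sets_lebesgue continuous_on_subset[OF f]) auto
    show "norm (f x) \<le> B" if "x \<in> space D" for x
      using that closure_subset by (intro B) auto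
  qed
qed

lemma bounded_on_frontier:
  assumes f: "continuous_on UNIV f"
  obtains B where "\<And>x. x \<in> frontier \<Omega> \<Longrightarrow> norm (f x) \<le> B"
proof -
  have "compact (frontier \<Omega>)" using bounded_domain by (rule compact_frontier_bounded)
  then have "bounded (f ` frontier \<Omega>)"
    by (intro compact_imp_bounded compact_continuous_image continuous_on_subset[OF f]) auto
  then show ?thesis using that by (auto simp: bounded_iff)
qed

lemma L2_continuous_surface:
  assumes f: "continuous_on UNIV f" shows "f \<in> L2 \<Gamma>"
proof -
  obtain B where B: "\<And>x. x \<in> frontier \<Omega> \<Longrightarrow> norm (f x) \<le> B"
    using bounded_on_frontier[OF f] by blast
  show ?thesis
    by (rule L2_bounded[OF finite_surface borel_measurable_surface[OF borel_measurable_continuous_onI[OF f]]])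
       (use B space_surface in auto)
qed

text \<open>A small step from \<open>x\<close> in the direction \<open>\<nu>' - \<nu>\<close> enters the half space belonging to \<open>\<nu>\<close> and leaves the
one belonging to \<open>\<nu>'\<close>, yet both describe the domain near \<open>x\<close>.\<close>

lemma outward_normal_unique:
  assumes "is_outward_normal \<Omega> x \<nu>" "is_outward_normal \<Omega> x \<nu>'" shows "\<nu> = \<nu>'"
proof (rule ccontr)
  assume ne: "\<nu> \<noteq> \<nu>'"
  obtain r where r: "norm \<nu> = 1" "r > 0" "\<Omega> \<inter> ball x r = {y \<in> ball x r. (y - x) \<bullet> \<nu> < 0}"
    using assms(1) unfolding is_outward_normal_def by blast
  obtain r' where r': "norm \<nu>' = 1" "r' > 0" "\<Omega> \<inter> ball x r' = {y \<in> ball x r'. (y - x) \<bullet> \<nu>' < 0}"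
    using assms(2) unfolding is_outward_normal_def by blast
  define t where "t = min r r' / 4"
  have t: "t > 0" using r r' by (simp add: t_def)
  define y where "y = x + t *\<^sub>R (\<nu>' - \<nu>)"
  have "norm (\<nu>' - \<nu>) \<le> 2" using norm_triangle_ineq4[of \<nu>' \<nu>] r r' by simp
  then have "dist x y \<le> t * 2" using t by (simp add: y_def dist_norm)
  also have "\<dots> < min r r'" using r(2) r'(2) unfolding t_def by (simp add: min_def)
  finally have y: "y \<in> ball x r" "y \<in> ball x r'" by auto
  have sq: "\<nu> \<bullet> \<nu> = 1" "\<nu>' \<bullet> \<nu>' = 1" using r r' by (auto simp: norm_eq_1)
  have "0 < (\<nu>' - \<nu>) \<bullet> (\<nu>' - \<nu>)" using ne by simp
  then have lt: "\<nu> \<bullet> \<nu>' < 1" using sq by (simp add: inner_diff_left inner_diff_right inner_commute)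
  have "(y - x) \<bullet> \<nu> = t * (\<nu> \<bullet> \<nu>' - 1)" "(y - x) \<bullet> \<nu>' = t * (1 - \<nu> \<bullet> \<nu>')"
    using sq by (auto simp: y_def inner_diff_left inner_diff_right inner_commute)
  then have "(y - x) \<bullet> \<nu> < 0" "\<not> (y - x) \<bullet> \<nu>' < 0" using lt t by (auto simp: mult_less_0_iff not_less)
  moreover have "y \<in> \<Omega> \<longleftrightarrow> (y - x) \<bullet> \<nu> < 0" using r(3) y by blast
  moreover have "y \<in> \<Omega> \<longleftrightarrow> (y - x) \<bullet> \<nu>' < 0" using r'(3) y by blast
  ultimately show False by simp
qed

lemma normal_eq: "x \<in> frontier \<Omega> \<Longrightarrow> is_outward_normal \<Omega> x \<nu> \<Longrightarrow> normal \<Omega> x = \<nu>"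
  unfolding normal_def using outward_normal_unique by (auto intro!: the_equality)

lemma norm_normal_le: "norm (normal \<Omega> x) \<le> 1"
proof (cases "x \<in> frontier \<Omega> \<and> (\<exists>\<nu>. is_outward_normal \<Omega> x \<nu>)")
  case True
  then obtain \<nu> where "x \<in> frontier \<Omega>" and \<nu>: "is_outward_normal \<Omega> x \<nu>" by blast
  then have "normal \<Omega> x = \<nu>" by (rule normal_eq)
  with \<nu> show ?thesis by (simp add: is_outward_normal_def)
next
  case False then show ?thesis by (simp only: normal_def if_False) simp
qed

text \<open>Boundary points near \<open>x\<close> lie on the plane through \<open>x\<close> orthogonal to \<open>\<nu>\<close>, so there the half space
is the same.\<close>

lemma normal_locally_constant:
  assumes x: "x \<in> frontier \<Omega>" and \<nu>: "is_outward_normal \<Omega> x \<nu>"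
  shows "\<exists>r>0. \<forall>y\<in>frontier \<Omega> \<inter> ball x r. is_outward_normal \<Omega> y \<nu>"
proof -
  obtain r where r: "norm \<nu> = 1" "r > 0" "\<Omega> \<inter> ball x r = {y \<in> ball x r. (y - x) \<bullet> \<nu> < 0}"
    using \<nu> unfolding is_outward_normal_def by blast
  have "is_outward_normal \<Omega> y \<nu>" if y: "y \<in> frontier \<Omega> \<inter> ball x r" for y
  proof -
    have "y \<notin> \<Omega>" using y open_domain by (simp add: frontier_def interior_open)
    then have ge: "(y - x) \<bullet> \<nu> \<ge> 0" using r(3) y by force
    have "\<not> (y - x) \<bullet> \<nu> > 0"
    proof
      assume gt: "(y - x) \<bullet> \<nu> > 0"
      define T where "T = ball x r \<inter> {z. 0 < (z - x) \<bullet> \<nu>}"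
      have "open {z. 0 < (z - x) \<bullet> \<nu>}" by (intro open_Collect_less continuous_intros)
      then have "open T" by (auto simp: T_def)
      moreover have "y \<in> T \<inter> closure \<Omega>" using y gt by (auto simp: T_def frontier_def)
      ultimately obtain z where z: "z \<in> T" "z \<in> \<Omega>" using open_Int_closure_eq_empty[of T \<Omega>] by blast
      then have "z \<in> \<Omega> \<inter> ball x r" by (simp add: T_def)
      then have "(z - x) \<bullet> \<nu> < 0" unfolding r(3) by simp
      with z show False by (simp add: T_def)
    qed
    with ge have eq: "(y - x) \<bullet> \<nu> = 0" by simp
    define s where "s = r - dist x y"
    have s: "s > 0" using y by (simp add: s_def)
    have sub: "w \<in> ball x r" if "w \<in> ball y s" for w
      using that dist_triangle[of x w y] by (simp add: s_def)
    have shift: "(w - y) \<bullet> \<nu> = (w - x) \<bullet> \<nu>" for w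
      using eq by (simp add: inner_diff_left)
    have mem: "w \<in> \<Omega> \<longleftrightarrow> (w - x) \<bullet> \<nu> < 0" if "w \<in> ball y s" for w
      using r(3) sub[OF that] by blast
    have "\<Omega> \<inter> ball y s = {w \<in> ball y s. (w - y) \<bullet> \<nu> < 0}"
      unfolding shift using mem by blast
    then show ?thesis unfolding is_outward_normal_def using r(1) s by blast
  qed
  with r(2) show ?thesis by blast
qed

text \<open>The normal is continuous on the relatively open set where it exists, being locally constant
there, and zero elsewhere.\<close>

lemma normal_borel: "normal \<Omega> \<in> borel_measurable borel"
proof -
  define G where "G = {x \<in> frontier \<Omega>. \<exists>\<nu>. is_outward_normal \<Omega> x \<nu>}"
  obtain r where r: "\<And>x. x \<in> G \<Longrightarrow> r x > 0"
    "\<And>x y. x \<in> G \<Longrightarrow> y \<in> frontier \<Omega> \<inter> ball x (r x) \<Longrightarrow> is_outward_normal \<Omega> y (normal \<Omega> x)"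
  proof -
    have "\<forall>x\<in>G. \<exists>r>0. \<forall>y\<in>frontier \<Omega> \<inter> ball x r. is_outward_normal \<Omega> y (normal \<Omega> x)"
      using normal_locally_constant normal_eq unfolding G_def by fastforce
    from bchoice[OF this] that show ?thesis by blast
  qed
  define W where "W = (\<Union>x\<in>G. ball x (r x))"
  have G_eq: "G = frontier \<Omega> \<inter> W"
  proof (intro equalityI subsetI)
    show "x \<in> frontier \<Omega> \<inter> W" if x: "x \<in> G" for x
      using x r(1)[OF x] unfolding W_def by (auto simp: G_def intro!: bexI[of _ x])
    show "x \<in> G" if "x \<in> frontier \<Omega> \<inter> W" for x
      using that r(2) unfolding W_def by (auto simp: G_def)
  qed
  have "open W" unfolding W_def by blast
  then have G_borel: "G \<in> sets borel" unfolding G_eq using frontier_borel by auto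
  have "continuous_on G (normal \<Omega>)"
    unfolding continuous_on_eq_continuous_within
  proof
    fix x assume x: "x \<in> G"
    have same: "normal \<Omega> y = normal \<Omega> x" if "y \<in> G" "y \<in> ball x (r x)" for y
      using normal_eq r(2)[OF x, of y] that G_eq by blast
    have "continuous (at x within G) (\<lambda>_. normal \<Omega> x)" by simp
    then show "continuous (at x within G) (normal \<Omega>)"
      by (rule continuous_transform_within[OF _ r(1)[OF x] x]) (use same in \<open>auto simp: dist_commute\<close>)
  qed
  then have "(\<lambda>x. if x \<in> G then normal \<Omega> x else 0) \<in> borel_measurable borel"
    by (rule borel_measurable_continuous_on_if[OF G_borel _ continuous_on_const])
  moreover have "(\<lambda>x. if x \<in> G then normal \<Omega> x else 0) = normal \<Omega>"
    by (auto simp: G_def normal_def)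
  ultimately show ?thesis by simp
qed

lemma normal_measurable: "normal \<Omega> \<in> borel_measurable \<Gamma>"
  by (rule borel_measurable_surface[OF normal_borel])

lemma normal_multiplier_L2:
  fixes B :: "'b::euclidean_space \<Rightarrow> real^3 \<Rightarrow> 'c::euclidean_space"
  assumes "bounded_bilinear B"
  shows "\<exists>K\<ge>0. \<forall>v\<in>L2 \<Gamma>. (\<lambda>x. B (v x) (normal \<Omega> x)) \<in> L2 \<Gamma> \<and> l2norm \<Gamma> (\<lambda>x. B (v x) (normal \<Omega> x)) \<le> K * l2norm \<Gamma> v"
  by (rule L2_bounded_multiplier[OF bounded_bilinear.flip[OF assms] normal_measurable AE_I2[OF norm_normal_le]])

lemma cross_normal_L2:
  "\<exists>K\<ge>0. \<forall>v\<in>L2 \<Gamma>. cross_normal \<Omega> v \<in> L2 \<Gamma> \<and> l2norm \<Gamma> (cross_normal \<Omega> v) \<le> K * l2norm \<Gamma> v"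
  using normal_multiplier_L2[OF bounded_bilinear_ccross_cvec] unfolding cross_normal_def[abs_def] .

lemma cross_normal_add: "cross_normal \<Omega> (v + w) = cross_normal \<Omega> v + cross_normal \<Omega> w"
  by (simp add: fun_eq_iff cross_normal_def bounded_bilinear.add_left[OF bounded_bilinear_ccross_cvec])

lemma cross_normal_scaleR: "cross_normal \<Omega> (c *\<^sub>R v) = c *\<^sub>R cross_normal \<Omega> v"
  by (simp add: fun_eq_iff cross_normal_def bounded_bilinear.scaleR_left[OF bounded_bilinear_ccross_cvec])

end

section \<open>The space H(curl)\<close>

context polyhedral_domain
begin

lemma test_field_L2:
  assumes "test_field \<Omega> \<phi>" shows "\<phi> \<in> L2 D" "classical_curl \<phi> \<in> L2 D"
  using assms by (auto simp: test_field_def intro!: L2_continuous_volume smooth_continuous classical_curl_continuous)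

text \<open>The chosen weak curl can therefore be replaced by any other one almost everywhere; all algebra of
curls below rests on this.\<close>

lemma weak_curl_unique:
  assumes w: "w \<in> L2 D" "w' \<in> L2 D" and "is_weak_curl \<Omega> u w" "is_weak_curl \<Omega> u w'"
  shows "AE x in D. w x = w' x"
proof -
  have "AE x in D. (w - w') x = 0"
  proof (rule AE_zero_of_test_field_integrals[OF open_domain])
    show "integrable D (w - w')" by (rule L2_integrable[OF finite_volume L2_diff[OF w]])
    fix \<phi> assume \<phi>: "test_field \<Omega> \<phi>"
    have "(LINT x|D. bdot ((w - w') x) (\<phi> x)) = (LINT x|D. bdot (w x) (\<phi> x)) - (LINT x|D. bdot (w' x) (\<phi> x))"
      using L2_bilinear_integrable[OF bounded_bilinear_bdot w(1) test_field_L2(1)[OF \<phi>]]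
        L2_bilinear_integrable[OF bounded_bilinear_bdot w(2) test_field_L2(1)[OF \<phi>]]
      by (simp add: bounded_bilinear.diff_left[OF bounded_bilinear_bdot])
    also have "\<dots> = 0" using assms(3,4) \<phi> by (simp add: is_weak_curl_def)
    finally show "(LINT x|D. bdot ((w - w') x) (\<phi> x)) = 0" .
  qed
  then show ?thesis by simp
qed

lemma curl_of_Hcurl:
  assumes "u \<in> Hcurl \<Omega>" shows "curl \<Omega> u \<in> L2 D" "is_weak_curl \<Omega> u (curl \<Omega> u)"
  using assms someI_ex[of "\<lambda>w. w \<in> L2 D \<and> is_weak_curl \<Omega> u w"] unfolding curl_def Hcurl_def by auto

lemma Hcurl_L2: "u \<in> Hcurl \<Omega> \<Longrightarrow> u \<in> L2 D"
  by (simp add: Hcurl_def)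

lemma Hcurl_weak_curl:
  assumes "u \<in> L2 D" "w \<in> L2 D" "is_weak_curl \<Omega> u w"
  shows "u \<in> Hcurl \<Omega>" "AE x in D. curl \<Omega> u x = w x"
proof -
  show u: "u \<in> Hcurl \<Omega>" using assms unfolding Hcurl_def by blast
  show "AE x in D. curl \<Omega> u x = w x"
    by (rule weak_curl_unique[OF curl_of_Hcurl(1)[OF u] assms(2) curl_of_Hcurl(2)[OF u] assms(3)])
qed

lemma weak_curl_add:
  assumes "u \<in> L2 D" "u' \<in> L2 D" "w \<in> L2 D" "w' \<in> L2 D" "is_weak_curl \<Omega> u w" "is_weak_curl \<Omega> u' w'"
  shows "is_weak_curl \<Omega> (u + u') (w + w')"
  using assms by (simp add: is_weak_curl_def L2_bilinear_add[OF bounded_bilinear_bdot] test_field_L2 del: plus_fun_apply)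

lemma weak_curl_scaleR:
  assumes "is_weak_curl \<Omega> u w" shows "is_weak_curl \<Omega> (c *\<^sub>R u) (c *\<^sub>R w)"
  using assms by (simp add: is_weak_curl_def L2_bilinear_scaleR[OF bounded_bilinear_bdot] del: scaleR_fun_apply)

text \<open>For a fixed test field both sides of the defining identity are continuous in \<open>L\<^sup>2\<close>.\<close>

lemma weak_curl_limit:
  assumes "\<And>n. u n \<in> L2 D" "u0 \<in> L2 D" "\<And>n. w n \<in> L2 D" "w0 \<in> L2 D"
    and "(\<lambda>n. l2norm D (u n - u0)) \<longlonglongrightarrow> 0" "(\<lambda>n. l2norm D (w n - w0)) \<longlonglongrightarrow> 0"
    and "\<And>n. is_weak_curl \<Omega> (u n) (w n)"
  shows "is_weak_curl \<Omega> u0 w0"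
  unfolding is_weak_curl_def
proof (intro allI impI)
  fix \<phi> assume \<phi>: "test_field \<Omega> \<phi>"
  have "(\<lambda>n. LINT x|D. bdot (w n x) (\<phi> x)) \<longlonglongrightarrow> (LINT x|D. bdot (w0 x) (\<phi> x))"
    by (rule L2_bilinear_tendsto[OF bounded_bilinear_bdot assms(3,4) test_field_L2(1)[OF \<phi>] assms(6)])
  moreover have "(\<lambda>n. LINT x|D. bdot (u n x) (classical_curl \<phi> x)) \<longlonglongrightarrow> (LINT x|D. bdot (u0 x) (classical_curl \<phi> x))"
    by (rule L2_bilinear_tendsto[OF bounded_bilinear_bdot assms(1,2) test_field_L2(2)[OF \<phi>] assms(5)])
  moreover have "(\<lambda>n. LINT x|D. bdot (w n x) (\<phi> x)) = (\<lambda>n. LINT x|D. bdot (u n x) (classical_curl \<phi> x))"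
    using assms(7) \<phi> by (simp add: is_weak_curl_def)
  ultimately show "(LINT x|D. bdot (w0 x) (\<phi> x)) = (LINT x|D. bdot (u0 x) (classical_curl \<phi> x))"
    using LIMSEQ_unique by simp
qed

lemma Hcurl_add:
  assumes "u \<in> Hcurl \<Omega>" "u' \<in> Hcurl \<Omega>"
  shows "u + u' \<in> Hcurl \<Omega>" "AE x in D. curl \<Omega> (u + u') x = (curl \<Omega> u + curl \<Omega> u') x"
  by (rule Hcurl_weak_curl[OF L2_add[OF assms[THEN Hcurl_L2]] L2_add[OF assms[THEN curl_of_Hcurl(1)]]
        weak_curl_add[OF assms[THEN Hcurl_L2] assms[THEN curl_of_Hcurl(1)] assms[THEN curl_of_Hcurl(2)]]])+

lemma Hcurl_scaleR:
  assumes "u \<in> Hcurl \<Omega>"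
  shows "c *\<^sub>R u \<in> Hcurl \<Omega>" "AE x in D. curl \<Omega> (c *\<^sub>R u) x = (c *\<^sub>R curl \<Omega> u) x"
  by (rule Hcurl_weak_curl[OF L2_scaleR[OF Hcurl_L2[OF assms]] L2_scaleR[OF curl_of_Hcurl(1)[OF assms]]
        weak_curl_scaleR[OF curl_of_Hcurl(2)[OF assms]]])+

lemma Hcurl_add_scaled:
  assumes u: "u \<in> Hcurl \<Omega>" "u' \<in> Hcurl \<Omega>"
  shows "u + c *\<^sub>R u' \<in> Hcurl \<Omega>" "AE x in D. curl \<Omega> (u + c *\<^sub>R u') x = (curl \<Omega> u + c *\<^sub>R curl \<Omega> u') x"
proof -
  note s = Hcurl_scaleR[OF u(2), of c]
  show "u + c *\<^sub>R u' \<in> Hcurl \<Omega>" by (rule Hcurl_add(1)[OF u(1) s(1)])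
  show "AE x in D. curl \<Omega> (u + c *\<^sub>R u') x = (curl \<Omega> u + c *\<^sub>R curl \<Omega> u') x"
    using Hcurl_add(2)[OF u(1) s(1)] s(2) by eventually_elim simp
qed

end

section \<open>The tangential trace\<close>

context polyhedral_domain
begin

text \<open>The unit ball of \<open>H\<^sup>1\<^sup>/\<^sup>2(\<Gamma>)\<^sup>3\<close>, over which the dual norm is a supremum.\<close>

definition trace_test :: "(real^3 \<Rightarrow> complex^3) set" where
  "trace_test = {\<phi> \<in> borel_measurable \<Gamma>. Hhalf_sq \<Omega> \<phi> \<le> 1}"

text \<open>The Sobolev-Slobodeckij norm dominates the \<open>L\<^sup>2\<close> norm. This makes trace functionals of square
integrable fields additive on the unit ball and bounds their dual norm.\<close>

lemma trace_test_L2: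
  assumes "\<phi> \<in> trace_test" shows "\<phi> \<in> L2 \<Gamma>" "l2norm \<Gamma> \<phi> \<le> 1"
proof -
  have "L2_sq \<Gamma> \<phi> \<le> Hhalf_sq \<Omega> \<phi>" by (simp add: Hhalf_sq_def)
  also have "\<dots> \<le> 1" using assms by (simp add: trace_test_def)
  finally have le: "L2_sq \<Gamma> \<phi> \<le> 1" .
  then have "L2_sq \<Gamma> \<phi> < \<infinity>" by (rule le_less_trans) simp
  then show \<phi>: "\<phi> \<in> L2 \<Gamma>" using assms by (simp add: L2_def trace_test_def)
  have "(l2norm \<Gamma> \<phi>)\<^sup>2 \<le> 1" using le unfolding L2_sq_eq[OF \<phi>] by simp
  then show "l2norm \<Gamma> \<phi> \<le> 1" by (simp add: power_le_one_iff abs_square_le_1)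
qed

lemma dual_norm_alt: "dual_norm \<Omega> \<Lambda> = (SUP \<phi>\<in>trace_test. ennreal (cmod (\<Lambda> \<phi>)))"
  by (simp add: dual_norm_def trace_test_def)

lemma dual_norm_le_add:
  assumes "\<And>\<phi>. \<phi> \<in> trace_test \<Longrightarrow> \<Lambda> \<phi> = \<Lambda>1 \<phi> + \<Lambda>2 \<phi>"
  shows "dual_norm \<Omega> \<Lambda> \<le> dual_norm \<Omega> \<Lambda>1 + dual_norm \<Omega> \<Lambda>2"
  unfolding dual_norm_alt
proof (rule SUP_least)
  fix \<phi> assume \<phi>: "\<phi> \<in> trace_test"
  have "ennreal (cmod (\<Lambda> \<phi>)) \<le> ennreal (cmod (\<Lambda>1 \<phi>)) + ennreal (cmod (\<Lambda>2 \<phi>))"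
    unfolding assms[OF \<phi>] by (simp add: norm_triangle_ineq flip: ennreal_plus)
  also have "\<dots> \<le> (SUP \<phi>\<in>trace_test. ennreal (cmod (\<Lambda>1 \<phi>))) + (SUP \<phi>\<in>trace_test. ennreal (cmod (\<Lambda>2 \<phi>)))"
    by (intro add_mono SUP_upper \<phi>)
  finally show "ennreal (cmod (\<Lambda> \<phi>)) \<le> \<dots>" .
qed

lemma dual_norm_scaleR_le: "dual_norm \<Omega> (\<lambda>\<phi>. c *\<^sub>R \<Lambda> \<phi>) \<le> ennreal \<bar>c\<bar> * dual_norm \<Omega> \<Lambda>"
  unfolding dual_norm_alt
proof (rule SUP_least)
  fix \<phi> assume \<phi>: "\<phi> \<in> trace_test"
  have "ennreal (cmod (c *\<^sub>R \<Lambda> \<phi>)) = ennreal \<bar>c\<bar> * ennreal (cmod (\<Lambda> \<phi>))"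
    by (simp add: ennreal_mult)
  also have "\<dots> \<le> ennreal \<bar>c\<bar> * (SUP \<phi>\<in>trace_test. ennreal (cmod (\<Lambda> \<phi>)))"
    by (intro mult_left_mono SUP_upper \<phi>) simp
  finally show "ennreal (cmod (c *\<^sub>R \<Lambda> \<phi>)) \<le> \<dots>" .
qed

lemma surface_functional_add:
  assumes "g \<in> L2 \<Gamma>" "g' \<in> L2 \<Gamma>" "\<phi> \<in> trace_test"
  shows "surface_functional \<Omega> (g + g') \<phi> = surface_functional \<Omega> g \<phi> + surface_functional \<Omega> g' \<phi>"
  unfolding surface_functional_def
  by (rule L2_bilinear_add[OF bounded_bilinear_bdot assms(1,2) trace_test_L2(1)[OF assms(3)]])

lemma surface_functional_scaleR:
  "surface_functional \<Omega> (c *\<^sub>R g) \<phi> = c *\<^sub>R surface_functional \<Omega> g \<phi>"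
  unfolding surface_functional_def by (rule L2_bilinear_scaleR[OF bounded_bilinear_bdot])

abbreviation "normal_trace z \<equiv> surface_functional \<Omega> (cross_normal \<Omega> z)"

lemma surface_functional_bound:
  obtains K where "\<And>z. z \<in> L2 \<Gamma> \<Longrightarrow> dual_norm \<Omega> (normal_trace z) \<le> ennreal (K * l2norm \<Gamma> z)"
proof -
  obtain C where C0: "C \<ge> 0" and C_all: "\<forall>v\<in>L2 \<Gamma>. cross_normal \<Omega> v \<in> L2 \<Gamma> \<and> l2norm \<Gamma> (cross_normal \<Omega> v) \<le> C * l2norm \<Gamma> v"
    using cross_normal_L2 by blast
  note C = C0 bspec[OF C_all, THEN conjunct1] bspec[OF C_all, THEN conjunct2]
  obtain K where K: "K \<ge> 0" "\<And>(M :: (real^3) measure) f g. f \<in> L2 M \<Longrightarrow> g \<in> L2 M \<Longrightarrow>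
       norm (LINT x|M. bdot (f x) (g x)) \<le> K * (l2norm M f * l2norm M g)"
    using L2_bilinear_bound[OF bounded_bilinear_bdot] by metis
  have "dual_norm \<Omega> (normal_trace z) \<le> ennreal (K * C * l2norm \<Gamma> z)" if z: "z \<in> L2 \<Gamma>" for z
    unfolding dual_norm_alt
  proof (rule SUP_least, rule ennreal_leI)
    fix \<phi> assume \<phi>: "\<phi> \<in> trace_test"
    have "cmod (normal_trace z \<phi>) \<le> K * (l2norm \<Gamma> (cross_normal \<Omega> z) * l2norm \<Gamma> \<phi>)"
      unfolding surface_functional_def by (rule K(2)[OF C(2)[OF z] trace_test_L2(1)[OF \<phi>]])
    also have "\<dots> \<le> K * ((C * l2norm \<Gamma> z) * 1)"
      by (intro mult_left_mono mult_mono C(3)[OF z] trace_test_L2(2)[OF \<phi>] K(1) mult_nonneg_nonneg C(1) l2norm_nonneg)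
    finally show "cmod (normal_trace z \<phi>) \<le> K * C * l2norm \<Gamma> z" by simp
  qed
  then show ?thesis by (rule that)
qed

lemma cross_normal_in_L2: "z \<in> L2 \<Gamma> \<Longrightarrow> cross_normal \<Omega> z \<in> L2 \<Gamma>"
  using cross_normal_L2 by blast

lemma classical_curl_scaleR:
  assumes "smooth f" shows "classical_curl (c *\<^sub>R f) = c *\<^sub>R classical_curl f"
proof -
  have "partial i (c *\<^sub>R f) x = c *\<^sub>R partial i f x" for i x
    using partial_bounded_linear[OF bounded_linear_scaleR_right smooth_differentiable[OF assms]]
    by (simp add: scaleR_fun_def)
  then show ?thesis
    by (auto simp: fun_eq_iff classical_curl_def vec_eq_iff forall_3 scaleR_diff_right)
qed

lemma smooth_scaleR: "smooth f \<Longrightarrow> smooth (c *\<^sub>R f)"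
  unfolding scaleR_fun_def by (rule smooth_bounded_linear[OF bounded_linear_scaleR_right])

lemma smooth_L2:
  assumes "smooth U" shows "U \<in> L2 D" "classical_curl U \<in> L2 D" "U \<in> L2 \<Gamma>"
  using assms by (auto intro!: L2_continuous_volume L2_continuous_surface smooth_continuous classical_curl_continuous)

text \<open>The distance of a smooth field \<open>U\<close> with its trace to a field \<open>u\<close> with curl \<open>w\<close> and prospective trace
\<open>\<Lambda>\<close>. The curl is an argument of its own because it is determined only almost everywhere.\<close>

definition trace_error ::
    "(real^3 \<Rightarrow> complex^3) \<Rightarrow> (real^3 \<Rightarrow> complex^3) \<Rightarrow> (real^3 \<Rightarrow> complex^3) \<Rightarrow> ((real^3 \<Rightarrow> complex^3) \<Rightarrow> complex) \<Rightarrow> ennreal" where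
  "trace_error U u w \<Lambda> = ennreal (l2norm D (U - u)) + ennreal (l2norm D (classical_curl U - w)) +
     dual_norm \<Omega> (\<lambda>\<phi>. normal_trace U \<phi> - \<Lambda> \<phi>)"

text \<open>In this form the tangential trace is a closure, so linearity and closedness reduce to triangle
inequalities for \<open>trace_error\<close>.\<close>

lemma has_tangential_trace_iff:
  "has_tangential_trace \<Omega> u \<Lambda> \<longleftrightarrow> u \<in> Hcurl \<Omega> \<and>
     (\<forall>\<epsilon>>0. \<exists>U. smooth U \<and> trace_error U u (curl \<Omega> u) \<Lambda> < ennreal \<epsilon>)"
proof (cases "u \<in> Hcurl \<Omega>")
  case u: True
  have sq: "(\<lambda>k. L2_sq D (\<lambda>x. f k x - g x)) \<longlonglongrightarrow> 0 \<longleftrightarrow> (\<lambda>k. ennreal (l2norm D (f k - g))) \<longlonglongrightarrow> 0"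
    if "\<And>k. f k \<in> L2 D" "g \<in> L2 D" for f :: "nat \<Rightarrow> real^3 \<Rightarrow> complex^3" and g
  proof -
    have "(\<lambda>k. L2_sq D (\<lambda>x. f k x - g x)) \<longlonglongrightarrow> 0 \<longleftrightarrow> (\<lambda>k. l2norm D (f k - g)) \<longlonglongrightarrow> 0"
      using L2_sq_tendsto_iff[of "\<lambda>k. f k - g" D] L2_diff[OF that] by (simp add: fun_diff_def)
    also have "\<dots> \<longleftrightarrow> (\<lambda>k. ennreal (l2norm D (f k - g))) \<longlonglongrightarrow> ennreal 0"
      by (rule tendsto_ennreal_iff[symmetric]) auto
    finally show ?thesis by simp
  qed
  show ?thesis
  proof
    assume "has_tangential_trace \<Omega> u \<Lambda>"
    then obtain U where U: "\<And>k. smooth (U k)"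
      and "(\<lambda>k. L2_sq D (\<lambda>x. U k x - u x)) \<longlonglongrightarrow> 0"
      and "(\<lambda>k. L2_sq D (\<lambda>x. classical_curl (U k) x - curl \<Omega> u x)) \<longlonglongrightarrow> 0"
      and dual: "(\<lambda>k. dual_norm \<Omega> (\<lambda>\<phi>. normal_trace (U k) \<phi> - \<Lambda> \<phi>)) \<longlonglongrightarrow> 0"
      unfolding has_tangential_trace_def by blast
    then have "(\<lambda>k. ennreal (l2norm D (U k - u))) \<longlonglongrightarrow> 0" "(\<lambda>k. ennreal (l2norm D (classical_curl (U k) - curl \<Omega> u))) \<longlonglongrightarrow> 0"
      using sq[of U, OF smooth_L2(1)[OF U] Hcurl_L2[OF u]] sq[of "\<lambda>k. classical_curl (U k)", OF smooth_L2(2)[OF U] curl_of_Hcurl(1)[OF u]]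
      by blast+
    from tendsto_add[OF tendsto_add[OF this] dual]
    have lim: "(\<lambda>k. trace_error (U k) u (curl \<Omega> u) \<Lambda>) \<longlonglongrightarrow> 0" by (simp add: trace_error_def)
    have "\<exists>U. smooth U \<and> trace_error U u (curl \<Omega> u) \<Lambda> < ennreal \<epsilon>" if "\<epsilon> > 0" for \<epsilon>
    proof -
      have "0 < ennreal \<epsilon>" using that by simp
      from order_tendstoD(2)[OF lim this] U show ?thesis using eventually_happens'[OF sequentially_bot] by blast
    qed
    with u show "u \<in> Hcurl \<Omega> \<and> (\<forall>\<epsilon>>0. \<exists>U. smooth U \<and> trace_error U u (curl \<Omega> u) \<Lambda> < ennreal \<epsilon>)" by blast
  next
    assume "u \<in> Hcurl \<Omega> \<and> (\<forall>\<epsilon>>0. \<exists>U. smooth U \<and> trace_error U u (curl \<Omega> u) \<Lambda> < ennreal \<epsilon>)"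
    then have "\<exists>U. smooth U \<and> trace_error U u (curl \<Omega> u) \<Lambda> < ennreal (1 / real (Suc k))" for k by simp
    then have "\<forall>k. \<exists>U. smooth U \<and> trace_error U u (curl \<Omega> u) \<Lambda> < ennreal (1 / real (Suc k))" ..
    from choice[OF this] obtain U where U: "\<And>k. smooth (U k)"
      and err: "\<And>k. trace_error (U k) u (curl \<Omega> u) \<Lambda> < ennreal (1 / real (Suc k))" by blast
    have small: "t \<longlonglongrightarrow> 0" if "\<And>k. t k \<le> trace_error (U k) u (curl \<Omega> u) \<Lambda>" for t :: "nat \<Rightarrow> ennreal"
    proof (rule tendsto_sandwich[OF always_eventually always_eventually tendsto_const])
      have "(\<lambda>k. ennreal (1 / real (Suc k))) \<longlonglongrightarrow> ennreal 0"
        by (rule tendsto_ennrealI[OF LIMSEQ_Suc[OF lim_1_over_n]])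
      then show "(\<lambda>k. ennreal (1 / real (Suc k))) \<longlonglongrightarrow> 0" by simp
      show "\<forall>k. t k \<le> ennreal (1 / real (Suc k))" using that err less_imp_le order_trans by blast
    qed simp
    have "(\<lambda>k. ennreal (l2norm D (U k - u))) \<longlonglongrightarrow> 0" "(\<lambda>k. ennreal (l2norm D (classical_curl (U k) - curl \<Omega> u))) \<longlonglongrightarrow> 0"
      and dual: "(\<lambda>k. dual_norm \<Omega> (\<lambda>\<phi>. normal_trace (U k) \<phi> - \<Lambda> \<phi>)) \<longlonglongrightarrow> 0"
      by (rule small, simp add: trace_error_def add_increasing add_increasing2)+
    then have "(\<lambda>k. L2_sq D (\<lambda>x. U k x - u x)) \<longlonglongrightarrow> 0" "(\<lambda>k. L2_sq D (\<lambda>x. classical_curl (U k) x - curl \<Omega> u x)) \<longlonglongrightarrow> 0"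
      using sq[of U, OF smooth_L2(1)[OF U] Hcurl_L2[OF u]] sq[of "\<lambda>k. classical_curl (U k)", OF smooth_L2(2)[OF U] curl_of_Hcurl(1)[OF u]]
      by blast+
    with u U dual show "has_tangential_trace \<Omega> u \<Lambda>" unfolding has_tangential_trace_def by blast
  qed
qed (simp add: has_tangential_trace_def)

lemma trace_error_cong_AE:
  assumes "AE x in D. w x = w' x" "w \<in> L2 D" "w' \<in> L2 D" "smooth U"
  shows "trace_error U u w \<Lambda> = trace_error U u w' \<Lambda>"
  unfolding trace_error_def using l2norm_diff_cong[OF assms(1) smooth_L2(2)[OF assms(4)] assms(2,3)] by simp

lemma trace_error_add_scaled:
  assumes U: "smooth U" "smooth U'" and L: "u \<in> L2 D" "w \<in> L2 D" "u' \<in> L2 D" "w' \<in> L2 D"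
    and \<Lambda>: "\<And>\<phi>. \<phi> \<in> trace_test \<Longrightarrow> \<Lambda>'' \<phi> = \<Lambda> \<phi> + c *\<^sub>R \<Lambda>' \<phi>"
  shows "trace_error (U + c *\<^sub>R U') (u + c *\<^sub>R u') (w + c *\<^sub>R w') \<Lambda>'' \<le>
    trace_error U u w \<Lambda> + ennreal \<bar>c\<bar> * trace_error U' u' w' \<Lambda>'"
proof -
  have l2: "ennreal (l2norm D (f + c *\<^sub>R f' - (g + c *\<^sub>R g'))) \<le> ennreal (l2norm D (f - g)) + ennreal \<bar>c\<bar> * ennreal (l2norm D (f' - g'))"
    if "f \<in> L2 D" "g \<in> L2 D" "f' \<in> L2 D" "g' \<in> L2 D" for f g f' g' :: "real^3 \<Rightarrow> complex^3"
  proof -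
    have "f + c *\<^sub>R f' - (g + c *\<^sub>R g') = (f - g) + c *\<^sub>R (f' - g')" by (simp add: algebra_simps)
    then have "l2norm D (f + c *\<^sub>R f' - (g + c *\<^sub>R g')) \<le> l2norm D (f - g) + \<bar>c\<bar> * l2norm D (f' - g')"
      using l2norm_triangle[OF L2_diff[OF that(1,2)] L2_scaleR[OF L2_diff[OF that(3,4)]], of c] by (simp only: l2norm_scaleR)
    from ennreal_leI[OF this] show ?thesis by (simp add: ennreal_mult)
  qed
  have "dual_norm \<Omega> (\<lambda>\<phi>. normal_trace (U + c *\<^sub>R U') \<phi> - \<Lambda>'' \<phi>) \<le>
      dual_norm \<Omega> (\<lambda>\<phi>. normal_trace U \<phi> - \<Lambda> \<phi>) + dual_norm \<Omega> (\<lambda>\<phi>. c *\<^sub>R (normal_trace U' \<phi> - \<Lambda>' \<phi>))"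
  proof (rule dual_norm_le_add)
    fix \<phi> assume \<phi>: "\<phi> \<in> trace_test"
    show "normal_trace (U + c *\<^sub>R U') \<phi> - \<Lambda>'' \<phi> = normal_trace U \<phi> - \<Lambda> \<phi> + c *\<^sub>R (normal_trace U' \<phi> - \<Lambda>' \<phi>)"
      unfolding cross_normal_add cross_normal_scaleR \<Lambda>[OF \<phi>] surface_functional_scaleR
        surface_functional_add[OF cross_normal_in_L2[OF smooth_L2(3)[OF U(1)]] L2_scaleR[OF cross_normal_in_L2[OF smooth_L2(3)[OF U(2)]]] \<phi>]
      by (simp add: scaleR_diff_right)
  qed
  also have "\<dots> \<le> dual_norm \<Omega> (\<lambda>\<phi>. normal_trace U \<phi> - \<Lambda> \<phi>) + ennreal \<bar>c\<bar> * dual_norm \<Omega> (\<lambda>\<phi>. normal_trace U' \<phi> - \<Lambda>' \<phi>)"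
    by (intro add_left_mono dual_norm_scaleR_le)
  finally have "trace_error (U + c *\<^sub>R U') (u + c *\<^sub>R u') (w + c *\<^sub>R w') \<Lambda>'' \<le>
      (ennreal (l2norm D (U - u)) + ennreal \<bar>c\<bar> * ennreal (l2norm D (U' - u'))) +
      (ennreal (l2norm D (classical_curl U - w)) + ennreal \<bar>c\<bar> * ennreal (l2norm D (classical_curl U' - w'))) +
      (dual_norm \<Omega> (\<lambda>\<phi>. normal_trace U \<phi> - \<Lambda> \<phi>) + ennreal \<bar>c\<bar> * dual_norm \<Omega> (\<lambda>\<phi>. normal_trace U' \<phi> - \<Lambda>' \<phi>))"
    unfolding trace_error_def classical_curl_add[OF U(1) smooth_scaleR[OF U(2)]] classical_curl_scaleR[OF U(2)]
    by (intro add_mono l2 smooth_L2 U L)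
  also have "\<dots> = trace_error U u w \<Lambda> + ennreal \<bar>c\<bar> * trace_error U' u' w' \<Lambda>'"
    by (simp only: trace_error_def distrib_left ac_simps)
  finally show ?thesis .
qed

text \<open>Approximations within \<open>\<epsilon> / (1 + \<bar>c\<bar>)\<close> of the two fields combine to one within \<open>\<epsilon>\<close> of the combination.\<close>

lemma has_tangential_trace_add_scaled:
  assumes trace: "has_tangential_trace \<Omega> u \<Lambda>" "has_tangential_trace \<Omega> u' \<Lambda>'"
    and \<Lambda>: "\<And>\<phi>. \<phi> \<in> trace_test \<Longrightarrow> \<Lambda>'' \<phi> = \<Lambda> \<phi> + c *\<^sub>R \<Lambda>' \<phi>"
  shows "has_tangential_trace \<Omega> (u + c *\<^sub>R u') \<Lambda>''"
  unfolding has_tangential_trace_iff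
proof (intro conjI allI impI)
  have u: "u \<in> Hcurl \<Omega>" "u' \<in> Hcurl \<Omega>" using trace by (auto simp: has_tangential_trace_def)
  note L = Hcurl_L2[OF u(1)] curl_of_Hcurl(1)[OF u(1)] Hcurl_L2[OF u(2)] curl_of_Hcurl(1)[OF u(2)]
  show sum: "u + c *\<^sub>R u' \<in> Hcurl \<Omega>" by (rule Hcurl_add_scaled(1)[OF u])
  fix \<epsilon> :: real assume \<epsilon>: "\<epsilon> > 0"
  define \<delta> where "\<delta> = \<epsilon> / (1 + \<bar>c\<bar>)"
  have pos: "0 < 1 + \<bar>c\<bar>" by simp
  then have \<delta>: "\<delta> > 0" "\<delta> + \<bar>c\<bar> * \<delta> = \<epsilon>" using \<epsilon> by (simp_all add: \<delta>_def add_divide_distrib[symmetric] distrib_right[symmetric] field_simps)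
  obtain U where U: "smooth U" "trace_error U u (curl \<Omega> u) \<Lambda> < ennreal \<delta>"
    using trace(1) \<delta>(1) unfolding has_tangential_trace_iff by blast
  obtain U' where U': "smooth U'" "trace_error U' u' (curl \<Omega> u') \<Lambda>' < ennreal \<delta>"
    using trace(2) \<delta>(1) unfolding has_tangential_trace_iff by blast
  have V: "smooth (U + c *\<^sub>R U')" by (rule smooth_add[OF U(1) smooth_scaleR[OF U'(1)]])
  have "trace_error (U + c *\<^sub>R U') (u + c *\<^sub>R u') (curl \<Omega> (u + c *\<^sub>R u')) \<Lambda>'' =
      trace_error (U + c *\<^sub>R U') (u + c *\<^sub>R u') (curl \<Omega> u + c *\<^sub>R curl \<Omega> u') \<Lambda>''"
    by (rule trace_error_cong_AE[OF Hcurl_add_scaled(2)[OF u] curl_of_Hcurl(1)[OF sum] L2_add[OF L(2) L2_scaleR[OF L(4)]] V])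
  also have "\<dots> \<le> trace_error U u (curl \<Omega> u) \<Lambda> + ennreal \<bar>c\<bar> * trace_error U' u' (curl \<Omega> u') \<Lambda>'"
    by (rule trace_error_add_scaled[OF U(1) U'(1) L \<Lambda>])
  also have "\<dots> \<le> trace_error U u (curl \<Omega> u) \<Lambda> + ennreal \<bar>c\<bar> * ennreal \<delta>"
    by (intro add_left_mono mult_left_mono less_imp_le[OF U'(2)]) simp
  also have "\<dots> < ennreal \<delta> + ennreal \<bar>c\<bar> * ennreal \<delta>"
    using U(2) by (simp add: ennreal_add_left_cancel_less ennreal_mult_eq_top_iff add.commute)
  also have "\<dots> = ennreal \<epsilon>" using \<delta> by (simp flip: ennreal_mult ennreal_plus)
  finally show "\<exists>V. smooth V \<and> trace_error V (u + c *\<^sub>R u') (curl \<Omega> (u + c *\<^sub>R u')) \<Lambda>'' < ennreal \<epsilon>"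
    using V by blast
qed

text \<open>A smooth field that approximates \<open>u n\<close> well, for large \<open>n\<close>, approximates the limit. For boundary
fields \<open>L\<^sup>2\<close> convergence suffices, since it dominates convergence in the dual norm.\<close>

lemma tangential_trace_limit:
  assumes trace: "\<And>n. has_tangential_trace \<Omega> (u n) (normal_trace (z n))"
    and z: "\<And>n. z n \<in> L2 \<Gamma>" "z0 \<in> L2 \<Gamma>" "(\<lambda>n. l2norm \<Gamma> (z n - z0)) \<longlonglongrightarrow> 0"
    and u0: "u0 \<in> L2 D" "(\<lambda>n. l2norm D (u n - u0)) \<longlonglongrightarrow> 0"
    and w0: "w0 \<in> L2 D" "(\<lambda>n. l2norm D (curl \<Omega> (u n) - w0)) \<longlonglongrightarrow> 0"
  shows "has_tangential_trace \<Omega> u0 (normal_trace z0)" "AE x in D. curl \<Omega> u0 x = w0 x"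
proof -
  have u: "u n \<in> Hcurl \<Omega>" for n using trace by (simp add: has_tangential_trace_def)
  have weak: "is_weak_curl \<Omega> u0 w0"
    by (rule weak_curl_limit[OF Hcurl_L2[OF u] u0(1) curl_of_Hcurl(1)[OF u] w0(1) u0(2) w0(2) curl_of_Hcurl(2)[OF u]])
  have u0_Hcurl: "u0 \<in> Hcurl \<Omega>" and curl_u0: "AE x in D. curl \<Omega> u0 x = w0 x"
    using Hcurl_weak_curl[OF u0(1) w0(1) weak] by auto
  show "AE x in D. curl \<Omega> u0 x = w0 x" by (rule curl_u0)
  obtain K where K: "\<And>z. z \<in> L2 \<Gamma> \<Longrightarrow> dual_norm \<Omega> (normal_trace z) \<le> ennreal (K * l2norm \<Gamma> z)"
    using surface_functional_bound by blast
  define r where "r n = ennreal (l2norm D (u n - u0)) + ennreal (l2norm D (curl \<Omega> (u n) - w0)) +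
      ennreal (K * l2norm \<Gamma> (z n - z0))" for n
  have "r \<longlonglongrightarrow> ennreal 0 + ennreal 0 + ennreal 0"
    unfolding r_def by (rule tendsto_add[OF tendsto_add[OF tendsto_ennrealI[OF u0(2)] tendsto_ennrealI[OF w0(2)]]
        tendsto_ennrealI[OF tendsto_mult_right_zero[OF z(3)]]])
  then have r: "r \<longlonglongrightarrow> 0" by simp
  have error: "trace_error U u0 w0 (normal_trace z0) \<le> trace_error U (u n) (curl \<Omega> (u n)) (normal_trace (z n)) + r n"
    if U: "smooth U" for U n
  proof -
    have l2: "ennreal (l2norm D (f - h)) \<le> ennreal (l2norm D (f - g)) + ennreal (l2norm D (g - h))"
      if "f \<in> L2 D" "g \<in> L2 D" "h \<in> L2 D" for f g h :: "real^3 \<Rightarrow> complex^3"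
      using ennreal_leI[OF l2norm_triangle_diff[OF that]] by simp
    have "dual_norm \<Omega> (\<lambda>\<phi>. normal_trace U \<phi> - normal_trace z0 \<phi>) \<le>
        dual_norm \<Omega> (\<lambda>\<phi>. normal_trace U \<phi> - normal_trace (z n) \<phi>) + dual_norm \<Omega> (normal_trace (z n - z0))"
    proof (rule dual_norm_le_add)
      fix \<phi> assume \<phi>: "\<phi> \<in> trace_test"
      have "normal_trace (z n) \<phi> = normal_trace (z n - z0) \<phi> + normal_trace z0 \<phi>"
        using surface_functional_add[OF cross_normal_in_L2[OF L2_diff[OF z(1)[of n] z(2)]] cross_normal_in_L2[OF z(2)] \<phi>]
        by (simp flip: cross_normal_add)
      then show "normal_trace U \<phi> - normal_trace z0 \<phi> =
          normal_trace U \<phi> - normal_trace (z n) \<phi> + normal_trace (z n - z0) \<phi>" by simp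
    qed
    also have "\<dots> \<le> dual_norm \<Omega> (\<lambda>\<phi>. normal_trace U \<phi> - normal_trace (z n) \<phi>) + ennreal (K * l2norm \<Gamma> (z n - z0))"
      by (intro add_left_mono K L2_diff z)
    finally have "trace_error U u0 w0 (normal_trace z0) \<le>
        (ennreal (l2norm D (U - u n)) + ennreal (l2norm D (u n - u0))) +
        (ennreal (l2norm D (classical_curl U - curl \<Omega> (u n))) + ennreal (l2norm D (curl \<Omega> (u n) - w0))) +
        (dual_norm \<Omega> (\<lambda>\<phi>. normal_trace U \<phi> - normal_trace (z n) \<phi>) + ennreal (K * l2norm \<Gamma> (z n - z0)))"
      unfolding trace_error_def
      by (intro add_mono l2 smooth_L2 U u0 w0 Hcurl_L2 curl_of_Hcurl u)
    then show ?thesis by (simp only: trace_error_def r_def ac_simps)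
  qed
  have "\<exists>U. smooth U \<and> trace_error U u0 (curl \<Omega> u0) (normal_trace z0) < ennreal \<epsilon>" if \<epsilon>: "\<epsilon> > 0" for \<epsilon>
  proof -
    have half: "0 < ennreal (\<epsilon> / 2)" "0 < \<epsilon> / 2" using \<epsilon> by auto
    obtain n where n: "r n < ennreal (\<epsilon> / 2)"
      using eventually_happens'[OF sequentially_bot order_tendstoD(2)[OF r half(1)]] by blast
    obtain U where U: "smooth U" "trace_error U (u n) (curl \<Omega> (u n)) (normal_trace (z n)) < ennreal (\<epsilon> / 2)"
      using trace[of n] half(2) unfolding has_tangential_trace_iff by blast
    have "trace_error U u0 (curl \<Omega> u0) (normal_trace z0) = trace_error U u0 w0 (normal_trace z0)"
      by (rule trace_error_cong_AE[OF curl_u0 curl_of_Hcurl(1)[OF u0_Hcurl] w0(1) U(1)])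
    also have "\<dots> \<le> trace_error U (u n) (curl \<Omega> (u n)) (normal_trace (z n)) + r n" by (rule error[OF U(1)])
    also have "\<dots> < ennreal (\<epsilon> / 2) + ennreal (\<epsilon> / 2)" by (rule add_strict_mono[OF U(2) n])
    also have "\<dots> = ennreal \<epsilon>" using \<epsilon> by (simp flip: ennreal_plus)
    finally show ?thesis using U(1) by blast
  qed
  with u0_Hcurl show "has_tangential_trace \<Omega> u0 (normal_trace z0)" unfolding has_tangential_trace_iff by blast
qed

end

section \<open>The material tensors\<close>

lemma measurable_matrix:
  fixes f :: "'a \<Rightarrow> real^3^3"
  assumes "\<And>i j. (\<lambda>x. f x $ i $ j) \<in> borel_measurable M" shows "f \<in> borel_measurable M"
proof -
  have "(\<lambda>x. \<Sum>i\<in>UNIV. \<Sum>j\<in>UNIV. f x $ i $ j *\<^sub>R (axis i (axis j 1) :: real^3^3)) \<in> borel_measurable M"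
    by (intro borel_measurable_sum borel_measurable_scaleR borel_measurable_const assms)
  moreover have "(\<Sum>i\<in>UNIV. \<Sum>j\<in>UNIV. A $ i $ j *\<^sub>R axis i (axis j 1)) = A" for A :: "real^3^3"
    by (simp add: vec_eq_iff forall_3 sum_3 axis_def)
  ultimately show ?thesis by simp
qed

lemma measurable_matrix_nth:
  fixes f :: "'a \<Rightarrow> real^3^3"
  assumes "f \<in> borel_measurable M" shows "(\<lambda>x. f x $ i $ j) \<in> borel_measurable M"
proof -
  have "continuous_on UNIV (\<lambda>A :: real^3^3. A $ i $ j)" by (intro continuous_intros)
  from measurable_compose[OF assms borel_measurable_continuous_onI[OF this]] show ?thesis .
qed

text \<open>Cramer's rule, applied to the columns of the unit matrix.\<close>

lemma matrix_inv_entries: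
  fixes A :: "real^3^3"
  assumes "det A \<noteq> 0"
  shows "matrix_inv A $ i $ j = det (\<chi> k l. if l = i then (axis j 1 :: real^3) $ k else A $ k $ l) / det A"
    "A ** matrix_inv A = mat 1"
proof -
  have "\<exists>B. A ** B = mat 1 \<and> B ** A = mat 1"
    using assms invertible_det_nz[of A] by (simp add: invertible_def)
  from someI_ex[OF this] show inv: "A ** matrix_inv A = mat 1" by (simp add: matrix_inv_def)
  have "A *v (matrix_inv A *v axis j 1) = axis j 1"
    by (simp add: matrix_vector_mul_assoc inv)
  then have "matrix_inv A *v axis j 1 = (\<chi> i. det (\<chi> k l. if l = i then (axis j 1 :: real^3) $ k else A $ k $ l) / det A)"
    by (rule cramer[OF assms, THEN iffD1])
  then have "(matrix_inv A *v axis j 1) $ i = det (\<chi> k l. if l = i then (axis j 1 :: real^3) $ k else A $ k $ l) / det A"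
    by simp
  then show "matrix_inv A $ i $ j = det (\<chi> k l. if l = i then (axis j 1 :: real^3) $ k else A $ k $ l) / det A"
    by (simp add: matrix_vector_mult_basis column_def)
qed

text \<open>On invertible matrices the inverse is a rational function of the entries. On all others it is
one and the same unspecified matrix \<open>N\<close>, because the choice is from an empty set of inverses.\<close>

lemma matrix_inv_measurable:
  fixes A :: "'a \<Rightarrow> real^3^3"
  assumes A: "A \<in> borel_measurable M"
  shows "(\<lambda>x. matrix_inv (A x)) \<in> borel_measurable M"
proof -
  define N :: "real^3^3" where "N = (SOME B. False)"
  define F :: "real^3^3 \<Rightarrow> real^3^3" where
    "F B = (\<chi> i j. det (\<chi> k l. if l = i then (axis j 1 :: real^3) $ k else B $ k $ l) / det B)" for B
  have eq: "matrix_inv B = (if det B \<noteq> 0 then F B else N)" for B :: "real^3^3"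
  proof (cases "det B = 0")
    case True
    then have "(\<lambda>X. B ** X = mat 1 \<and> X ** B = mat 1) = (\<lambda>X. False)"
      using invertible_det_nz[of B] unfolding invertible_def by blast
    then have "matrix_inv B = N" by (simp only: matrix_inv_def N_def)
    with True show ?thesis by simp
  next
    case False
    have "matrix_inv B = F B"
      unfolding vec_eq_iff F_def vec_lambda_beta using matrix_inv_entries(1)[OF False] by blast
    with False show ?thesis by simp
  qed
  have entry [measurable]: "(\<lambda>x. A x $ i $ j) \<in> borel_measurable M" for i j by (rule measurable_matrix_nth[OF A])
  have det: "(\<lambda>x. det (A x)) \<in> borel_measurable M" unfolding det_3 by measurable
  have cof: "(\<lambda>x. det (\<chi> k l. if l = i then (axis j 1 :: real^3) $ k else A x $ k $ l)) \<in> borel_measurable M" for i j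
  proof -
    have "(\<lambda>x. if l = i then (axis j 1 :: real^3) $ k else A x $ k $ l) \<in> borel_measurable M" for k l
      by (cases "l = i") simp_all
    then show ?thesis unfolding det_3 vec_lambda_beta
      by (intro borel_measurable_add borel_measurable_diff borel_measurable_times)
  qed
  have "(\<lambda>x. F (A x)) \<in> borel_measurable M"
    by (rule measurable_matrix) (simp only: F_def vec_lambda_beta borel_measurable_divide[OF cof det])
  moreover have "{x \<in> space M. det (A x) \<noteq> 0} \<in> sets M" using det by measurable
  ultimately show ?thesis unfolding eq by (rule measurable_If[OF _ borel_measurable_const])
qed

text \<open>Coercivity bounds the inverse in operator norm by \<open>1 / c\<close>, hence each of its nine entries.\<close>

lemma coercive_matrix_inv:
  fixes A :: "real^3^3"
  assumes c: "c > 0" and coercive: "\<forall>\<xi>. c * (norm \<xi>)\<^sup>2 \<le> \<xi> \<bullet> (A *v \<xi>)"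
  shows "det A \<noteq> 0" "norm (matrix_inv A) \<le> 9 / c"
proof -
  have "inj ((*v) A)"
  proof (rule linear_injective_0[OF matrix_vector_mul_linear, THEN iffD2], intro allI impI)
    fix \<xi> assume "A *v \<xi> = 0"
    then have "c * (norm \<xi>)\<^sup>2 \<le> 0" using coercive[rule_format, of \<xi>] by simp
    then show "\<xi> = 0" using c by (simp add: mult_le_0_iff)
  qed
  then show det: "det A \<noteq> 0"
    using det_nz_iff_inj[OF matrix_vector_mul_linear[of A]] by simp
  have small: "norm (matrix_inv A *v y) \<le> norm y / c" for y
  proof -
    define \<xi> where "\<xi> = matrix_inv A *v y"
    have "A *v \<xi> = y" by (simp add: \<xi>_def matrix_vector_mul_assoc matrix_inv_entries(2)[OF det])
    then have "c * (norm \<xi>)\<^sup>2 \<le> \<xi> \<bullet> y" using coercive by metis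
    also have "\<dots> \<le> norm \<xi> * norm y" by (rule norm_cauchy_schwarz)
    finally have "norm \<xi> * (c * norm \<xi>) \<le> norm \<xi> * norm y" by (simp add: power2_eq_square mult_ac)
    then have "c * norm \<xi> \<le> norm y" using c by (cases "\<xi> = 0") auto
    then show ?thesis using c by (simp add: \<xi>_def field_simps)
  qed
  have entry: "\<bar>matrix_inv A $ i $ j\<bar> \<le> 1 / c" for i j
  proof -
    have "\<bar>matrix_inv A $ i $ j\<bar> = \<bar>(matrix_inv A *v axis j 1) $ i\<bar>"
      by (simp add: matrix_vector_mult_basis column_def)
    also have "\<dots> \<le> norm (matrix_inv A *v axis j 1)" by (rule component_le_norm_cart)
    also have "\<dots> \<le> 1 / c" using small[of "axis j 1"] by simp
    finally show ?thesis .
  qed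
  have "norm (matrix_inv A) \<le> (\<Sum>i\<in>UNIV. norm (matrix_inv A $ i))"
    unfolding norm_vec_def by (rule L2_set_le_sum) simp
  also have "\<dots> \<le> (\<Sum>i\<in>(UNIV :: 3 set). \<Sum>j\<in>(UNIV :: 3 set). 1 / c)"
    by (intro sum_mono order_trans[OF norm_le_l1_cart] entry)
  also have "\<dots> = 9 / c" by simp
  finally show "norm (matrix_inv A) \<le> 9 / c" .
qed

lemma rmatvec_matrix_inv:
  assumes "det A \<noteq> 0" shows "rmatvec A (rmatvec (matrix_inv A) b) = b"
proof -
  have "rmatvec A (rmatvec B b) = rmatvec (A ** B) b" for B
    by (simp add: rmatvec_def matrix_matrix_mult_def vec_eq_iff forall_3 sum_3 algebra_simps)
  moreover have "rmatvec (mat 1) b = b"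
    by (simp add: rmatvec_def mat_def vec_eq_iff forall_3 sum_3)
  ultimately show ?thesis using matrix_inv_entries(2)[OF assms] by simp
qed

lemma symmetric_form_real:
  assumes "transpose A = A" shows "Im (cdot (rmatvec A a) a) = 0" "Im (cdot a (rmatvec A a)) = 0"
proof -
  have "A $ i $ j = A $ j $ i" for i j
    using assms by (simp add: vec_eq_iff transpose_def)
  from this[of 1 2] this[of 1 3] this[of 2 3]
  show "Im (cdot (rmatvec A a) a) = 0" "Im (cdot a (rmatvec A a)) = 0"
    by (simp_all add: cdot_def rmatvec_def sum_3 algebra_simps)
qed

text \<open>The real part is the sum of the real quadratic forms at the real and the imaginary part of \<open>a\<close>.\<close>

lemma coercive_form:
  fixes A :: "real^3^3"
  assumes "\<forall>\<xi>. c * (norm \<xi>)\<^sup>2 \<le> \<xi> \<bullet> (A *v \<xi>)"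
  shows "c * (norm a)\<^sup>2 \<le> Re (cdot (rmatvec A a) a)"
proof -
  define p q where "p = (\<chi> i. Re (a $ i))" and "q = (\<chi> i. Im (a $ i))"
  have "(norm a)\<^sup>2 = (norm p)\<^sup>2 + (norm q)\<^sup>2"
    unfolding power2_norm_eq_inner by (simp add: inner_vec_def sum_3 p_def q_def inner_complex_def)
  moreover have "Re (cdot (rmatvec A a) a) = p \<bullet> (A *v p) + q \<bullet> (A *v q)"
    by (simp add: cdot_def rmatvec_def inner_vec_def matrix_vector_mult_def sum_3 p_def q_def algebra_simps)
  ultimately show ?thesis using assms[rule_format, of p] assms[rule_format, of q] by (simp add: algebra_simps)
qed

definition weighted :: "('a \<Rightarrow> real^3^3) \<Rightarrow> ('a \<Rightarrow> complex^3) \<Rightarrow> 'a \<Rightarrow> complex^3" where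
  "weighted A u x = rmatvec (A x) (u x)"

lemma weighted_add: "weighted A (u + v) = weighted A u + weighted A v"
  by (simp add: fun_eq_iff weighted_def bounded_bilinear.add_right[OF bounded_bilinear_rmatvec])

lemma weighted_scaleR: "weighted A (c *\<^sub>R u) = c *\<^sub>R weighted A u"
  by (simp add: fun_eq_iff weighted_def bounded_bilinear.scaleR_right[OF bounded_bilinear_rmatvec])

lemma weighted_diff: "weighted A (u - v) = weighted A u - weighted A v"
  by (simp add: fun_eq_iff weighted_def bounded_bilinear.diff_right[OF bounded_bilinear_rmatvec])

lemma weighted_bounded:
  assumes "A \<in> borel_measurable M" "AE x in M. norm (A x) \<le> C"
  shows "\<exists>K. \<forall>u\<in>L2 M. weighted A u \<in> L2 M \<and> l2norm M (weighted A u) \<le> K * l2norm M u"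
  using L2_bounded_multiplier[OF bounded_bilinear_rmatvec assms] unfolding weighted_def[abs_def] by blast

section \<open>States\<close>

locale eddy_current = polyhedral_domain +
  fixes \<mu> \<kappa> :: "real^3 \<Rightarrow> real^3^3" and \<omega> :: real
  assumes \<mu>: "material_tensor \<Omega> \<mu>" and \<kappa>: "material_tensor \<Omega> \<kappa>" and \<omega>: "\<omega> \<noteq> 0"
begin

abbreviation "state \<equiv> is_state \<Omega> \<mu> \<kappa> \<omega>"

abbreviation "\<nu> x \<equiv> matrix_inv (\<mu> x)"

lemma \<mu>_symmetric_invertible: "AE x in D. transpose (\<mu> x) = \<mu> x \<and> det (\<mu> x) \<noteq> 0"
proof -
  obtain c where c: "c > 0" "AE x in D. \<forall>\<xi>. c * (norm \<xi>)\<^sup>2 \<le> \<xi> \<bullet> (\<mu> x *v \<xi>)"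
    using \<mu> unfolding material_tensor_def by blast
  have "AE x in D. transpose (\<mu> x) = \<mu> x" using \<mu> unfolding material_tensor_def by blast
  with c(2) show ?thesis by eventually_elim (use coercive_matrix_inv(1)[OF c(1)] in blast)
qed

lemma weighted_\<nu>:
  "\<exists>K. \<forall>u\<in>L2 D. weighted \<nu> u \<in> L2 D \<and> l2norm D (weighted \<nu> u) \<le> K * l2norm D u"
proof -
  obtain c where c: "c > 0" "AE x in D. \<forall>\<xi>. c * (norm \<xi>)\<^sup>2 \<le> \<xi> \<bullet> (\<mu> x *v \<xi>)"
    using \<mu> unfolding material_tensor_def by blast
  have bd: "AE x in D. norm (\<nu> x) \<le> 9 / c"
    using c(2) by (rule eventually_mono) (rule coercive_matrix_inv(2)[OF c(1)])
  have meas: "\<nu> \<in> borel_measurable D"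
    using \<mu> by (intro matrix_inv_measurable) (simp add: material_tensor_def)
  show ?thesis by (rule weighted_bounded[OF meas bd])
qed

lemma weighted_\<kappa>:
  "\<exists>K. \<forall>u\<in>L2 D. weighted \<kappa> u \<in> L2 D \<and> l2norm D (weighted \<kappa> u) \<le> K * l2norm D u"
proof -
  obtain C where C: "AE x in D. norm (\<kappa> x) \<le> C"
    using \<kappa> unfolding material_tensor_def by blast
  have meas: "\<kappa> \<in> borel_measurable D"
    using \<kappa> by (simp add: material_tensor_def)
  show ?thesis by (rule weighted_bounded[OF meas C])
qed

lemma weighted_L2: "u \<in> L2 D \<Longrightarrow> weighted \<nu> u \<in> L2 D" "u \<in> L2 D \<Longrightarrow> weighted \<kappa> u \<in> L2 D"
  by (use weighted_\<nu> in blast) (use weighted_\<kappa> in blast)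

text \<open>The sesquilinear form of the state equation for fields \<open>u\<close> and \<open>v\<close> with curls \<open>w\<close> and \<open>w'\<close>. The curls
are separate arguments, as they are determined only almost everywhere: this lets the form be
computed with any representatives.\<close>

definition form :: "(real^3 \<Rightarrow> complex^3) \<Rightarrow> (real^3 \<Rightarrow> complex^3) \<Rightarrow> (real^3 \<Rightarrow> complex^3) \<Rightarrow> (real^3 \<Rightarrow> complex^3) \<Rightarrow> complex" where
  "form u w v w' = (LINT x|D. cdot (weighted \<nu> w x) (w' x)) +
     \<i> * complex_of_real \<omega> * (LINT x|D. cdot (weighted \<kappa> u x) (v x))"

lemma is_state_iff:
  "state jc z u \<longleftrightarrow> u \<in> Hcurl \<Omega> \<and>
     has_tangential_trace \<Omega> u (normal_trace z) \<and>
     (\<forall>v\<in>Hcurl0 \<Omega>. form u (curl \<Omega> u) v (curl \<Omega> v) = (LINT x|D. cdot (jc x) (v x)))"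
  by (simp add: is_state_def form_def weighted_def)

lemma form_add:
  assumes "u \<in> L2 D" "w \<in> L2 D" "u' \<in> L2 D" "w' \<in> L2 D" "v \<in> L2 D" "t \<in> L2 D"
  shows "form (u + u') (w + w') v t = form u w v t + form u' w' v t"
  using assms unfolding form_def weighted_add
  by (simp add: L2_bilinear_add[OF bounded_bilinear_cdot] weighted_L2 algebra_simps del: plus_fun_apply)

lemma form_scaleR: "form (c *\<^sub>R u) (c *\<^sub>R w) v t = c *\<^sub>R form u w v t"
  unfolding form_def weighted_scaleR L2_bilinear_scaleR[OF bounded_bilinear_cdot]
  by (simp add: scaleR_add_right)

lemma weighted_cong_AE:
  assumes "AE x in D. w x = w' x" shows "AE x in D. weighted A w x = weighted A w' x"
  using assms by (rule eventually_mono) (simp add: weighted_def)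

lemma form_cong_AE:
  assumes w: "AE x in D. w x = w' x" and L2: "w \<in> L2 D" "w' \<in> L2 D" "t \<in> L2 D"
  shows "form u w v t = form u w' v t"
proof -
  have "(LINT x|D. cdot (weighted \<nu> w x) (t x)) = (LINT x|D. cdot (weighted \<nu> w' x) (t x))"
  proof (rule integral_cong_AE)
    show "AE x in D. cdot (weighted \<nu> w x) (t x) = cdot (weighted \<nu> w' x) (t x)"
      using weighted_cong_AE[OF w, of \<nu>] by (rule eventually_mono) (simp only:)
    show "(\<lambda>x. cdot (weighted \<nu> w x) (t x)) \<in> borel_measurable D"
      by (rule borel_measurable_integrable[OF L2_bilinear_integrable[OF bounded_bilinear_cdot weighted_L2(1)[OF L2(1)] L2(3)]])
    show "(\<lambda>x. cdot (weighted \<nu> w' x) (t x)) \<in> borel_measurable D"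
      by (rule borel_measurable_integrable[OF L2_bilinear_integrable[OF bounded_bilinear_cdot weighted_L2(1)[OF L2(2)] L2(3)]])
  qed
  then show ?thesis by (simp add: form_def)
qed

lemma form_tendsto:
  assumes u: "\<And>n. u n \<in> L2 D" "u0 \<in> L2 D" "(\<lambda>n. l2norm D (u n - u0)) \<longlonglongrightarrow> 0"
    and w: "\<And>n. w n \<in> L2 D" "w0 \<in> L2 D" "(\<lambda>n. l2norm D (w n - w0)) \<longlonglongrightarrow> 0"
    and v: "v \<in> L2 D" "t \<in> L2 D"
  shows "(\<lambda>n. form (u n) (w n) v t) \<longlonglongrightarrow> form u0 w0 v t"
proof -
  obtain K where K: "\<forall>u\<in>L2 D. l2norm D (weighted \<nu> u) \<le> K * l2norm D u" using weighted_\<nu> by blast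
  obtain L where L: "\<forall>u\<in>L2 D. l2norm D (weighted \<kappa> u) \<le> L * l2norm D u" using weighted_\<kappa> by blast
  have "(\<lambda>n. l2norm D (weighted \<nu> (w n) - weighted \<nu> w0)) \<longlonglongrightarrow> 0"
  proof (rule tendsto_sandwich[OF always_eventually always_eventually tendsto_const tendsto_mult_right_zero[OF w(3)]])
    show "\<forall>n. l2norm D (weighted \<nu> (w n) - weighted \<nu> w0) \<le> K * l2norm D (w n - w0)"
      unfolding weighted_diff[symmetric] using bspec[OF K L2_diff[OF w(1,2)]] by blast
  qed simp
  moreover have "(\<lambda>n. l2norm D (weighted \<kappa> (u n) - weighted \<kappa> u0)) \<longlonglongrightarrow> 0"
  proof (rule tendsto_sandwich[OF always_eventually always_eventually tendsto_const tendsto_mult_right_zero[OF u(3)]])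
    show "\<forall>n. l2norm D (weighted \<kappa> (u n) - weighted \<kappa> u0) \<le> L * l2norm D (u n - u0)"
      unfolding weighted_diff[symmetric] using bspec[OF L L2_diff[OF u(1,2)]] by blast
  qed simp
  ultimately show ?thesis
    unfolding form_def
    by (rule tendsto_add[OF
          L2_bilinear_tendsto[OF bounded_bilinear_cdot weighted_L2(1)[OF w(1)] weighted_L2(1)[OF w(2)] v(2)]
          tendsto_mult[OF tendsto_const
            L2_bilinear_tendsto[OF bounded_bilinear_cdot weighted_L2(2)[OF u(1)] weighted_L2(2)[OF u(2)] v(1)]]])
qed

lemma Hcurl0_Hcurl: "v \<in> Hcurl0 \<Omega> \<Longrightarrow> v \<in> Hcurl \<Omega>"
  by (simp add: Hcurl0_def)

lemma is_state_Hcurl: "state jc z u \<Longrightarrow> u \<in> Hcurl \<Omega>"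
  by (simp add: is_state_def)

text \<open>Linearity of the state relation in source, boundary data and field together; sums, differences and
multiples of states are instances.\<close>

lemma is_state_add_scaled:
  assumes s: "state jc z u" "state jc' z' u'"
    and L2: "jc \<in> L2 D" "jc' \<in> L2 D" "z \<in> L2 \<Gamma>" "z' \<in> L2 \<Gamma>"
  shows "state (jc + c *\<^sub>R jc') (z + c *\<^sub>R z') (u + c *\<^sub>R u')"
  unfolding is_state_iff
proof (intro conjI ballI)
  have u: "u \<in> Hcurl \<Omega>" "u' \<in> Hcurl \<Omega>" using s by (auto simp: is_state_def)
  note L = Hcurl_L2[OF u(1)] curl_of_Hcurl(1)[OF u(1)] L2_scaleR[OF Hcurl_L2[OF u(2)]] L2_scaleR[OF curl_of_Hcurl(1)[OF u(2)]]
  show sum: "u + c *\<^sub>R u' \<in> Hcurl \<Omega>" by (rule Hcurl_add_scaled(1)[OF u])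
  show "has_tangential_trace \<Omega> (u + c *\<^sub>R u') (normal_trace (z + c *\<^sub>R z'))"
  proof (rule has_tangential_trace_add_scaled)
    show "has_tangential_trace \<Omega> u (normal_trace z)" "has_tangential_trace \<Omega> u' (normal_trace z')"
      using s by (auto simp: is_state_def)
  qed (simp only: cross_normal_add cross_normal_scaleR surface_functional_scaleR
      surface_functional_add[OF cross_normal_in_L2[OF L2(3)] L2_scaleR[OF cross_normal_in_L2[OF L2(4)]]])
  fix v assume v: "v \<in> Hcurl0 \<Omega>"
  note Lv = Hcurl_L2[OF Hcurl0_Hcurl[OF v]] curl_of_Hcurl(1)[OF Hcurl0_Hcurl[OF v]]
  have "form (u + c *\<^sub>R u') (curl \<Omega> (u + c *\<^sub>R u')) v (curl \<Omega> v) =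
      form (u + c *\<^sub>R u') (curl \<Omega> u + c *\<^sub>R curl \<Omega> u') v (curl \<Omega> v)"
    by (rule form_cong_AE[OF Hcurl_add_scaled(2)[OF u] curl_of_Hcurl(1)[OF sum] L2_add[OF L(2,4)] Lv(2)])
  also have "\<dots> = form u (curl \<Omega> u) v (curl \<Omega> v) + c *\<^sub>R form u' (curl \<Omega> u') v (curl \<Omega> v)"
    unfolding form_add[OF L Lv] form_scaleR ..
  also have "\<dots> = (LINT x|D. cdot (jc x) (v x)) + c *\<^sub>R (LINT x|D. cdot (jc' x) (v x))"
    using s v by (simp add: is_state_iff)
  also have "\<dots> = (LINT x|D. cdot ((jc + c *\<^sub>R jc') x) (v x))"
    unfolding L2_bilinear_add[OF bounded_bilinear_cdot L2(1) L2_scaleR[OF L2(2)] Lv(1)] L2_bilinear_scaleR[OF bounded_bilinear_cdot] ..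
  finally show "form (u + c *\<^sub>R u') (curl \<Omega> (u + c *\<^sub>R u')) v (curl \<Omega> v) = (LINT x|D. cdot ((jc + c *\<^sub>R jc') x) (v x))" .
qed

lemma is_state_add:
  assumes "state jc z u" "state jc' z' u'" "jc \<in> L2 D" "jc' \<in> L2 D" "z \<in> L2 \<Gamma>" "z' \<in> L2 \<Gamma>"
  shows "state (jc + jc') (z + z') (u + u')"
  using is_state_add_scaled[OF assms, of 1] by simp

lemma is_state_diff:
  assumes "state jc z u" "state jc' z' u'" "jc \<in> L2 D" "jc' \<in> L2 D" "z \<in> L2 \<Gamma>" "z' \<in> L2 \<Gamma>"
  shows "state (jc - jc') (z - z') (u - u')"
  using is_state_add_scaled[OF assms, of "-1"] by simp

lemma is_state_scaleR:
  assumes "state jc z u" "jc \<in> L2 D" "z \<in> L2 \<Gamma>"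
  shows "state (c *\<^sub>R jc) (c *\<^sub>R z) (c *\<^sub>R u)"
  using is_state_add_scaled[OF assms(1,1,2,2,3,3), of "c - 1"] by (simp add: scaleR_diff_left)

text \<open>The graph of the control-to-state map is closed: boundary data converge in \<open>L\<^sup>2(\<Gamma>)\<close> and states in
H(curl).\<close>

lemma is_state_limit:
  assumes s: "\<And>n. state jc (z n) (u n)"
    and z: "\<And>n. z n \<in> L2 \<Gamma>" "z0 \<in> L2 \<Gamma>" "(\<lambda>n. l2norm \<Gamma> (z n - z0)) \<longlonglongrightarrow> 0"
    and u0: "u0 \<in> L2 D" "(\<lambda>n. l2norm D (u n - u0)) \<longlonglongrightarrow> 0"
    and w0: "w0 \<in> L2 D" "(\<lambda>n. l2norm D (curl \<Omega> (u n) - w0)) \<longlonglongrightarrow> 0"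
  shows "state jc z0 u0" "AE x in D. curl \<Omega> u0 x = w0 x"
proof -
  have u: "u n \<in> Hcurl \<Omega>" for n using s by (simp add: is_state_def)
  have "has_tangential_trace \<Omega> (u n) (normal_trace (z n))" for n
    using s by (simp add: is_state_def)
  note tr = tangential_trace_limit[OF this z u0 w0]
  show curl: "AE x in D. curl \<Omega> u0 x = w0 x" by (rule tr(2))
  have u0_Hcurl: "u0 \<in> Hcurl \<Omega>" using tr(1) by (simp add: has_tangential_trace_def)
  have "form u0 (curl \<Omega> u0) v (curl \<Omega> v) = (LINT x|D. cdot (jc x) (v x))" if v: "v \<in> Hcurl0 \<Omega>" for v
  proof -
    note Lv = Hcurl_L2[OF Hcurl0_Hcurl[OF v]] curl_of_Hcurl(1)[OF Hcurl0_Hcurl[OF v]]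
    have "form (u n) (curl \<Omega> (u n)) v (curl \<Omega> v) = (LINT x|D. cdot (jc x) (v x))" for n
      using s v by (simp add: is_state_iff)
    then have "form u0 w0 v (curl \<Omega> v) = (LINT x|D. cdot (jc x) (v x))"
      using form_tendsto[OF Hcurl_L2[OF u] u0 curl_of_Hcurl(1)[OF u] w0 Lv] by (simp add: LIMSEQ_const_iff)
    then show ?thesis
      using form_cong_AE[OF curl curl_of_Hcurl(1)[OF u0_Hcurl] w0(1) Lv(2)] by simp
  qed
  with tr(1) u0_Hcurl show "state jc z0 u0" by (simp add: is_state_iff)
qed

text \<open>Test the equation with \<open>d\<close> itself. By symmetry of \<open>\<mu>\<close> the curl term is real, so the imaginary part of
the equation says that the coercive term weighted by \<open>\<kappa>\<close> vanishes.\<close>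

lemma homogeneous_state_zero:
  assumes s: "state 0 0 d"
  shows "AE x in D. d x = 0" "AE x in D. curl \<Omega> d x = 0"
proof -
  have d: "d \<in> Hcurl \<Omega>" using s by (simp add: is_state_def)
  note L = Hcurl_L2[OF d] curl_of_Hcurl(1)[OF d]
  have "normal_trace 0 = (\<lambda>_. 0)"
    by (simp add: fun_eq_iff surface_functional_def cross_normal_def bounded_bilinear.zero_left[OF bounded_bilinear_ccross_cvec]
        bounded_bilinear.zero_left[OF bounded_bilinear_bdot])
  then have "d \<in> Hcurl0 \<Omega>" using s by (simp add: Hcurl0_def is_state_def)
  then have "form d (curl \<Omega> d) d (curl \<Omega> d) = 0"
    using s by (simp add: is_state_iff bounded_bilinear.zero_left[OF bounded_bilinear_cdot])
  moreover have "Im (LINT x|D. cdot (weighted \<nu> (curl \<Omega> d) x) (curl \<Omega> d x)) = 0"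
  proof -
    have "Im (LINT x|D. cdot (weighted \<nu> (curl \<Omega> d) x) (curl \<Omega> d x)) = (LINT x|D. Im (cdot (weighted \<nu> (curl \<Omega> d) x) (curl \<Omega> d x)))"
      using L2_bilinear_integrable[OF bounded_bilinear_cdot weighted_L2(1)[OF L(2)] L(2)] by simp
    also have "\<dots> = 0"
    proof (rule integral_eq_zero_AE, use \<mu>_symmetric_invertible in eventually_elim)
      case (elim x)
      \<comment> \<open>with \<open>b = \<nu> curl d\<close> the integrand is \<open>b\<close> paired with \<open>\<mu> b\<close>\<close>
      have "cdot (weighted \<nu> (curl \<Omega> d) x) (curl \<Omega> d x) =
          cdot (weighted \<nu> (curl \<Omega> d) x) (rmatvec (\<mu> x) (weighted \<nu> (curl \<Omega> d) x))"
        using elim by (simp add: weighted_def rmatvec_matrix_inv)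
      then show ?case using elim symmetric_form_real(2) by simp
    qed
    finally show ?thesis .
  qed
  ultimately have "\<omega> * Re (LINT x|D. cdot (weighted \<kappa> d x) (d x)) = 0"
    by (simp add: form_def complex_eq_iff)
  then have zero: "Re (LINT x|D. cdot (weighted \<kappa> d x) (d x)) = 0" using \<omega> by simp
  obtain c where c: "c > 0" "AE x in D. \<forall>\<xi>. c * (norm \<xi>)\<^sup>2 \<le> \<xi> \<bullet> (\<kappa> x *v \<xi>)"
    using \<kappa> unfolding material_tensor_def by blast
  have int: "integrable D (\<lambda>x. cdot (weighted \<kappa> d x) (d x))"
    by (rule L2_bilinear_integrable[OF bounded_bilinear_cdot weighted_L2(2)[OF L(1)] L(1)])
  have "c * (l2norm D d)\<^sup>2 = (LINT x|D. c * (norm (d x))\<^sup>2)" by (simp add: l2norm_sq)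
  also have "\<dots> \<le> (LINT x|D. Re (cdot (weighted \<kappa> d x) (d x)))"
  proof (rule integral_mono_AE)
    show "integrable D (\<lambda>x. c * (norm (d x))\<^sup>2)" using L(1) by (simp add: L2_iff)
    show "integrable D (\<lambda>x. Re (cdot (weighted \<kappa> d x) (d x)))" using int by simp
    show "AE x in D. c * (norm (d x))\<^sup>2 \<le> Re (cdot (weighted \<kappa> d x) (d x))"
      using c(2) unfolding weighted_def by (rule eventually_mono) (rule coercive_form)
  qed
  also have "\<dots> = 0" using int zero by simp
  finally have "c * (l2norm D d)\<^sup>2 \<le> 0" .
  then have "l2norm D d = 0" using c(1) by (simp add: mult_le_0_iff)
  then show d0: "AE x in D. d x = 0" using l2norm_eq_0_iff[OF L(1)] by simp
  have "is_weak_curl \<Omega> d 0"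
    unfolding is_weak_curl_def
  proof (intro allI impI)
    fix \<phi>
    have "(LINT x|D. bdot (d x) (classical_curl \<phi> x)) = 0"
      by (rule integral_eq_zero_AE, use d0 in eventually_elim) (simp add: bounded_bilinear.zero_left[OF bounded_bilinear_bdot])
    then show "(LINT x|D. bdot (0 x) (\<phi> x)) = (LINT x|D. bdot (d x) (classical_curl \<phi> x))"
      by (simp add: bounded_bilinear.zero_left[OF bounded_bilinear_bdot])
  qed
  from Hcurl_weak_curl(2)[OF L(1) L2_zero this] show "AE x in D. curl \<Omega> d x = 0" by simp
qed

end

section \<open>The surface curl and the control space\<close>

context polyhedral_domain
begin

definition rotated_gradient :: "(real^3 \<Rightarrow> real) \<Rightarrow> real^3 \<Rightarrow> complex^3" where
  "rotated_gradient \<phi> x = cvec (cross3 (surface_gradient \<Omega> \<phi> x) (normal \<Omega> x))"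

lemma H1_surface_L2:
  assumes "\<phi> \<in> H1_surface \<Omega>" shows "\<phi> \<in> L2 \<Gamma>" "rotated_gradient \<phi> \<in> L2 \<Gamma>"
proof -
  have G: "is_surface_gradient \<Omega> \<phi> (surface_gradient \<Omega> \<phi>)"
    using assms someI_ex[of "is_surface_gradient \<Omega> \<phi>"] unfolding surface_gradient_def H1_surface_def by simp
  then show "\<phi> \<in> L2 \<Gamma>" by (simp add: is_surface_gradient_def)
  have "surface_gradient \<Omega> \<phi> \<in> L2 \<Gamma>" using G by (simp add: is_surface_gradient_def)
  then show "rotated_gradient \<phi> \<in> L2 \<Gamma>"
    using normal_multiplier_L2[OF bounded_bilinear_cvec_cross] unfolding rotated_gradient_def[abs_def] by blast
qed

lemma is_surface_curl_iff:
  "is_surface_curl \<Omega> z c \<longleftrightarrow> (\<forall>\<phi>\<in>H1_surface \<Omega>.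
     (LINT x|\<Gamma>. c x * complex_of_real (\<phi> x)) = (LINT x|\<Gamma>. bdot (z x) (rotated_gradient \<phi> x)))"
  by (simp add: is_surface_curl_def rotated_gradient_def)

text \<open>The constant sequence approximates; it remains to see that the surface gradient is bounded and
measurable.\<close>

lemma smooth_H1_surface:
  assumes f: "smooth f" shows "f \<in> H1_surface \<Omega>"
proof -
  define G where "G = smooth_surface_gradient \<Omega> f"
  have part: "continuous_on UNIV (partial i f)" for i
    using f by (intro smooth_continuous smooth_partial)
  have grad: "continuous_on UNIV (gradient f)"
    unfolding gradient_def[abs_def] by (rule continuous_on_vec_lambda[OF part])
  obtain B where B: "\<And>x. x \<in> frontier \<Omega> \<Longrightarrow> norm (gradient f x) \<le> B"
    using bounded_on_frontier[OF grad] by blast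
  have G_L2: "G \<in> L2 \<Gamma>"
  proof (rule L2_bounded[OF finite_surface])
    have "gradient f \<in> borel_measurable \<Gamma>"
      by (rule borel_measurable_surface[OF borel_measurable_continuous_onI[OF grad]])
    with normal_measurable show "G \<in> borel_measurable \<Gamma>"
      unfolding G_def smooth_surface_gradient_def[abs_def] by measurable
    fix x assume "x \<in> space \<Gamma>"
    then have x: "norm (gradient f x) \<le> B" using B space_surface by simp
    have "norm (G x) \<le> norm (gradient f x) + \<bar>gradient f x \<bullet> normal \<Omega> x\<bar> * norm (normal \<Omega> x)"
      unfolding G_def smooth_surface_gradient_def by (rule order_trans[OF norm_triangle_ineq4]) simp
    also have "\<bar>gradient f x \<bullet> normal \<Omega> x\<bar> * norm (normal \<Omega> x) \<le> (norm (gradient f x) * norm (normal \<Omega> x)) * norm (normal \<Omega> x)"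
      by (intro mult_right_mono Cauchy_Schwarz_ineq2 norm_ge_zero)
    also have "\<dots> \<le> (norm (gradient f x) * 1) * 1"
      using norm_normal_le[of x] by (intro mult_mono norm_ge_zero mult_nonneg_nonneg) auto
    finally show "norm (G x) \<le> 2 * B" using x by simp
  qed
  have f_L2: "f \<in> L2 \<Gamma>" by (rule L2_continuous_surface[OF smooth_continuous[OF f]])
  have "is_surface_gradient \<Omega> f G"
    unfolding is_surface_gradient_def
    by (intro conjI f_L2 G_L2 exI[of _ "\<lambda>k. f"]) (simp_all add: f G_def L2_sq_def)
  then show ?thesis by (auto simp: H1_surface_def)
qed

text \<open>Pushed forward to the whole space, the surface measure is a finite Borel measure \<open>N\<close>. With \<open>c\<close> extended
by zero off the boundary, the argument with bump functions applies to all boxes.\<close>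

lemma AE_zero_of_smooth_surface_integrals:
  fixes c :: "real^3 \<Rightarrow> complex"
  assumes c: "c \<in> L2 \<Gamma>" and smooth: "\<And>f :: real^3 \<Rightarrow> real. smooth f \<Longrightarrow> (LINT x|\<Gamma>. f x *\<^sub>R c x) = 0"
  shows "AE x in \<Gamma>. c x = 0"
proof -
  define N where "N = distr \<Gamma> borel (\<lambda>x. x)"
  define c' where "c' x = indicator (frontier \<Omega>) x *\<^sub>R c x" for x
  have id: "(\<lambda>x. x) \<in> measurable \<Gamma> borel" by (rule borel_measurable_surface) simp
  have "c \<in> borel_measurable \<Gamma>" using c by (simp add: L2_iff)
  then have "c \<in> borel_measurable (restrict_space borel (frontier \<Omega>))"
    using measurable_cong_sets[OF sets_surface refl] by blast
  then have c'_meas: "c' \<in> borel_measurable borel"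
    using frontier_borel by (simp add: borel_measurable_restrict_space_iff c'_def[abs_def])
  have eq: "c' x = c x" if "x \<in> space \<Gamma>" for x using that by (simp add: c'_def space_surface)
  have "integrable \<Gamma> c" by (rule L2_integrable[OF finite_surface c])
  then have "integrable \<Gamma> c'" using eq by (simp cong: Bochner_Integration.integrable_cong)
  then have int: "integrable N c'"
    unfolding N_def by (simp add: integrable_distr_eq[OF id c'_meas])
  have N_borel: "borel_generated N" by (rule borel_generated_of_borel) (simp add: N_def)
  have "finite_measure N" unfolding N_def by (rule finite_measure.finite_measure_distr[OF finite_surface id])
  then have N_finite: "sigma_finite_measure N" by (simp add: finite_measure_def)
  have "AE x in N. c' x = 0"
  proof (rule AE_zero_of_box_integrals[OF N_finite N_borel int], rule box_integral_zero_of_bump_integrals[OF N_borel int])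
    fix n a b
    have cont: "continuous_on UNIV (bump n a b)" by (rule smooth_continuous[OF bump_smooth])
    have "(\<lambda>x. bump n a b x *\<^sub>R c' x) \<in> borel_measurable borel"
      by (rule borel_measurable_scaleR[OF borel_measurable_continuous_onI[OF cont] c'_meas])
    then have "(LINT x|N. bump n a b x *\<^sub>R c' x) = (LINT x|\<Gamma>. bump n a b x *\<^sub>R c' x)"
      unfolding N_def by (rule integral_distr[OF id])
    also have "\<dots> = (LINT x|\<Gamma>. bump n a b x *\<^sub>R c x)"
      by (rule Bochner_Integration.integral_cong) (simp_all add: eq)
    also have "\<dots> = 0" by (rule smooth[OF bump_smooth])
    finally show "(LINT x|N. bump n a b x *\<^sub>R c' x) = 0" .
  qed
  then have "AE x in \<Gamma>. c' x = 0"
    unfolding N_def by (subst (asm) AE_distr_iff[OF id]) (use c'_meas in measurable)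
  then show ?thesis by (rule AE_mp) (rule AE_I2, simp add: eq)
qed

lemma surface_curl_unique:
  assumes c: "c \<in> L2 \<Gamma>" "c' \<in> L2 \<Gamma>" and z: "is_surface_curl \<Omega> z c" "is_surface_curl \<Omega> z c'"
  shows "AE x in \<Gamma>. c x = c' x"
proof -
  have "AE x in \<Gamma>. (c - c') x = 0"
  proof (rule AE_zero_of_smooth_surface_integrals[OF L2_diff[OF c]])
    fix f :: "real^3 \<Rightarrow> real" assume "smooth f"
    then have f: "f \<in> H1_surface \<Omega>" by (rule smooth_H1_surface)
    note int = L2_bilinear_integrable[OF bounded_bilinear_of_real_mult _ H1_surface_L2(1)[OF f]]
    have "(LINT x|\<Gamma>. f x *\<^sub>R (c - c') x) = (LINT x|\<Gamma>. c x * complex_of_real (f x) - c' x * complex_of_real (f x))"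
      by (simp add: scaleR_conv_of_real algebra_simps)
    also have "\<dots> = (LINT x|\<Gamma>. c x * complex_of_real (f x)) - (LINT x|\<Gamma>. c' x * complex_of_real (f x))"
      by (rule Bochner_Integration.integral_diff[OF int[OF c(1)] int[OF c(2)]])
    also have "\<dots> = 0" using z f by (simp add: is_surface_curl_iff)
    finally show "(LINT x|\<Gamma>. f x *\<^sub>R (c - c') x) = 0" .
  qed
  then show ?thesis by simp
qed

lemma is_surface_curl_add:
  assumes "z \<in> L2 \<Gamma>" "z' \<in> L2 \<Gamma>" "c \<in> L2 \<Gamma>" "c' \<in> L2 \<Gamma>" "is_surface_curl \<Omega> z c" "is_surface_curl \<Omega> z' c'"
  shows "is_surface_curl \<Omega> (z + z') (c + c')"
  unfolding is_surface_curl_iff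
proof
  fix \<phi> assume \<phi>: "\<phi> \<in> H1_surface \<Omega>"
  show "(LINT x|\<Gamma>. (c + c') x * complex_of_real (\<phi> x)) = (LINT x|\<Gamma>. bdot ((z + z') x) (rotated_gradient \<phi> x))"
    unfolding L2_bilinear_add[OF bounded_bilinear_of_real_mult assms(3,4) H1_surface_L2(1)[OF \<phi>]]
      L2_bilinear_add[OF bounded_bilinear_bdot assms(1,2) H1_surface_L2(2)[OF \<phi>]]
    using assms(5,6) \<phi> by (simp add: is_surface_curl_iff)
qed

lemma is_surface_curl_scaleR:
  assumes "is_surface_curl \<Omega> z c"
  shows "is_surface_curl \<Omega> (r *\<^sub>R z) (r *\<^sub>R c)"
  unfolding is_surface_curl_iff L2_bilinear_scaleR[OF bounded_bilinear_of_real_mult] L2_bilinear_scaleR[OF bounded_bilinear_bdot]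
  using assms by (simp add: is_surface_curl_iff)

lemma is_surface_curl_limit:
  assumes z: "\<And>n. z n \<in> L2 \<Gamma>" "z0 \<in> L2 \<Gamma>" "(\<lambda>n. l2norm \<Gamma> (z n - z0)) \<longlonglongrightarrow> 0"
    and c: "\<And>n. c n \<in> L2 \<Gamma>" "c0 \<in> L2 \<Gamma>" "(\<lambda>n. l2norm \<Gamma> (c n - c0)) \<longlonglongrightarrow> 0"
    and curl: "\<And>n. is_surface_curl \<Omega> (z n) (c n)"
  shows "is_surface_curl \<Omega> z0 c0"
  unfolding is_surface_curl_iff
proof
  fix \<phi> assume \<phi>: "\<phi> \<in> H1_surface \<Omega>"
  have "(\<lambda>n. LINT x|\<Gamma>. c n x * complex_of_real (\<phi> x)) \<longlonglongrightarrow> (LINT x|\<Gamma>. c0 x * complex_of_real (\<phi> x))"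
    by (rule L2_bilinear_tendsto[OF bounded_bilinear_of_real_mult c(1,2) H1_surface_L2(1)[OF \<phi>] c(3)])
  moreover have "(\<lambda>n. LINT x|\<Gamma>. bdot (z n x) (rotated_gradient \<phi> x)) \<longlonglongrightarrow> (LINT x|\<Gamma>. bdot (z0 x) (rotated_gradient \<phi> x))"
    by (rule L2_bilinear_tendsto[OF bounded_bilinear_bdot z(1,2) H1_surface_L2(2)[OF \<phi>] z(3)])
  moreover have "(\<lambda>n. LINT x|\<Gamma>. c n x * complex_of_real (\<phi> x)) = (\<lambda>n. LINT x|\<Gamma>. bdot (z n x) (rotated_gradient \<phi> x))"
    using curl \<phi> by (simp add: is_surface_curl_iff)
  ultimately show "(LINT x|\<Gamma>. c0 x * complex_of_real (\<phi> x)) = (LINT x|\<Gamma>. bdot (z0 x) (rotated_gradient \<phi> x))"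
    using LIMSEQ_unique by simp
qed

lemma one_L2: "(\<lambda>x. 1 :: real) \<in> L2 \<Gamma>"
  by (rule L2_continuous_surface) simp

text \<open>Membership in the control space can be decided with any representative of the surface curl.\<close>

lemma control_space_iff:
  assumes "z \<in> L2 \<Gamma>" "c \<in> L2 \<Gamma>" "is_surface_curl \<Omega> z c"
  shows "AE x in \<Gamma>. surface_curl \<Omega> z x = c x"
    "z \<in> control_space \<Omega> \<longleftrightarrow> (AE x in \<Gamma>. bdot (z x) (cvec (normal \<Omega> x)) = 0) \<and> (LINT x|\<Gamma>. c x) = 0"
proof -
  have "surface_curl \<Omega> z \<in> L2 \<Gamma> \<and> is_surface_curl \<Omega> z (surface_curl \<Omega> z)"
    unfolding surface_curl_def by (rule someI[of "\<lambda>c. c \<in> L2 \<Gamma> \<and> is_surface_curl \<Omega> z c" c]) (simp add: assms)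
  then have sc: "surface_curl \<Omega> z \<in> L2 \<Gamma>" "is_surface_curl \<Omega> z (surface_curl \<Omega> z)" by auto
  show eq: "AE x in \<Gamma>. surface_curl \<Omega> z x = c x" by (rule surface_curl_unique[OF sc(1) assms(2) sc(2) assms(3)])
  have "(LINT x|\<Gamma>. surface_curl \<Omega> z x) = (LINT x|\<Gamma>. c x)"
    using eq sc(1) assms(2) by (intro integral_cong_AE) (auto simp: L2_iff)
  then show "z \<in> control_space \<Omega> \<longleftrightarrow> (AE x in \<Gamma>. bdot (z x) (cvec (normal \<Omega> x)) = 0) \<and> (LINT x|\<Gamma>. c x) = 0"
    using assms unfolding control_space_def Hcurl_surface_def L2t_def by auto
qed

lemma control_spaceD:
  assumes "z \<in> control_space \<Omega>"
  shows "z \<in> L2 \<Gamma>" "surface_curl \<Omega> z \<in> L2 \<Gamma>" "is_surface_curl \<Omega> z (surface_curl \<Omega> z)"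
    "AE x in \<Gamma>. bdot (z x) (cvec (normal \<Omega> x)) = 0" "(LINT x|\<Gamma>. surface_curl \<Omega> z x) = 0"
proof -
  show "z \<in> L2 \<Gamma>" "AE x in \<Gamma>. bdot (z x) (cvec (normal \<Omega> x)) = 0" "(LINT x|\<Gamma>. surface_curl \<Omega> z x) = 0"
    using assms by (auto simp: control_space_def Hcurl_surface_def L2t_def)
  have "\<exists>c. c \<in> L2 \<Gamma> \<and> is_surface_curl \<Omega> z c"
    using assms by (auto simp: control_space_def Hcurl_surface_def)
  from someI_ex[OF this] show "surface_curl \<Omega> z \<in> L2 \<Gamma>" "is_surface_curl \<Omega> z (surface_curl \<Omega> z)"
    by (auto simp: surface_curl_def)
qed

lemma control_space_add:
  assumes z: "z \<in> control_space \<Omega>" "z' \<in> control_space \<Omega>"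
  shows "z + z' \<in> control_space \<Omega>" "AE x in \<Gamma>. surface_curl \<Omega> (z + z') x = (surface_curl \<Omega> z + surface_curl \<Omega> z') x"
proof -
  note Z = control_spaceD[OF z(1)] and Z' = control_spaceD[OF z(2)]
  note c = control_space_iff[OF L2_add[OF Z(1) Z'(1)] L2_add[OF Z(2) Z'(2)] is_surface_curl_add[OF Z(1) Z'(1) Z(2) Z'(2) Z(3) Z'(3)]]
  show "AE x in \<Gamma>. surface_curl \<Omega> (z + z') x = (surface_curl \<Omega> z + surface_curl \<Omega> z') x" by (rule c(1))
  have "AE x in \<Gamma>. bdot ((z + z') x) (cvec (normal \<Omega> x)) = 0"
    using Z(4) Z'(4) by eventually_elim (simp add: bounded_bilinear.add_left[OF bounded_bilinear_bdot])
  moreover have "(LINT x|\<Gamma>. (surface_curl \<Omega> z + surface_curl \<Omega> z') x) = 0"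
    using Z(5) Z'(5) L2_integrable[OF finite_surface Z(2)] L2_integrable[OF finite_surface Z'(2)] by simp
  ultimately show "z + z' \<in> control_space \<Omega>" using c(2) by blast
qed

lemma control_space_scaleR:
  assumes z: "z \<in> control_space \<Omega>"
  shows "r *\<^sub>R z \<in> control_space \<Omega>" "AE x in \<Gamma>. surface_curl \<Omega> (r *\<^sub>R z) x = (r *\<^sub>R surface_curl \<Omega> z) x"
proof -
  note Z = control_spaceD[OF z]
  note c = control_space_iff[OF L2_scaleR[OF Z(1)] L2_scaleR[OF Z(2)] is_surface_curl_scaleR[OF Z(3)], of r]
  show "AE x in \<Gamma>. surface_curl \<Omega> (r *\<^sub>R z) x = (r *\<^sub>R surface_curl \<Omega> z) x" by (rule c(1))
  have "AE x in \<Gamma>. bdot ((r *\<^sub>R z) x) (cvec (normal \<Omega> x)) = 0"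
    using Z(4) by eventually_elim (simp add: bounded_bilinear.scaleR_left[OF bounded_bilinear_bdot])
  moreover have "(LINT x|\<Gamma>. (r *\<^sub>R surface_curl \<Omega> z) x) = 0" using Z(5) by simp
  ultimately show "r *\<^sub>R z \<in> control_space \<Omega>" using c(2) by blast
qed

lemma zero_control_space: "0 \<in> control_space \<Omega>"
proof -
  have "is_surface_curl \<Omega> 0 0"
    by (simp add: is_surface_curl_iff bounded_bilinear.zero_left[OF bounded_bilinear_bdot])
  from control_space_iff(2)[OF L2_zero L2_zero this] show ?thesis
    by (simp add: bounded_bilinear.zero_left[OF bounded_bilinear_bdot])
qed

text \<open>The three defining conditions, namely the weak identity for the surface curl, tangentiality and the
vanishing mean, are expressed by continuous linear maps on \<open>L\<^sup>2(\<Gamma>)\<close>.\<close>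

lemma control_space_limit:
  assumes Z: "\<And>n. z n \<in> control_space \<Omega>"
    and z0: "z0 \<in> L2 \<Gamma>" "(\<lambda>n. l2norm \<Gamma> (z n - z0)) \<longlonglongrightarrow> 0"
    and c0: "c0 \<in> L2 \<Gamma>" "(\<lambda>n. l2norm \<Gamma> (surface_curl \<Omega> (z n) - c0)) \<longlonglongrightarrow> 0"
  shows "z0 \<in> control_space \<Omega>" "AE x in \<Gamma>. surface_curl \<Omega> z0 x = c0 x"
proof -
  note Zn = control_spaceD[OF Z]
  note c = control_space_iff[OF z0(1) c0(1) is_surface_curl_limit[OF Zn(1) z0 Zn(2) c0 Zn(3)]]
  show "AE x in \<Gamma>. surface_curl \<Omega> z0 x = c0 x" by (rule c(1))
  obtain K where K: "\<forall>v\<in>L2 \<Gamma>. (\<lambda>x. bdot (v x) (cvec (normal \<Omega> x))) \<in> L2 \<Gamma> \<and>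
      l2norm \<Gamma> (\<lambda>x. bdot (v x) (cvec (normal \<Omega> x))) \<le> K * l2norm \<Gamma> v"
    using normal_multiplier_L2[OF bounded_bilinear_bdot_cvec] by blast
  define T where "T v = (\<lambda>x. bdot (v x) (cvec (normal \<Omega> x)))" for v
  have T: "T v \<in> L2 \<Gamma>" "l2norm \<Gamma> (T v) \<le> K * l2norm \<Gamma> v" if "v \<in> L2 \<Gamma>" for v
    using bspec[OF K that] by (auto simp: T_def)
  have "l2norm \<Gamma> (T z0) \<le> K * l2norm \<Gamma> (z n - z0)" for n
  proof -
    have "AE x in \<Gamma>. T z0 x = ((-1) *\<^sub>R T (z n - z0)) x"
      using Zn(4)[of n] by eventually_elim (simp add: T_def bounded_bilinear.diff_left[OF bounded_bilinear_bdot])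
    then have "l2norm \<Gamma> (T z0) = l2norm \<Gamma> ((-1) *\<^sub>R T (z n - z0))"
      by (rule l2norm_cong_AE[OF _ T(1)[OF z0(1)] L2_scaleR[OF T(1)[OF L2_diff[OF Zn(1) z0(1)]]]])
    also have "\<dots> = l2norm \<Gamma> (T (z n - z0))" using l2norm_scaleR[of \<Gamma> "-1" "T (z n - z0)"] by simp
    also have "\<dots> \<le> K * l2norm \<Gamma> (z n - z0)" by (rule T(2)[OF L2_diff[OF Zn(1) z0(1)]])
    finally show ?thesis .
  qed
  then have "l2norm \<Gamma> (T z0) \<le> 0"
    using LIMSEQ_le_const[OF tendsto_mult_right_zero[OF z0(2), of K]] by blast
  then have "l2norm \<Gamma> (T z0) = 0" using l2norm_nonneg[of \<Gamma> "T z0"] by linarith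
  then have tangential: "AE x in \<Gamma>. bdot (z0 x) (cvec (normal \<Omega> x)) = 0"
    using l2norm_eq_0_iff[OF T(1)[OF z0(1)]] by (simp add: T_def)
  have "(\<lambda>n. LINT x|\<Gamma>. surface_curl \<Omega> (z n) x * complex_of_real 1) \<longlonglongrightarrow> (LINT x|\<Gamma>. c0 x * complex_of_real 1)"
    by (rule L2_bilinear_tendsto[OF bounded_bilinear_of_real_mult Zn(2) c0(1) one_L2 c0(2)])
  then have "(LINT x|\<Gamma>. c0 x) = 0" using Zn(5) by (simp add: LIMSEQ_const_iff)
  with tangential show "z0 \<in> control_space \<Omega>" using c(2) by blast
qed

definition control_norm :: "(real^3 \<Rightarrow> complex^3) \<Rightarrow> real" where
  "control_norm z = l2norm \<Gamma> z + l2norm \<Gamma> (surface_curl \<Omega> z)"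

lemma control_space_diff:
  assumes z: "z \<in> control_space \<Omega>" "z' \<in> control_space \<Omega>"
  shows "z - z' \<in> control_space \<Omega>"
    "l2norm \<Gamma> (surface_curl \<Omega> (z - z')) = l2norm \<Gamma> (surface_curl \<Omega> z - surface_curl \<Omega> z')"
proof -
  note n = control_space_scaleR[OF z(2), of "-1"]
  note s = control_space_add[OF z(1) n(1)]
  show d: "z - z' \<in> control_space \<Omega>" using s(1) by simp
  have "AE x in \<Gamma>. surface_curl \<Omega> (z - z') x = (surface_curl \<Omega> z - surface_curl \<Omega> z') x"
    using s(2) n(2) by eventually_elim simp
  then show "l2norm \<Gamma> (surface_curl \<Omega> (z - z')) = l2norm \<Gamma> (surface_curl \<Omega> z - surface_curl \<Omega> z')"
    by (rule l2norm_cong_AE[OF _ control_spaceD(2)[OF d] L2_diff[OF control_spaceD(2)[OF z(1)] control_spaceD(2)[OF z(2)]]])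
qed

lemma control_norm_complete: "complete_seminorm_on (control_space \<Omega>) control_norm"
proof
  show "subspace (control_space \<Omega>)"
    using zero_control_space control_space_add(1) control_space_scaleR(1) by (auto simp: subspace_def)
next
  fix z z' assume z: "z \<in> control_space \<Omega>" "z' \<in> control_space \<Omega>"
  note Z = control_spaceD[OF z(1)] and Z' = control_spaceD[OF z(2)]
  have "l2norm \<Gamma> (surface_curl \<Omega> (z + z')) = l2norm \<Gamma> (surface_curl \<Omega> z + surface_curl \<Omega> z')"
    by (rule l2norm_cong_AE[OF control_space_add(2)[OF z] control_spaceD(2)[OF control_space_add(1)[OF z]] L2_add[OF Z(2) Z'(2)]])
  then show "control_norm (z + z') \<le> control_norm z + control_norm z'"
    using l2norm_triangle[OF Z(1) Z'(1)] l2norm_triangle[OF Z(2) Z'(2)] unfolding control_norm_def by linarith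
next
  fix z r assume z: "z \<in> control_space \<Omega>"
  have "l2norm \<Gamma> (surface_curl \<Omega> (r *\<^sub>R z)) = l2norm \<Gamma> (r *\<^sub>R surface_curl \<Omega> z)"
    by (rule l2norm_cong_AE[OF control_space_scaleR(2)[OF z] control_spaceD(2)[OF control_space_scaleR(1)[OF z]] L2_scaleR[OF control_spaceD(2)[OF z]]])
  then show "control_norm (r *\<^sub>R z) = \<bar>r\<bar> * control_norm z"
    by (simp only: control_norm_def l2norm_scaleR distrib_left)
next
  fix z :: "nat \<Rightarrow> real^3 \<Rightarrow> complex^3"
  assume z: "\<And>n. z n \<in> control_space \<Omega>"
    and Cauchy: "\<And>e. e > 0 \<Longrightarrow> \<exists>n0. \<forall>m\<ge>n0. \<forall>n\<ge>n0. control_norm (z m - z n) < e"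
  note Z = control_spaceD[OF z]
  have split: "control_norm (z m - z n) = l2norm \<Gamma> (z m - z n) + l2norm \<Gamma> (surface_curl \<Omega> (z m) - surface_curl \<Omega> (z n))" for m n
    unfolding control_norm_def using control_space_diff(2)[OF z z, of m n] by simp
  have le: "l2norm \<Gamma> (z m - z n) \<le> control_norm (z m - z n)"
    "l2norm \<Gamma> (surface_curl \<Omega> (z m) - surface_curl \<Omega> (z n)) \<le> control_norm (z m - z n)" for m n
    unfolding split by simp_all
  have "\<exists>z0\<in>L2 \<Gamma>. (\<lambda>n. l2norm \<Gamma> (z n - z0)) \<longlonglongrightarrow> 0"
  proof (rule L2_complete[OF Z(1)])
    fix e :: real assume "e > 0"
    then obtain n0 where "\<forall>m\<ge>n0. \<forall>n\<ge>n0. control_norm (z m - z n) < e" using Cauchy by blast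
    then show "\<exists>n0. \<forall>m\<ge>n0. \<forall>n\<ge>n0. l2norm \<Gamma> (z m - z n) < e"
      using le_less_trans[OF le(1)] by blast
  qed
  then obtain z0 where z0: "z0 \<in> L2 \<Gamma>" "(\<lambda>n. l2norm \<Gamma> (z n - z0)) \<longlonglongrightarrow> 0" by blast
  have "\<exists>c0\<in>L2 \<Gamma>. (\<lambda>n. l2norm \<Gamma> (surface_curl \<Omega> (z n) - c0)) \<longlonglongrightarrow> 0"
  proof (rule L2_complete[OF Z(2)])
    fix e :: real assume "e > 0"
    then obtain n0 where "\<forall>m\<ge>n0. \<forall>n\<ge>n0. control_norm (z m - z n) < e" using Cauchy by blast
    then show "\<exists>n0. \<forall>m\<ge>n0. \<forall>n\<ge>n0. l2norm \<Gamma> (surface_curl \<Omega> (z m) - surface_curl \<Omega> (z n)) < e"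
      using le_less_trans[OF le(2)] by blast
  qed
  then obtain c0 where c0: "c0 \<in> L2 \<Gamma>" "(\<lambda>n. l2norm \<Gamma> (surface_curl \<Omega> (z n) - c0)) \<longlonglongrightarrow> 0" by blast
  note lim = control_space_limit[OF z z0 c0]
  have "l2norm \<Gamma> (surface_curl \<Omega> (z n - z0)) = l2norm \<Gamma> (surface_curl \<Omega> (z n) - c0)" for n
    using control_space_diff(2)[OF z lim(1), of n] l2norm_diff_cong[OF lim(2) Z(2) control_spaceD(2)[OF lim(1)] c0(1), of n] by simp
  then have "(\<lambda>n. control_norm (z n - z0)) \<longlonglongrightarrow> 0"
    using tendsto_add[OF z0(2) c0(2)] by (simp add: control_norm_def)
  with lim(1) show "\<exists>y\<in>control_space \<Omega>. (\<lambda>n. control_norm (z n - y)) \<longlonglongrightarrow> 0" by blast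
qed

end

section \<open>Continuity of the control-to-state map\<close>

context polyhedral_domain
begin

definition Hcurl_norm :: "(real^3 \<Rightarrow> complex^3) \<Rightarrow> real" where
  "Hcurl_norm u = l2norm D u + l2norm D (curl \<Omega> u)"

lemma Hcurl_norm_add:
  assumes u: "u \<in> Hcurl \<Omega>" "u' \<in> Hcurl \<Omega>"
  shows "Hcurl_norm (u + u') \<le> Hcurl_norm u + Hcurl_norm u'"
proof -
  note L = Hcurl_L2[OF u(1)] Hcurl_L2[OF u(2)] curl_of_Hcurl(1)[OF u(1)] curl_of_Hcurl(1)[OF u(2)]
  have "l2norm D (curl \<Omega> (u + u')) = l2norm D (curl \<Omega> u + curl \<Omega> u')"
    by (rule l2norm_cong_AE[OF Hcurl_add(2)[OF u] curl_of_Hcurl(1)[OF Hcurl_add(1)[OF u]] L2_add[OF L(3,4)]])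
  then show ?thesis
    using l2norm_triangle[OF L(1,2)] l2norm_triangle[OF L(3,4)] unfolding Hcurl_norm_def by linarith
qed

lemma Hcurl_norm_scaleR:
  assumes u: "u \<in> Hcurl \<Omega>"
  shows "Hcurl_norm (r *\<^sub>R u) = \<bar>r\<bar> * Hcurl_norm u"
proof -
  have "l2norm D (curl \<Omega> (r *\<^sub>R u)) = l2norm D (r *\<^sub>R curl \<Omega> u)"
    by (rule l2norm_cong_AE[OF Hcurl_scaleR(2)[OF u] curl_of_Hcurl(1)[OF Hcurl_scaleR(1)[OF u]] L2_scaleR[OF curl_of_Hcurl(1)[OF u]]])
  then show ?thesis by (simp only: Hcurl_norm_def l2norm_scaleR distrib_left)
qed

lemma Hcurl_diff_AE:
  assumes u: "u \<in> Hcurl \<Omega>" "u' \<in> Hcurl \<Omega>"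
  shows "AE x in D. curl \<Omega> (u - u') x = curl \<Omega> u x - curl \<Omega> u' x"
  using Hcurl_add(2)[OF u(1) Hcurl_scaleR(1)[OF u(2), of "-1"]] Hcurl_scaleR(2)[OF u(2), of "-1"]
  by eventually_elim simp

end

context eddy_current
begin

lemma state_unique:
  assumes s: "state jc z u" "state jc z u'" and jc: "jc \<in> L2 D" and z: "z \<in> L2 \<Gamma>"
  shows "AE x in D. u x = u' x" "AE x in D. curl \<Omega> u x = curl \<Omega> u' x"
proof -
  have "state 0 0 (u - u')"
    using is_state_diff[OF s jc jc z z] by simp
  note h = homogeneous_state_zero[OF this]
  show "AE x in D. u x = u' x" using h(1) by simp
  show "AE x in D. curl \<Omega> u x = curl \<Omega> u' x"
    using h(2) Hcurl_diff_AE[OF s(1)[THEN is_state_Hcurl] s(2)[THEN is_state_Hcurl]] by eventually_elim simp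
qed

lemma Hcurl_norm_state_unique:
  assumes s: "state jc z u" "state jc z u'" and jc: "jc \<in> L2 D" and z: "z \<in> L2 \<Gamma>"
  shows "Hcurl_norm u = Hcurl_norm u'"
proof -
  note u = s(1)[THEN is_state_Hcurl] s(2)[THEN is_state_Hcurl]
  show ?thesis
    unfolding Hcurl_norm_def
    using l2norm_cong_AE[OF state_unique(1)[OF s jc z] Hcurl_L2[OF u(1)] Hcurl_L2[OF u(2)]]
      l2norm_cong_AE[OF state_unique(2)[OF s jc z] curl_of_Hcurl(1)[OF u(1)] curl_of_Hcurl(1)[OF u(2)]] by simp
qed

text \<open>Both the partial sums of the states and those of their curls converge in \<open>L\<^sup>2\<close>, so the limit is a
state by closedness.\<close>

lemma homogeneous_state_series:
  assumes s: "\<And>n :: nat. state 0 (z n) (u n)"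
    and z: "\<And>n. z n \<in> L2 \<Gamma>" "y \<in> L2 \<Gamma>" "(\<lambda>n. l2norm \<Gamma> ((\<Sum>k<n. z k) - y)) \<longlonglongrightarrow> 0"
    and sm: "summable (\<lambda>n. Hcurl_norm (u n))"
  shows "\<exists>u0. state 0 y u0 \<and> Hcurl_norm u0 \<le> (\<Sum>n. Hcurl_norm (u n))"
proof -
  have u: "u n \<in> Hcurl \<Omega>" for n by (rule is_state_Hcurl[OF s])
  note L = Hcurl_L2[OF u] curl_of_Hcurl(1)[OF u]
  have sm1: "summable (\<lambda>n. l2norm D (u n))"
    by (rule summable_comparison_test'[OF sm, of 0]) (simp add: Hcurl_norm_def)
  have sm2: "summable (\<lambda>n. l2norm D (curl \<Omega> (u n)))"
    by (rule summable_comparison_test'[OF sm, of 0]) (simp add: Hcurl_norm_def)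
  obtain u0 where u0: "u0 \<in> L2 D" "(\<lambda>n. l2norm D ((\<Sum>k<n. u k) - u0)) \<longlonglongrightarrow> 0" "l2norm D u0 \<le> (\<Sum>n. l2norm D (u n))"
    using L2_series[OF L(1) sm1] by blast
  obtain w0 where w0: "w0 \<in> L2 D" "(\<lambda>n. l2norm D ((\<Sum>k<n. curl \<Omega> (u k)) - w0)) \<longlonglongrightarrow> 0" "l2norm D w0 \<le> (\<Sum>n. l2norm D (curl \<Omega> (u n)))"
    using L2_series[OF L(2) sm2] by blast
  have partial: "state 0 (\<Sum>k<n. z k) (\<Sum>k<n. u k) \<and>
      (AE x in D. curl \<Omega> (\<Sum>k<n. u k) x = (\<Sum>k<n. curl \<Omega> (u k)) x)" for n
  proof (induction n)
    case 0
    have zero: "state 0 0 0"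
      using is_state_scaleR[OF s[of 0] L2_zero z(1), of 0] by simp
    have "AE x in D. curl \<Omega> 0 x = 0 x"
      using homogeneous_state_zero(2)[OF zero] by (rule eventually_mono) (simp only: zero_fun_def)
    with zero show ?case unfolding lessThan_0 sum.empty by (rule conjI)
  next
    case (Suc n)
    have zS: "(\<Sum>k<n. z k) \<in> L2 \<Gamma>" using z(1) by (rule L2_sum)
    have "state (0 + 0) ((\<Sum>k<n. z k) + z n) ((\<Sum>k<n. u k) + u n)"
      by (rule is_state_add[OF conjunct1[OF Suc] s L2_zero L2_zero zS z(1)])
    moreover have "AE x in D. curl \<Omega> ((\<Sum>k<n. u k) + u n) x = ((\<Sum>k<n. curl \<Omega> (u k)) + curl \<Omega> (u n)) x"
      using Hcurl_add(2)[OF is_state_Hcurl[OF conjunct1[OF Suc]] u[of n]] conjunct2[OF Suc] by eventually_elim simp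
    ultimately show ?case by (simp only: sum.lessThan_Suc add_0_left)
  qed
  have S_L2: "(\<Sum>k<n. curl \<Omega> (u k)) \<in> L2 D" for n using L(2) by (rule L2_sum)
  have "l2norm D (curl \<Omega> (\<Sum>k<n. u k) - w0) = l2norm D ((\<Sum>k<n. curl \<Omega> (u k)) - w0)" for n
    using l2norm_diff_cong[OF conjunct2[OF partial] w0(1) curl_of_Hcurl(1)[OF is_state_Hcurl[OF conjunct1[OF partial]]] S_L2, of n]
      l2norm_diff_commute[of D] by metis
  then have w0': "(\<lambda>n. l2norm D (curl \<Omega> (\<Sum>k<n. u k) - w0)) \<longlonglongrightarrow> 0" using w0(2) by simp
  have zS: "(\<Sum>k<n. z k) \<in> L2 \<Gamma>" for n using z(1) by (rule L2_sum)
  note lim = is_state_limit[OF conjunct1[OF partial] zS z(2,3) u0(1,2) w0(1) w0']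
  have "l2norm D (curl \<Omega> u0) = l2norm D w0"
    by (rule l2norm_cong_AE[OF lim(2) curl_of_Hcurl(1)[OF is_state_Hcurl[OF lim(1)]] w0(1)])
  then have "Hcurl_norm u0 \<le> (\<Sum>n. l2norm D (u n)) + (\<Sum>n. l2norm D (curl \<Omega> (u n)))"
    using u0(3) w0(3) by (simp add: Hcurl_norm_def)
  also have "\<dots> = (\<Sum>n. Hcurl_norm (u n))"
    unfolding Hcurl_norm_def by (rule suminf_add[OF sm1 sm2])
  finally show ?thesis using lim(1) by blast
qed

text \<open>The closed graph argument. The map \<open>R\<close> picks one of the states belonging to a control; these
differ on null sets only, so the H(curl) norm of \<open>R z\<close> does not depend on the choice and is a
seminorm in \<open>z\<close>.\<close>

lemma response_bounded:
  assumes R: "\<And>z. z \<in> control_space \<Omega> \<Longrightarrow> state 0 z (R z)"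
  shows "\<exists>C\<ge>0. \<forall>z\<in>control_space \<Omega>. Hcurl_norm (R z) \<le> C * control_norm z"
proof -
  interpret Z: complete_seminorm_on "control_space \<Omega>" control_norm by (rule control_norm_complete)
  note zero = L2_zero[of D]
  have R_Hcurl: "R z \<in> Hcurl \<Omega>" if "z \<in> control_space \<Omega>" for z by (rule is_state_Hcurl[OF R[OF that]])
  show ?thesis
  proof (rule Z.Zabreiko)
    show "seminorm_on (control_space \<Omega>) (\<lambda>z. Hcurl_norm (R z))"
    proof
      show "subspace (control_space \<Omega>)" by (rule Z.subspace)
    next
      fix z z' assume z: "z \<in> control_space \<Omega>" "z' \<in> control_space \<Omega>"
      have "state (0 + 0) (z + z') (R z + R z')"
        by (rule is_state_add[OF R[OF z(1)] R[OF z(2)] zero zero control_spaceD(1)[OF z(1)] control_spaceD(1)[OF z(2)]])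
      then have "state 0 (z + z') (R z + R z')" by simp
      then have "Hcurl_norm (R (z + z')) = Hcurl_norm (R z + R z')"
        by (rule Hcurl_norm_state_unique[OF R[OF control_space_add(1)[OF z]] _ zero control_spaceD(1)[OF control_space_add(1)[OF z]]])
      also have "\<dots> \<le> Hcurl_norm (R z) + Hcurl_norm (R z')" by (rule Hcurl_norm_add[OF z[THEN R_Hcurl]])
      finally show "Hcurl_norm (R (z + z')) \<le> Hcurl_norm (R z) + Hcurl_norm (R z')" .
    next
      fix z r assume z: "z \<in> control_space \<Omega>"
      have "state 0 (r *\<^sub>R z) (r *\<^sub>R R z)" using is_state_scaleR[OF R[OF z] L2_zero control_spaceD(1)[OF z], of r] by simp
      then have "Hcurl_norm (R (r *\<^sub>R z)) = Hcurl_norm (r *\<^sub>R R z)"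
        by (rule Hcurl_norm_state_unique[OF R[OF control_space_scaleR(1)[OF z]] _ zero control_spaceD(1)[OF control_space_scaleR(1)[OF z]]])
      also have "\<dots> = \<bar>r\<bar> * Hcurl_norm (R z)" by (rule Hcurl_norm_scaleR[OF R_Hcurl[OF z]])
      finally show "Hcurl_norm (R (r *\<^sub>R z)) = \<bar>r\<bar> * Hcurl_norm (R z)" .
    qed
  next
    fix z :: "nat \<Rightarrow> real^3 \<Rightarrow> complex^3" and y
    assume z: "\<And>n. z n \<in> control_space \<Omega>" and y: "y \<in> control_space \<Omega>"
      and lim: "(\<lambda>n. control_norm ((\<Sum>k<n. z k) - y)) \<longlonglongrightarrow> 0" and sm: "summable (\<lambda>n. Hcurl_norm (R (z n)))"
    have "(\<lambda>n. l2norm \<Gamma> ((\<Sum>k<n. z k) - y)) \<longlonglongrightarrow> 0"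
      by (rule tendsto_sandwich[OF always_eventually always_eventually tendsto_const lim]) (simp_all add: control_norm_def)
    from homogeneous_state_series[OF R[OF z] control_spaceD(1)[OF z] control_spaceD(1)[OF y] this sm]
    obtain u0 where u0: "state 0 y u0" "Hcurl_norm u0 \<le> (\<Sum>n. Hcurl_norm (R (z n)))" by blast
    have "Hcurl_norm (R y) = Hcurl_norm u0"
      by (rule Hcurl_norm_state_unique[OF R[OF y] u0(1) zero control_spaceD(1)[OF y]])
    with u0(2) show "Hcurl_norm (R y) \<le> (\<Sum>n. Hcurl_norm (R (z n)))" by simp
  qed
qed

text \<open>The difference of two states responds to the difference of the controls without source, and
\<open>S z - S 0\<close> is such a response for every control \<open>z\<close>.\<close>

lemma control_to_state_lipschitz:
  assumes S: "control_to_state_map \<Omega> \<mu> \<kappa> \<omega> jc S" and jc: "jc \<in> L2 D"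
  shows "\<exists>C\<ge>0. \<forall>z\<in>control_space \<Omega>. \<forall>z'\<in>control_space \<Omega>. l2norm D (S z - S z') \<le> C * control_norm (z - z')"
proof -
  have S_state: "state jc z (S z)" if "z \<in> control_space \<Omega>" for z
    using S that by (simp add: control_to_state_map_def)
  define R where "R z = S z - S 0" for z
  have R: "state 0 z (R z)" if z: "z \<in> control_space \<Omega>" for z
    using is_state_diff[OF S_state[OF z] S_state[OF zero_control_space] jc jc control_spaceD(1)[OF z] L2_zero] by (simp add: R_def)
  obtain C where C: "C \<ge> 0" "\<forall>z\<in>control_space \<Omega>. Hcurl_norm (R z) \<le> C * control_norm z"
    using response_bounded[of R, OF R] by blast
  have "l2norm D (S z - S z') \<le> C * control_norm (z - z')" if z: "z \<in> control_space \<Omega>" "z' \<in> control_space \<Omega>" for z z'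
  proof -
    note d = control_space_diff(1)[OF z]
    have "state 0 (z - z') (S z - S z')"
      using is_state_diff[OF S_state[OF z(1)] S_state[OF z(2)] jc jc control_spaceD(1)[OF z(1)] control_spaceD(1)[OF z(2)]] by simp
    then have "Hcurl_norm (S z - S z') = Hcurl_norm (R (z - z'))"
      by (rule Hcurl_norm_state_unique[OF _ R[OF d] L2_zero control_spaceD(1)[OF d]])
    also have "\<dots> \<le> C * control_norm (z - z')" using C(2) d by blast
    finally show ?thesis using l2norm_nonneg[of D "curl \<Omega> (S z - S z')"] unfolding Hcurl_norm_def by linarith
  qed
  with C(1) show ?thesis by blast
qed

end

section \<open>The optimal control\<close>

theorem theorem3p1:
  fixes \<Omega> :: "(real^3) set"
    and \<mu> \<kappa> :: "real^3 \<Rightarrow> real^3^3"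
    and \<omega> \<alpha> \<beta> :: real
    and jc ud :: "real^3 \<Rightarrow> complex^3"
    and S :: "(real^3 \<Rightarrow> complex^3) \<Rightarrow> real^3 \<Rightarrow> complex^3"
  assumes "lipschitz_polyhedron \<Omega>"
    and "material_tensor \<Omega> \<mu>" and "material_tensor \<Omega> \<kappa>"
    and "\<omega> \<noteq> 0"
    and "jc \<in> L2 (lebesgue_on \<Omega>)" and "ud \<in> L2 (lebesgue_on \<Omega>)"
    and "\<alpha> > 0" and "\<beta> > 0"
    and "control_to_state_map \<Omega> \<mu> \<kappa> \<omega> jc S"
  shows "\<exists>zbar \<in> control_space \<Omega>.
    (\<forall>z \<in> control_space \<Omega>. cost \<Omega> S ud \<alpha> \<beta> zbar \<le> cost \<Omega> S ud \<alpha> \<beta> z) \<and>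
    (\<forall>z' \<in> control_space \<Omega>.
       (\<forall>z \<in> control_space \<Omega>. cost \<Omega> S ud \<alpha> \<beta> z' \<le> cost \<Omega> S ud \<alpha> \<beta> z) \<longrightarrow>
       (AE x in surface \<Omega>. z' x = zbar x))"
proof -
  interpret eddy_current \<Omega> \<mu> \<kappa> \<omega> by standard (fact assms)+
  interpret Z: complete_seminorm_on "control_space \<Omega>" control_norm by (rule control_norm_complete)
  note jc = assms(5) and ud = assms(6) and S = assms(9)
  let ?Z = "control_space \<Omega>"
  let ?J = "cost \<Omega> S ud \<alpha> \<beta>"
  have S_state: "state jc z (S z)" if "z \<in> ?Z" for z
    using S that by (simp add: control_to_state_map_def)
  have S_L2: "S z \<in> L2 D" if "z \<in> ?Z" for z by (rule Hcurl_L2[OF is_state_Hcurl[OF S_state[OF that]]])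
  have J: "?J z = 1/2 * (l2norm D (S z - ud))\<^sup>2 + \<alpha>/2 * (l2norm \<Gamma> (surface_curl \<Omega> z))\<^sup>2 + \<beta>/2 * (l2norm \<Gamma> z)\<^sup>2" for z
    by (simp add: cost_def l2norm_sq)
  \<comment> \<open>the midpoint identity contributes \<open>\<alpha> / 8\<close> and \<open>\<beta> / 8\<close>; another factor 2 is lost in passing from
    the sum of the two squared norms to the square of their sum\<close>
  define c where "c = min \<alpha> \<beta> / 16"
  have c: "c > 0" using assms(7,8) by (simp add: c_def)
  have midpoint: "?J ((1/2) *\<^sub>R (x + y)) \<le> (?J x + ?J y) / 2 - c * (control_norm (x - y))\<^sup>2"
    if xy: "x \<in> ?Z" "y \<in> ?Z" for x y
  proof -
    define m where "m = (1/2) *\<^sub>R (x + y)"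
    have s: "x + y \<in> ?Z" by (rule control_space_add(1)[OF xy])
    have m: "m \<in> ?Z" unfolding m_def by (rule control_space_scaleR(1)[OF s])
    note Lx = control_spaceD[OF xy(1)] and Ly = control_spaceD[OF xy(2)]
    have "state ((1/2) *\<^sub>R (jc + jc)) m ((1/2) *\<^sub>R (S x + S y))"
      unfolding m_def by (rule is_state_scaleR[OF is_state_add[OF S_state[OF xy(1)] S_state[OF xy(2)] jc jc Lx(1) Ly(1)] L2_add[OF jc jc] L2_add[OF Lx(1) Ly(1)]])
    moreover have "(1/2) *\<^sub>R (jc + jc) = jc" by (simp add: fun_eq_iff flip: scaleR_2)
    ultimately have "state jc m ((1/2) *\<^sub>R (S x + S y))" by simp
    then have "AE t in D. S m t = ((1/2) *\<^sub>R (S x + S y)) t"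
      by (rule state_unique(1)[OF S_state[OF m] _ jc control_spaceD(1)[OF m]])
    moreover have "(1/2) *\<^sub>R (a + b) - u = (1/2) *\<^sub>R ((a - u) + (b - u))" for a b u :: "complex^3"
    proof -
      have "(a - u) + (b - u) = (a + b) - 2 *\<^sub>R u" by (simp add: scaleR_2)
      then show ?thesis by (simp only: scaleR_diff_right) simp
    qed
    ultimately have "AE t in D. (S m - ud) t = ((1/2) *\<^sub>R ((S x - ud) + (S y - ud))) t"
      by (auto elim: eventually_mono simp del: scaleR_add_right)
    then have "l2norm D (S m - ud) = l2norm D ((1/2) *\<^sub>R ((S x - ud) + (S y - ud)))"
      by (rule l2norm_cong_AE[OF _ L2_diff[OF S_L2[OF m] ud] L2_scaleR[OF L2_add[OF L2_diff[OF S_L2[OF xy(1)] ud] L2_diff[OF S_L2[OF xy(2)] ud]]]])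
    then have "(l2norm D (S m - ud))\<^sup>2 =
        ((l2norm D (S x - ud))\<^sup>2 + (l2norm D (S y - ud))\<^sup>2) / 2 - (l2norm D ((S x - ud) - (S y - ud)))\<^sup>2 / 4"
      by (simp only: l2norm_midpoint[OF L2_diff[OF S_L2[OF xy(1)] ud] L2_diff[OF S_L2[OF xy(2)] ud]])
    moreover have "0 \<le> (l2norm D ((S x - ud) - (S y - ud)))\<^sup>2 / 4" by simp
    ultimately have 1: "(l2norm D (S m - ud))\<^sup>2 \<le> ((l2norm D (S x - ud))\<^sup>2 + (l2norm D (S y - ud))\<^sup>2) / 2"
      by linarith
    have "AE t in \<Gamma>. surface_curl \<Omega> m t = ((1/2) *\<^sub>R (surface_curl \<Omega> x + surface_curl \<Omega> y)) t"
      using control_space_scaleR(2)[OF s, of "1/2"] control_space_add(2)[OF xy] unfolding m_def by eventually_elim simp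
    then have "l2norm \<Gamma> (surface_curl \<Omega> m) = l2norm \<Gamma> ((1/2) *\<^sub>R (surface_curl \<Omega> x + surface_curl \<Omega> y))"
      by (rule l2norm_cong_AE[OF _ control_spaceD(2)[OF m] L2_scaleR[OF L2_add[OF Lx(2) Ly(2)]]])
    then have 2: "(l2norm \<Gamma> (surface_curl \<Omega> m))\<^sup>2 = ((l2norm \<Gamma> (surface_curl \<Omega> x))\<^sup>2 + (l2norm \<Gamma> (surface_curl \<Omega> y))\<^sup>2) / 2 -
        (l2norm \<Gamma> (surface_curl \<Omega> (x - y)))\<^sup>2 / 4"
      using l2norm_midpoint[OF Lx(2) Ly(2)] control_space_diff(2)[OF xy] by simp
    have 3: "(l2norm \<Gamma> m)\<^sup>2 = ((l2norm \<Gamma> x)\<^sup>2 + (l2norm \<Gamma> y)\<^sup>2) / 2 - (l2norm \<Gamma> (x - y))\<^sup>2 / 4"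
      unfolding m_def by (rule l2norm_midpoint[OF Lx(1) Ly(1)])
    define p q where "p = l2norm \<Gamma> (x - y)" and "q = l2norm \<Gamma> (surface_curl \<Omega> (x - y))"
    have "(control_norm (x - y))\<^sup>2 \<le> 2 * p\<^sup>2 + 2 * q\<^sup>2"
      using sum_squares_bound[of p q] by (simp add: control_norm_def p_def q_def power2_sum)
    then have "c * (control_norm (x - y))\<^sup>2 \<le> c * (2 * p\<^sup>2 + 2 * q\<^sup>2)" using c by (intro mult_left_mono) auto
    also have "\<dots> = (2 * c) * p\<^sup>2 + (2 * c) * q\<^sup>2" by (simp add: algebra_simps)
    also have "\<dots> \<le> (\<beta>/8) * p\<^sup>2 + (\<alpha>/8) * q\<^sup>2"
      by (intro add_mono mult_right_mono) (auto simp: c_def)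
    finally have 4: "c * (control_norm (x - y))\<^sup>2 \<le> (\<beta>/8) * p\<^sup>2 + (\<alpha>/8) * q\<^sup>2" .
    have "?J m = 1/2 * (l2norm D (S m - ud))\<^sup>2 +
        \<alpha>/2 * (((l2norm \<Gamma> (surface_curl \<Omega> x))\<^sup>2 + (l2norm \<Gamma> (surface_curl \<Omega> y))\<^sup>2) / 2 - q\<^sup>2 / 4) +
        \<beta>/2 * (((l2norm \<Gamma> x)\<^sup>2 + (l2norm \<Gamma> y)\<^sup>2) / 2 - p\<^sup>2 / 4)"
      unfolding J 2 3 p_def q_def ..
    also have "\<dots> \<le> (?J x + ?J y) / 2 - ((\<beta>/8) * p\<^sup>2 + (\<alpha>/8) * q\<^sup>2)"
      unfolding J using 1 by (simp add: field_simps)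
    also have "\<dots> \<le> (?J x + ?J y) / 2 - c * (control_norm (x - y))\<^sup>2" using 4 by simp
    finally show ?thesis unfolding m_def .
  qed
  obtain C where C: "C \<ge> 0" "\<forall>z\<in>?Z. \<forall>z'\<in>?Z. l2norm D (S z - S z') \<le> C * control_norm (z - z')"
    using control_to_state_lipschitz[OF S jc] by blast
  have continuous: "(\<lambda>n. ?J (x n)) \<longlonglongrightarrow> ?J y"
    if x: "\<And>n :: nat. x n \<in> ?Z" and y: "y \<in> ?Z" and lim: "(\<lambda>n. control_norm (x n - y)) \<longlonglongrightarrow> 0" for x y
  proof -
    note Lx = control_spaceD[OF x] and Ly = control_spaceD[OF y]
    have "(\<lambda>n. l2norm D ((S (x n) - ud) - (S y - ud))) \<longlonglongrightarrow> 0"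
    proof (rule tendsto_sandwich[OF always_eventually always_eventually tendsto_const tendsto_mult_right_zero[OF lim]])
      show "\<forall>n. l2norm D ((S (x n) - ud) - (S y - ud)) \<le> C * control_norm (x n - y)"
        using C(2) x y by simp
    qed simp
    note 1 = l2norm_tendsto[OF L2_diff[OF S_L2[OF x] ud] L2_diff[OF S_L2[OF y] ud] this]
    have "(\<lambda>n. l2norm \<Gamma> (surface_curl \<Omega> (x n) - surface_curl \<Omega> y)) \<longlonglongrightarrow> 0"
    proof (rule tendsto_sandwich[OF always_eventually always_eventually tendsto_const lim])
      show "\<forall>n. l2norm \<Gamma> (surface_curl \<Omega> (x n) - surface_curl \<Omega> y) \<le> control_norm (x n - y)"
        using control_space_diff(2)[OF x y] by (simp add: control_norm_def)
    qed simp
    note 2 = l2norm_tendsto[OF Lx(2) Ly(2) this]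
    have "(\<lambda>n. l2norm \<Gamma> (x n - y)) \<longlonglongrightarrow> 0"
      by (rule tendsto_sandwich[OF always_eventually always_eventually tendsto_const lim]) (simp_all add: control_norm_def)
    note 3 = l2norm_tendsto[OF Lx(1) Ly(1) this]
    show ?thesis unfolding J by (intro tendsto_intros 1 2 3)
  qed
  have nonneg: "0 \<le> ?J z" for z unfolding J using assms(7,8) by simp
  obtain zbar where zbar: "zbar \<in> ?Z" "\<And>z. z \<in> ?Z \<Longrightarrow> ?J zbar \<le> ?J z"
    and unique: "\<And>z'. z' \<in> ?Z \<Longrightarrow> (\<And>z. z \<in> ?Z \<Longrightarrow> ?J z' \<le> ?J z) \<Longrightarrow> control_norm (z' - zbar) = 0"
    using Z.strongly_convex_minimum[OF nonneg c midpoint continuous] by blast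
  have "AE x in \<Gamma>. z' x = zbar x" if z': "z' \<in> ?Z" "\<forall>z\<in>?Z. ?J z' \<le> ?J z" for z'
  proof -
    have "control_norm (z' - zbar) = 0" using unique z' by blast
    then have "l2norm \<Gamma> (z' - zbar) = 0"
      using l2norm_nonneg[of \<Gamma> "z' - zbar"] l2norm_nonneg[of \<Gamma> "surface_curl \<Omega> (z' - zbar)"] unfolding control_norm_def by linarith
    then show ?thesis
      using l2norm_eq_0_iff[OF L2_diff[OF control_spaceD(1)[OF z'(1)] control_spaceD(1)[OF zbar(1)]]] by simp
  qed
  with zbar show ?thesis by blast
qed

end
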